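(* Let $p\in[2,\infty)$, $T>0$, let $\rho_0\in\mathscr P_p(\mathbb{R})$ and $v_0\in L^p(\mathbb{R},\rho_0)$, and let $M^0$ be the right-continuous cumulative distribution function of $\rho_0$, with right-continuous generalized inverse $X^0(m)=\inf\{x:M^0(x)>m\}$. Consider a flux $\mathcal U(t,m)=\sum_{i=0}^nB_i(t)\mathcal F_i(m)$ where $\mathcal F_0(m)=\mathcal V^0(m)=\int_0^m v_0(X^0(\omega))\,d\omega$, $B_0\equiv1$, and for $i=1,\dots,n$: $\mathcal F_i(m)=\int_0^mF_i(\omega)\,d\omega$ with $F_i\in L^p(0,1)$, $B_i(t)=\int_0^tb_i(s)\,ds$ with $b_i\in L^1(0,T)$; write $F_0=v_0\circ X^0$. Let $M$, with $M(t,\cdot)\in\mathscr R_p$, be the entropy solution of $\partial_tM+\partial_x\mathcal U(t,M)=0$ with initial datum $M^0$. Define $\rho(t,\cdot)=\partial_xM(t,\cdot)$ and $v(t,\cdot)=\mathcal U'_M(t,\cdot)$. Then $(\rho(t,\cdot),v(t,\cdot))\in\mathscr T_p(\mathbb{R})$ for $t\in(0,T)$ and $(\rho,v)$ is a distributional solution on $(0,T)\times\mathbb{R}$ of $$\partial_t\rho+\partial_x(\rho v)=0,\qquad\partial_t(\rho v)+\partial_x(\rho v^2)=f[\rho],\qquad f[\rho]=\sum_{i=1}^nb_i(t)\,\partial_x\mathcal F_i(M).$$ Moreover $\rho(t)\in\mathscr P_p(\mathbb{R})$ and $v(t,\cdot)\in L^p(\mathbb{R},\rho(t))$ for every $t>0$,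 and (i) $\|v(t,\cdot)\|_{L^p(\mathbb{R},\rho(t))}\le\sum_{i=0}^n|B_i(t)|\,\|F_i\|_{L^p(0,1)}$ for a.e. $t>0$; (ii) $d_{\mathscr W_p}(\rho(t),\rho(s))\le|t-s|\sum_{i=0}^n\|F_i\|_{L^p(0,1)}\|B_i\|_{L^\infty(0,T)}$ for $0\le s\le t\le T$.
   Context: $\mathscr P_p(\mathbb{R})$ is the set of Borel probability measures with finite $p$-th moment, $d_{\mathscr W_p}$ the $p$-Wasserstein distance, and $\mathscr T_p(\mathbb{R})=\{(\mu,v):\mu\in\mathscr P_p(\mathbb{R}),v\in L^p(\mathbb{R},\mu)\}$. $\mathscr R$ is the set of nondecreasing right-continuous functions $\mathbb{R}\to\mathbb{R}$ with limits $0$ at $-\infty$ and $1$ at $+\infty$; $\mathscr R_p$ those whose derivative has finite $p$-th moment. For a cumulative distribution function $M(t,\cdot)$, $\mathcal U'_M(t,\cdot)$ denotes the Radon–Nikodym derivative of the measure $\partial_x\mathcal U(t,M(t,\cdot))$ with respect to $\partial_xM(t,\cdot)$; it equals $\sum_iB_i(t)F_i(M(t,x))$ where $M(t,\cdot)$ has no jump and $(\mathcal U(t,M(t,x))-\mathcal U(t,M(t,x-)))/(M(t,x)-M(t,x-))$ at a jump. An entropy solution with initial datum $M^0$ is $M\in L^\infty((0,T)\times\mathbb{R})\cap C([0,T];L^1_{\mathrm{loc}}(\mathbb{R}))$ with $\int_0^T\!\int(|M-k|\varphi_t+\operatorname{sgn}(M-k)(\mathcal U(t,M)-\mathcal U(t,k))\varphi_x)\,dx\,dt+\int|M^0-k|\varphi(0,x)\,dx\ge0$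 for all $k$ in a dense subset of $\mathbb{R}$ and all nonnegative $\varphi\in C_c^\infty([0,T)\times\mathbb{R})$. *)

theory Defs
  imports "HOL-Probability.Probability"
begin

fun higher_diff :: "nat \<Rightarrow> (real \<times> real \<Rightarrow> real) \<Rightarrow> bool" where
  "higher_diff 0 f = continuous_on UNIV f"
| "higher_diff (Suc n) f =
     (f differentiable_on UNIV \<and>
      (\<forall>w. higher_diff n (\<lambda>z. frechet_derivative f (at z) w)))"

definition smooth2 :: "(real \<times> real \<Rightarrow> real) \<Rightarrow> bool" where
  "smooth2 f \<longleftrightarrow> (\<forall>n. higher_diff n f)"

definition dt :: "(real \<times> real \<Rightarrow> real) \<Rightarrow> real \<times> real \<Rightarrow> real" where
  "dt f z = frechet_derivative f (at z) (1, 0)"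

definition dx :: "(real \<times> real \<Rightarrow> real) \<Rightarrow> real \<times> real \<Rightarrow> real" where
  "dx f z = frechet_derivative f (at z) (0, 1)"

text \<open>C_c^infinity([0,T) x R): (restrictions to [0,T) x R of) smooth functions whose
  support meets [0,T) x R in a compact set. Only values with t >= 0 matter.\<close>
definition test_fun_half :: "real \<Rightarrow> (real \<times> real \<Rightarrow> real) \<Rightarrow> bool" where
  "test_fun_half T \<phi> \<longleftrightarrow> smooth2 \<phi> \<and>
     (\<exists>K. compact K \<and> K \<subseteq> {..<T} \<times> UNIV \<and> (\<forall>z. z \<notin> K \<longrightarrow> \<phi> z = 0))"

definition test_fun_open :: "real \<Rightarrow> (real \<times> real \<Rightarrow> real) \<Rightarrow> bool" where
  "test_fun_open T \<phi> \<longleftrightarrow> smooth2 \<phi> \<and>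
     (\<exists>K. compact K \<and> K \<subseteq> {0<..<T} \<times> UNIV \<and> (\<forall>z. z \<notin> K \<longrightarrow> \<phi> z = 0))"

definition Pp :: "real \<Rightarrow> real measure \<Rightarrow> bool" where
  "Pp p \<mu> \<longleftrightarrow> prob_space \<mu> \<and> sets \<mu> = sets borel \<and> integrable \<mu> (\<lambda>x. \<bar>x\<bar> powr p)"

definition Lp :: "real \<Rightarrow> real measure \<Rightarrow> (real \<Rightarrow> real) \<Rightarrow> bool" where
  "Lp p \<mu> v \<longleftrightarrow> v \<in> borel_measurable \<mu> \<and> integrable \<mu> (\<lambda>x. \<bar>v x\<bar> powr p)"

definition Lp_norm :: "real \<Rightarrow> real measure \<Rightarrow> (real \<Rightarrow> real) \<Rightarrow> real" where
  "Lp_norm p \<mu> v = (\<integral>x. \<bar>v x\<bar> powr p \<partial>\<mu>) powr (1 / p)"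

definition Tp :: "real \<Rightarrow> real measure \<Rightarrow> (real \<Rightarrow> real) \<Rightarrow> bool" where
  "Tp p \<mu> v \<longleftrightarrow> Pp p \<mu> \<and> Lp p \<mu> v"

definition couplings :: "real measure \<Rightarrow> real measure \<Rightarrow> (real \<times> real) measure set" where
  "couplings \<mu> \<nu> = {\<pi>. prob_space \<pi> \<and> sets \<pi> = sets borel \<and>
       distr \<pi> borel fst = \<mu> \<and> distr \<pi> borel snd = \<nu>}"

definition wasserstein :: "real \<Rightarrow> real measure \<Rightarrow> real measure \<Rightarrow> real" where
  "wasserstein p \<mu> \<nu> =
     enn2real (INF \<pi>\<in>couplings \<mu> \<nu>. \<integral>\<^sup>+ z. ennreal (\<bar>fst z - snd z\<bar> powr p) \<partial>\<pi>) powr (1 / p)"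

definition cdf_class :: "(real \<Rightarrow> real) \<Rightarrow> bool" where
  "cdf_class F \<longleftrightarrow> mono F \<and> (\<forall>x. continuous (at_right x) F) \<and>
     (F \<longlongrightarrow> 0) at_bot \<and> (F \<longlongrightarrow> 1) at_top"

definition cdf_class_p :: "real \<Rightarrow> (real \<Rightarrow> real) \<Rightarrow> bool" where
  "cdf_class_p p F \<longleftrightarrow> cdf_class F \<and> integrable (interval_measure F) (\<lambda>x. \<bar>x\<bar> powr p)"

definition cdf_of :: "real measure \<Rightarrow> real \<Rightarrow> real" where
  "cdf_of \<mu> x = measure \<mu> {..x}"

definition gen_inv :: "(real \<Rightarrow> real) \<Rightarrow> real \<Rightarrow> real" where
  "gen_inv F m = Inf {x. F x > m}"

definition entropy_solution ::
  "real \<Rightarrow> (real \<Rightarrow> real \<Rightarrow> real) \<Rightarrow> (real \<Rightarrow> real) \<Rightarrow> (real \<Rightarrow> real \<Rightarrow> real) \<Rightarrow> bool" where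
  "entropy_solution T U M0 M \<longleftrightarrow>
     \<comment> \<open>M in L^infinity((0,T) x R)\<close>
     set_borel_measurable lborel ({0<..<T} \<times> UNIV) (\<lambda>z. M (fst z) (snd z)) \<and>
     (\<exists>C. AE z in lborel. z \<in> {0<..<T} \<times> UNIV \<longrightarrow> \<bar>M (fst z) (snd z)\<bar> \<le> C) \<and>
     \<comment> \<open>M in C([0,T]; L^1_loc(R))\<close>
     (\<forall>t\<in>{0..T}. \<forall>R. set_integrable lborel {-R..R} (M t)) \<and>
     (\<forall>s\<in>{0..T}. \<forall>R. ((\<lambda>t. LINT x:{-R..R}|lborel. \<bar>M t x - M s x\<bar>) \<longlongrightarrow> 0) (at s within {0..T})) \<and>
     \<comment> \<open>entropy inequalities for all k in a dense set\<close>
     (\<exists>D. closure D = UNIV \<and>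
        (\<forall>k\<in>D. \<forall>\<phi>. test_fun_half T \<phi> \<and> (\<forall>z. fst z \<ge> 0 \<longrightarrow> \<phi> z \<ge> 0) \<longrightarrow>
           (LINT z:{0<..<T} \<times> UNIV|lborel.
               \<bar>M (fst z) (snd z) - k\<bar> * dt \<phi> z
             + sgn (M (fst z) (snd z) - k) * (U (fst z) (M (fst z) (snd z)) - U (fst z) k) * dx \<phi> z)
           + (LINT x|lborel. \<bar>M0 x - k\<bar> * \<phi> (0, x)) \<ge> 0))"

definition left_lim :: "(real \<Rightarrow> real) \<Rightarrow> real \<Rightarrow> real" where
  "left_lim F x = Lim (at_left x) F"

text \<open>Density of the measure d_x U(t, M(t,.)) w.r.t. d_x M(t,.), given explicitly:
  sum_i B_i(t) F_i(M(t,x)) at continuity points of M(t,.), and the difference quotient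
  at jump points. Here Ft is the integrand sum_i B_i(t) F_i and Ut(m) = U(t,m).\<close>
definition U_prime :: "(real \<Rightarrow> real) \<Rightarrow> (real \<Rightarrow> real) \<Rightarrow> (real \<Rightarrow> real) \<Rightarrow> real \<Rightarrow> real" where
  "U_prime Ut Ft Mt x =
     (if Mt x = left_lim Mt x then Ft (Mt x)
      else (Ut (Mt x) - Ut (left_lim Mt x)) / (Mt x - left_lim Mt x))"

end

theory Submission
  imports Defs
begin

text \<open>
  Only the weak formulation is extracted from the entropy inequalities, by taking one constant
  above \<open>1\<close> and one below \<open>0\<close>. Write \<open>X\<^sub>t\<close> for the quantile function of \<open>M t\<close>, so that
  \<open>X\<^sub>t\<close> pushes Lebesgue measure on \<open>(0,1)\<close> forward to \<open>\<rho> t\<close>, and \<open>\<Phi>\<^sub>t = \<Sum>\<^sub>i B\<^sub>i(t) F\<^sub>i\<close>.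
  The key observation is that \<open>V\<^sub>t = v(t, X\<^sub>t)\<close> is the conditional expectation of \<open>\<Phi>\<^sub>t\<close> given
  \<open>X\<^sub>t\<close>: the difference quotient defining \<open>v\<close> at a jump is an average over an atom. Jensen's
  inequality then gives the \<open>L\<^sup>p\<close> bounds.

  Mollifying \<open>M\<close> in space makes it continuously differentiable in time, so the chain rule applies to
  \<open>\<G>(M)\<close> for a primitive \<open>\<G>\<close> of a continuous \<open>G\<close>. At a jump the mollified profile sweeps the whole gap
  \<open>(M(x-), M(x))\<close>, so in the limit \<open>G(M)\<close> turns into the same atom average, and
  \<open>d/dt \<integral>\<^sub>0\<^sup>1 G \<phi>(t, X\<^sub>t) dm = \<integral>\<^sub>0\<^sup>1 G (\<phi>\<^sub>t + V\<^sub>t \<phi>\<^sub>x)(t, X\<^sub>t) dm\<close>. By density this holds for all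
  \<open>G \<in> L\<^sup>2(0,1)\<close>; this is where \<open>p \<ge> 2\<close> enters.

  The choice \<open>G = 1\<close> is the continuity equation. The choices \<open>G = F\<^sub>i\<close>, combined with the weights
  \<open>B\<^sub>i\<close> and an integration by parts in time, give the momentum equation, since
  \<open>\<integral> V\<^sub>t \<xi>(X\<^sub>t) dm = \<integral> \<Phi>\<^sub>t \<xi>(X\<^sub>t) dm\<close>. Taking for \<open>G\<close> the dual element
  \<open>sgn D |D|\<^sup>p\<^sup>-\<^sup>1\<close> of the (truncated) displacement \<open>D = X\<^sub>r - X\<^sub>s\<close> bounds
  \<open>\<parallel>X\<^sub>r - X\<^sub>s\<parallel>\<^sub>p\<close>, hence the Wasserstein distance.
\<close>

section \<open>Powers, convexity and integrals over the unit interval\<close>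

text \<open>Two constants suffice because \<open>M t x\<close> lies in \<open>[0,1]\<close>: above 1
  and below 0 the sign in the entropy inequality is constant, and two opposite inequalities make an
  equation. The obstacle is the chain rule for \<G>(M). Since \<open>M t\<close> may jump in x, the
  product of \<open>G(M)\<close> with the measure \<partial>_x U(t,M) is ambiguous on atoms; zooming
  in at the scale of the mollifier decides it, because a substitution along the transition from left
  to right limit produces the mean of \<open>G\<close> over the gap. All is transported to the mass
  coordinate in \<open>(0,1)\<close>: the reference measure there is independent of time and
  \<open>G\<close> is a fixed function, so that one balance law yields all equations. The rate of
  change contains \<open>G * V t\<close>, and the momentum equation takes \<open>G = F i\<close>;
  hence the class \<open>L^2\<close>, in which both \<open>F i\<close> and \<open>V t\<close> lie.
  In the displacement estimate \<open>G\<close> depends on the two times \<open>s\<close> and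
  \<open>r\<close> only, so the balance is used once on \<open>[s, r]\<close>. Truncation makes
  \<open>G\<close> bounded, and Young's inequality with weight \<open>r - s\<close> on the velocity
  absorbs the power of the displacement.\<close>

lemma young_powr:
  fixes a b q :: real
  assumes "q \<ge> 1" "a \<ge> 0" "b \<ge> 0"
  shows "a powr (q - 1) * b \<le> (q - 1) / q * a powr q + b powr q / q"
\<comment> \<open>The conjugate exponent \<open>q / (q - 1)\<close> degenerates at
  \<open>q = 1\<close>. There \<open>a powr 0\<close> is 1, or 0 when \<open>a = 0\<close>, so the
  left side is at most \<open>b\<close>.\<close>
proof (cases "q = 1")
  case True
  then show ?thesis using assms by (auto simp: powr_def)
next
  case False
  then have q: "q > 1" using assms by simp
  have "(a powr (q - 1)) * b \<le> (a powr (q - 1)) powr (q / (q - 1)) / (q / (q - 1)) + b powr q / q"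
    using q assms by (intro Youngs_inequality) (auto simp: field_simps)
  also have "(a powr (q - 1)) powr (q / (q - 1)) = a powr q"
    using q by (simp add: powr_powr)
  finally show ?thesis using q by (simp add: field_simps)
qed

text \<open>This is the supporting line of the convex function \<bar>y\<bar>^q at \<open>c\<close>.
  Derived from Young's inequality, it asks for no differentiability at 0. Jensen's inequality on
  atoms rests on it.\<close>

lemma powr_tangent:
  fixes c y q :: real
  assumes q: "q \<ge> 1"
  shows "\<bar>c\<bar> powr q + q * sgn c * \<bar>c\<bar> powr (q - 1) * (y - c) \<le> \<bar>y\<bar> powr q"
proof -
  have 1: "\<bar>c\<bar> powr (q - 1) * \<bar>y\<bar> \<le> (q - 1) / q * \<bar>c\<bar> powr q + \<bar>y\<bar> powr q / q"
    by (rule young_powr) (use q in auto)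
  have "sgn c * y \<le> \<bar>y\<bar>" by (auto simp: sgn_if)
  then have "\<bar>c\<bar> powr (q - 1) * (sgn c * y) \<le> \<bar>c\<bar> powr (q - 1) * \<bar>y\<bar>"
    by (intro mult_left_mono) auto
  with 1 have "\<bar>c\<bar> powr (q - 1) * (sgn c * y) \<le> (q - 1) / q * \<bar>c\<bar> powr q + \<bar>y\<bar> powr q / q"
    by linarith
  then have "q * (\<bar>c\<bar> powr (q - 1) * (sgn c * y)) \<le> q * ((q - 1) / q * \<bar>c\<bar> powr q + \<bar>y\<bar> powr q / q)"
    using q by (intro mult_left_mono) auto
  also have "\<dots> = (q - 1) * \<bar>c\<bar> powr q + \<bar>y\<bar> powr q"
    using q by (simp add: field_simps)
  finally have 2: "q * (\<bar>c\<bar> powr (q - 1) * (sgn c * y)) \<le> (q - 1) * \<bar>c\<bar> powr q + \<bar>y\<bar> powr q" .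
  have "\<bar>c\<bar> powr (q - 1) * (sgn c * c) = \<bar>c\<bar> powr q"
    by (cases "c = 0") (auto simp: powr_diff sgn_if)
  moreover have "q * sgn c * \<bar>c\<bar> powr (q - 1) * (y - c) =
      q * (\<bar>c\<bar> powr (q - 1) * (sgn c * y)) - q * (\<bar>c\<bar> powr (q - 1) * (sgn c * c))"
    by (simp add: algebra_simps)
  ultimately have "q * sgn c * \<bar>c\<bar> powr (q - 1) * (y - c) =
      q * (\<bar>c\<bar> powr (q - 1) * (sgn c * y)) - q * \<bar>c\<bar> powr q"
    by simp
  moreover have "(q - 1) * \<bar>c\<bar> powr q = q * \<bar>c\<bar> powr q - \<bar>c\<bar> powr q"
    by (simp add: algebra_simps)
  ultimately show ?thesis using 2 by linarith
qed

text \<open>The two supporting lines at \<open>c = s * x + t * y\<close> are added with weights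
  \<open>s\<close> and \<open>t\<close>; their linear parts cancel.\<close>

lemma powr_abs_convex_comb:
  fixes x y s t q :: real
  assumes q: "q \<ge> 1" and st: "s \<ge> 0" "t \<ge> 0" "s + t = 1"
  shows "\<bar>s * x + t * y\<bar> powr q \<le> s * \<bar>x\<bar> powr q + t * \<bar>y\<bar> powr q"
proof -
  define c where "c = s * x + t * y"
  define k where "k = q * sgn c * \<bar>c\<bar> powr (q - 1)"
  have "s * (\<bar>c\<bar> powr q + k * (x - c)) + t * (\<bar>c\<bar> powr q + k * (y - c))
      \<le> s * \<bar>x\<bar> powr q + t * \<bar>y\<bar> powr q"
    unfolding k_def by (intro add_mono mult_left_mono powr_tangent q st)
  moreover have "s * (\<bar>c\<bar> powr q + k * (x - c)) + t * (\<bar>c\<bar> powr q + k * (y - c))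
      = (s + t) * \<bar>c\<bar> powr q + k * (s * x + t * y - (s + t) * c)"
    by (simp add: algebra_simps)
  ultimately show ?thesis using st by (simp add: c_def)
qed

text \<open>The smaller power is dominated by 1 plus the larger one. This carries \<open>F i\<close>
  from the exponent \<open>p\<close> down to 2, and from 2 down to 1.\<close>

lemma integrable_powr_le:
  fixes f :: "'a \<Rightarrow> real"
  assumes "finite_measure \<mu>" "f \<in> borel_measurable \<mu>" "integrable \<mu> (\<lambda>x. \<bar>f x\<bar> powr p)"
    and "0 \<le> q" "q \<le> p"
  shows "integrable \<mu> (\<lambda>x. \<bar>f x\<bar> powr q)"
proof -
  interpret finite_measure \<mu> by fact
  have le: "\<bar>f x\<bar> powr q \<le> 1 + \<bar>f x\<bar> powr p" for x
  proof (cases "\<bar>f x\<bar> \<le> 1")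
    case True
    then show ?thesis using assms(4) by (smt (verit) powr_le1 powr_ge_zero)
  next
    case False
    then have "\<bar>f x\<bar> powr q \<le> \<bar>f x\<bar> powr p" using assms by (intro powr_mono) auto
    then show ?thesis by simp
  qed
  show ?thesis
    by (rule Bochner_Integration.integrable_bound[of _ "\<lambda>x. 1 + \<bar>f x\<bar> powr p"])
      (use assms le in \<open>auto intro!: AE_I2 simp: abs_of_nonneg\<close>)
qed

text \<open>Minkowski's inequality with positive upper bounds \<open>a\<close>, \<open>b\<close> in
  place of the norms, so that no division by a vanishing norm occurs. The sum is
  \<open>a + b\<close> times the convex combination of \<open>f / a\<close> and \<open>g / b\<close>
  with weights \<open>a / (a + b)\<close> and \<open>b / (a + b)\<close>.\<close>

lemma integrable_powr_add:
  fixes f g :: "'a \<Rightarrow> real"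
  assumes "f \<in> borel_measurable \<mu>" "g \<in> borel_measurable \<mu>"
    and "integrable \<mu> (\<lambda>x. \<bar>f x\<bar> powr q)" "integrable \<mu> (\<lambda>x. \<bar>g x\<bar> powr q)" and q: "q \<ge> 1"
    and a: "a > 0" "(\<integral>x. \<bar>f x\<bar> powr q \<partial>\<mu>) \<le> a powr q"
    and b: "b > 0" "(\<integral>x. \<bar>g x\<bar> powr q \<partial>\<mu>) \<le> b powr q"
  shows "integrable \<mu> (\<lambda>x. \<bar>f x + g x\<bar> powr q)"
    and "(\<integral>x. \<bar>f x + g x\<bar> powr q \<partial>\<mu>) \<le> (a + b) powr q"
proof -
  define c where "c = (a + b) powr q"
  have c: "c \<ge> 0" by (simp add: c_def)
  define s where "s = a / (a + b)"
  define t where "t = b / (a + b)"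
  have st: "s \<ge> 0" "t \<ge> 0" "s + t = 1" using a(1) b(1) by (auto simp: s_def t_def simp flip: add_divide_distrib)
  let ?h = "\<lambda>x. c * (s * (\<bar>f x\<bar> powr q / a powr q) + t * (\<bar>g x\<bar> powr q / b powr q))"
  have le: "\<bar>f x + g x\<bar> powr q \<le> ?h x" for x
  proof -
    have "f x + g x = (a + b) * (s * (f x / a) + t * (g x / b))"
      using a(1) b(1) by (simp add: s_def t_def distrib_left)
    then have "\<bar>f x + g x\<bar> powr q = c * \<bar>s * (f x / a) + t * (g x / b)\<bar> powr q"
      using a(1) b(1) by (simp add: abs_mult powr_mult c_def)
    also have "\<dots> \<le> c * (s * \<bar>f x / a\<bar> powr q + t * \<bar>g x / b\<bar> powr q)"
      by (intro mult_left_mono powr_abs_convex_comb q st c)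
    also have "\<dots> = ?h x" using a(1) b(1) by (simp add: abs_divide powr_divide)
    finally show ?thesis .
  qed
  have int: "integrable \<mu> ?h" using assms(3,4) by (intro integrable_mult_right integrable_add integrable_divide) auto
  show I: "integrable \<mu> (\<lambda>x. \<bar>f x + g x\<bar> powr q)"
    by (rule Bochner_Integration.integrable_bound[OF int]) (use assms(1,2) le in \<open>auto intro!: AE_I2\<close>,
      meson abs_ge_self le order_trans)
  have "(\<integral>x. \<bar>f x + g x\<bar> powr q \<partial>\<mu>) \<le> (\<integral>x. ?h x \<partial>\<mu>)"
    by (intro integral_mono I int le)
  also have "\<dots> = c * (s * ((\<integral>x. \<bar>f x\<bar> powr q \<partial>\<mu>) / a powr q) + t * ((\<integral>x. \<bar>g x\<bar> powr q \<partial>\<mu>) / b powr q))"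
    using assms(3,4) by simp
  also have "\<dots> \<le> c * (s * 1 + t * 1)"
    using a b st by (intro mult_left_mono add_mono c) (auto simp: field_simps)
  finally show "(\<integral>x. \<bar>f x + g x\<bar> powr q \<partial>\<mu>) \<le> (a + b) powr q" using st by (simp add: c_def)
qed

lemma integral_powr_sum_le:
  fixes f :: "'i \<Rightarrow> 'a \<Rightarrow> real"
  assumes "finite I" "\<And>i. i \<in> I \<Longrightarrow> f i \<in> borel_measurable \<mu>"
    and "\<And>i. i \<in> I \<Longrightarrow> integrable \<mu> (\<lambda>x. \<bar>f i x\<bar> powr q)" and q: "q \<ge> 1"
  shows "integrable \<mu> (\<lambda>x. \<bar>\<Sum>i\<in>I. f i x\<bar> powr q) \<and>
    (\<integral>x. \<bar>\<Sum>i\<in>I. f i x\<bar> powr q \<partial>\<mu>) powr (1 / q) \<le> (\<Sum>i\<in>I. (\<integral>x. \<bar>f i x\<bar> powr q \<partial>\<mu>) powr (1 / q))"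
  using assms(1-3)
proof (induction I rule: finite_induct)
  case empty
  then show ?case using q by simp
next
  case (insert i I)
  define S where "S = (\<Sum>i\<in>I. (\<integral>x. \<bar>f i x\<bar> powr q \<partial>\<mu>) powr (1 / q))"
  define A where "A = (\<integral>x. \<bar>f i x\<bar> powr q \<partial>\<mu>)"
  define D where "D = (\<integral>x. \<bar>\<Sum>i\<in>I. f i x\<bar> powr q \<partial>\<mu>)"
  define N where "N = (\<integral>x. \<bar>f i x + (\<Sum>i\<in>I. f i x)\<bar> powr q \<partial>\<mu>)"
  have IH: "integrable \<mu> (\<lambda>x. \<bar>\<Sum>i\<in>I. f i x\<bar> powr q)" "D powr (1 / q) \<le> S"
    using insert by (auto simp: S_def D_def)
  have nn: "A \<ge> 0" "D \<ge> 0" "N \<ge> 0" by (auto simp: A_def D_def N_def)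
  have S0: "S \<ge> 0" by (auto simp: S_def intro: sum_nonneg)
  \<comment> \<open>The norms may be zero, whereas the two-term inequality wants positive bounds:
    both are enlarged by \<open>e\<close>, which is sent to 0 afterwards.\<close>
  have *: "integrable \<mu> (\<lambda>x. \<bar>f i x + (\<Sum>i\<in>I. f i x)\<bar> powr q) \<and> N powr (1 / q) \<le> A powr (1 / q) + S + 2 * e"
    if e: "e > 0" for e
  proof -
    have p: "y \<le> (y powr (1 / q) + e) powr q" if "y \<ge> 0" for y
    proof -
      have "y = (y powr (1 / q)) powr q" using q that by (simp add: powr_powr)
      also have "\<dots> \<le> (y powr (1 / q) + e) powr q" using e q by (intro powr_mono2) auto
      finally show ?thesis .
    qed
    have 1: "A \<le> (A powr (1 / q) + e) powr q" using nn by (intro p)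
    have "D \<le> (D powr (1 / q) + e) powr q" using nn by (intro p)
    also have "\<dots> \<le> (S + e) powr q" using IH(2) e q by (intro powr_mono2) auto
    finally have 2: "D \<le> (S + e) powr q" .
    have pos: "A powr (1 / q) + e > 0" "S + e > 0" using e S0 by (auto simp: add_nonneg_pos)
    note B = integrable_powr_add[of "f i" \<mu> "\<lambda>x. \<Sum>i\<in>I. f i x" q "A powr (1 / q) + e" "S + e"]
    have I: "integrable \<mu> (\<lambda>x. \<bar>f i x + (\<Sum>i\<in>I. f i x)\<bar> powr q)"
      and N: "N \<le> ((A powr (1 / q) + e) + (S + e)) powr q"
      unfolding N_def by (rule B; use insert IH q pos 1 2 in \<open>auto simp: A_def D_def\<close>)+
    have "N powr (1 / q) \<le> (((A powr (1 / q) + e) + (S + e)) powr q) powr (1 / q)"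
      using nn N q by (intro powr_mono2) auto
    also have "\<dots> = (A powr (1 / q) + e) + (S + e)" using q pos by (simp add: powr_powr)
    finally show ?thesis using I by simp
  qed
  have "N powr (1 / q) \<le> A powr (1 / q) + S"
  proof (rule field_le_epsilon)
    fix e :: real assume "e > 0"
    then show "N powr (1 / q) \<le> A powr (1 / q) + S + e" using *[of "e / 2"] by simp
  qed
  then show ?case using insert *[of 1] by (simp add: A_def S_def N_def)
qed

section \<open>Lebesgue measure on the unit interval and primitives in the mass coordinate\<close>

definition Unif :: "real measure" where
  "Unif = restrict_space lborel {0<..<1}"

lemma space_Unif [simp]: "space Unif = {0<..<1}"
  by (simp add: Unif_def space_restrict_space)

lemma sets_Unif [measurable_cong]: "sets Unif = sets (restrict_space borel {0<..<1})"
  unfolding Unif_def by (intro sets_restrict_space_cong) simp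

interpretation Unif: prob_space Unif
  by (auto simp: Unif_def emeasure_restrict_space space_restrict_space intro!: prob_spaceI)

lemma integral_Unif: "(\<integral>x. f x \<partial>Unif) = (LINT x:{0<..<1}|lborel. f x)" for f :: "real \<Rightarrow> real"
  by (simp add: Unif_def set_lebesgue_integral_def integral_restrict_space)

lemma integrable_Unif: "integrable Unif f \<longleftrightarrow> set_integrable lborel {0<..<1} f" for f :: "real \<Rightarrow> real"
  by (simp add: Unif_def set_integrable_def integrable_restrict_space)

lemma measurable_Unif: "f \<in> borel_measurable Unif \<longleftrightarrow> set_borel_measurable lborel {0<..<1} f" for f :: "real \<Rightarrow> real"
  by (simp add: Unif_def set_borel_measurable_def borel_measurable_restrict_space_iff)

lemma borel_measurable_Unif_of_borel:
  "f \<in> borel_measurable borel \<Longrightarrow> f \<in> borel_measurable Unif" for f :: "real \<Rightarrow> real"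
  by (auto simp: measurable_Unif set_borel_measurable_def)

lemma AE_Unif: "(AE x in Unif. P x) \<longleftrightarrow> (AE x in lborel. 0 < x \<and> x < 1 \<longrightarrow> P x)"
  by (subst Unif_def, subst AE_restrict_space_iff) auto

lemma AE_Unif_neq: "AE m in Unif. m \<noteq> a"
  unfolding AE_Unif using AE_lborel_singleton[of a] by eventually_elim auto

text \<open>Cutting off by an indicator gives a primitive on the whole line: it vanishes for
  \<open>y \<le> 0\<close>, is constant for \<open>y \<ge> 1\<close>, and for integrable
  \<open>G\<close> is bounded by the \<open>L^1\<close> norm.\<close>

definition prim :: "(real \<Rightarrow> real) \<Rightarrow> real \<Rightarrow> real" where
  "prim G y = (\<integral>m. indicator {..y} m * G m \<partial>Unif)"

text \<open>The left-continuous inverse, with a weak inequality where \<open>gen_inv\<close> has a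
  strict one. For a distribution function and \<open>0 < m < 1\<close> it satisfies the Galois
  relation \<open>quant F m \<le> x \<longleftrightarrow> m \<le> F x\<close>, on which the later
  Fubini arguments depend.\<close>

definition quant :: "(real \<Rightarrow> real) \<Rightarrow> real \<Rightarrow> real" where
  "quant F m = Inf {x. m \<le> F x}"

lemma integrable_Unif_indicator:
  fixes G :: "real \<Rightarrow> real"
  assumes "integrable Unif G" "A \<in> sets borel" shows "integrable Unif (\<lambda>m. indicator A m * G m)"
proof -
  have "(\<lambda>m. indicator A m :: real) \<in> borel_measurable Unif"
    using assms(2) by (intro borel_measurable_Unif_of_borel) auto
  then show ?thesis
    using borel_measurable_integrable[OF assms(1)]
    by (intro Bochner_Integration.integrable_bound[OF assms(1)] borel_measurable_times)
      (auto intro!: AE_I2 simp: indicator_def)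
qed

lemma prim_diff:
  assumes "integrable Unif G" "a \<le> b"
  shows "prim G b - prim G a = (\<integral>m. indicator {a<..b} m * G m \<partial>Unif)"
proof -
  have "prim G b - prim G a = (\<integral>m. indicator {..b} m * G m - indicator {..a} m * G m \<partial>Unif)"
    unfolding prim_def using assms by (intro Bochner_Integration.integral_diff[symmetric] integrable_Unif_indicator) auto
  also have "\<dots> = (\<integral>m. indicator {a<..b} m * G m \<partial>Unif)"
    using assms(2) by (intro Bochner_Integration.integral_cong) (auto simp: indicator_def)
  finally show ?thesis .
qed

lemma prim_0 [simp]: "prim G 0 = 0"
proof -
  have "prim G 0 = (\<integral>m. 0 \<partial>Unif)"
    unfolding prim_def by (intro Bochner_Integration.integral_cong) auto
  then show ?thesis by simp
qed

lemma prim_bound: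
  assumes "integrable Unif G" shows "\<bar>prim G y\<bar> \<le> (\<integral>m. \<bar>G m\<bar> \<partial>Unif)"
proof -
  have "\<bar>prim G y\<bar> \<le> (\<integral>m. \<bar>indicator {..y} m * G m\<bar> \<partial>Unif)"
    unfolding prim_def using integral_norm_bound[of Unif "\<lambda>m. indicator {..y} m * G m"] by simp
  also have "\<dots> \<le> (\<integral>m. \<bar>G m\<bar> \<partial>Unif)"
    using assms by (intro integral_mono integrable_abs integrable_Unif_indicator) (auto simp: indicator_def)
  finally show ?thesis .
qed

text \<open>When \<open>y\<close> tends to \<open>a\<close>, the indicators converge at every
  \<open>m \<noteq> a\<close>, and \<bar>G\<bar> dominates. The measure is abstract because the
  lemma serves both the mass coordinate (\<open>Unif\<close>) and time
  (\<open>Iv s r\<close>).\<close>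

lemma continuous_primitive:
  fixes G :: "real \<Rightarrow> real"
  assumes G: "integrable \<mu> G" and atomless: "\<And>a. AE m in \<mu>. m \<noteq> a"
    and ind: "\<And>y. (\<lambda>m. indicator {..y} m :: real) \<in> borel_measurable \<mu>"
  shows "continuous_on UNIV (\<lambda>y. \<integral>m. indicator {..y} m * G m \<partial>\<mu>)"
proof -
  have "isCont (\<lambda>y. \<integral>m. indicator {..y} m * G m \<partial>\<mu>) a" for a
  proof (subst continuous_at_sequentially, safe)
    fix u :: "nat \<Rightarrow> real" assume u: "u \<longlonglongrightarrow> a"
    have "(\<lambda>n. \<integral>m. indicator {..u n} m * G m \<partial>\<mu>) \<longlonglongrightarrow> (\<integral>m. indicator {..a} m * G m \<partial>\<mu>)"
    proof (rule integral_dominated_convergence[where w="\<lambda>m. \<bar>G m\<bar>"])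
      show "AE m in \<mu>. (\<lambda>n. indicator {..u n} m * G m) \<longlonglongrightarrow> indicator {..a} m * G m"
        using atomless[of a]
      proof eventually_elim
        case (elim m)
        have "eventually (\<lambda>n. indicator {..u n} m = (indicator {..a} m :: real)) sequentially"
        proof (cases "m < a")
          case True
          then show ?thesis using order_tendstoD(1)[OF u True] by (auto elim!: eventually_mono simp: indicator_def)
        next
          case False
          with elim have "a < m" by simp
          then show ?thesis using order_tendstoD(2)[OF u \<open>a < m\<close>] by (auto elim!: eventually_mono simp: indicator_def)
        qed
        then have "(\<lambda>n. indicator {..u n} m :: real) \<longlonglongrightarrow> indicator {..a} m"
          by (rule tendsto_eventually)
        then show ?case by (intro tendsto_mult tendsto_const)
      qed
      show "integrable \<mu> (\<lambda>m. \<bar>G m\<bar>)" using G by (rule integrable_abs)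
      show "AE m in \<mu>. norm (indicator {..u n} m * G m) \<le> \<bar>G m\<bar>" for n
        by (intro AE_I2) (simp add: indicator_def)
    qed (rule borel_measurable_times[OF ind borel_measurable_integrable[OF G]])+
    then show "((\<lambda>y. \<integral>m. indicator {..y} m * G m \<partial>\<mu>) \<circ> u) \<longlonglongrightarrow> (\<integral>m. indicator {..a} m * G m \<partial>\<mu>)"
      by (simp add: o_def)
  qed
  then show ?thesis by (simp add: continuous_at_imp_continuous_on)
qed

lemma continuous_prim:
  assumes "integrable Unif G" shows "continuous_on UNIV (prim G)"
  unfolding prim_def[abs_def]
  by (rule continuous_primitive[OF assms AE_Unif_neq borel_measurable_Unif_of_borel]) simp

lemma prim_measurable:
  assumes "integrable Unif G" shows "prim G \<in> borel_measurable borel"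
  using continuous_prim[OF assms] by (rule borel_measurable_continuous_onI)

section \<open>Quantiles of a distribution function and averaging over atoms\<close>

lemma (in pair_sigma_finite) integrable_fst_mult_snd:
  fixes f :: "'a \<Rightarrow> real" and g :: "'b \<Rightarrow> real"
  assumes f: "integrable M1 f" and g: "integrable M2 g"
  shows "integrable (M1 \<Otimes>\<^sub>M M2) (\<lambda>z. f (fst z) * g (snd z))"
proof (rule Fubini_integrable)
  have [measurable]: "f \<in> borel_measurable M1" "g \<in> borel_measurable M2" using f g by auto
  show "(\<lambda>z. f (fst z) * g (snd z)) \<in> borel_measurable (M1 \<Otimes>\<^sub>M M2)" by measurable
  have "integrable M1 (\<lambda>x. \<bar>f x\<bar> * (\<integral>y. \<bar>g y\<bar> \<partial>M2))" using f by simp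
  then show "integrable M1 (\<lambda>x. \<integral>y. norm (f (fst (x, y)) * g (snd (x, y))) \<partial>M2)"
    by (simp add: abs_mult)
qed (use g in auto)

text \<open>The space splits into the part where \<open>X\<close> misses \<open>J\<close> and
  countably many fibres over \<open>J\<close>; on a fibre it suffices to compare integrals. In the
  applications \<open>J\<close> is the set of jumps of a distribution function and the fibres are
  its atoms, seen in the mass coordinate.\<close>

lemma nn_integral_fibres_mono:
  fixes f g :: "'a \<Rightarrow> ennreal" and X :: "'a \<Rightarrow> real"
  assumes [measurable]: "f \<in> borel_measurable \<mu>" "g \<in> borel_measurable \<mu>" "X \<in> borel_measurable \<mu>"
    and J: "countable J"
    and off: "\<And>m. m \<in> space \<mu> \<Longrightarrow> X m \<notin> J \<Longrightarrow> f m \<le> g m"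
    and on: "\<And>x. x \<in> J \<Longrightarrow> (\<integral>\<^sup>+m. f m * indicator {m \<in> space \<mu>. X m = x} m \<partial>\<mu>)
      \<le> (\<integral>\<^sup>+m. g m * indicator {m \<in> space \<mu>. X m = x} m \<partial>\<mu>)"
  shows "(\<integral>\<^sup>+m. f m \<partial>\<mu>) \<le> (\<integral>\<^sup>+m. g m \<partial>\<mu>)"
proof -
  let ?A = "\<lambda>x. {m \<in> space \<mu>. X m = x}"
  have [measurable]: "J \<in> sets borel" using J by (rule sets.countable[rotated]) auto
  have meas: "?A x \<in> sets \<mu>" for x by measurable
  \<comment> \<open>The fibre integrals are summed by countable additivity of the measure with
    density \<open>h\<close>.\<close>
  have split: "(\<integral>\<^sup>+m. h m \<partial>\<mu>) = (\<integral>\<^sup>+m. h m * indicator {m \<in> space \<mu>. X m \<notin> J} m \<partial>\<mu>)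
      + (\<integral>\<^sup>+x. (\<integral>\<^sup>+m. h m * indicator (?A x) m \<partial>\<mu>) \<partial>count_space J)"
    if [measurable]: "h \<in> borel_measurable \<mu>" for h :: "'a \<Rightarrow> ennreal"
  proof -
    have "(\<integral>\<^sup>+x. (\<integral>\<^sup>+m. h m * indicator (?A x) m \<partial>\<mu>) \<partial>count_space J)
        = (\<integral>\<^sup>+x. emeasure (density \<mu> h) (?A x) \<partial>count_space J)"
      by (simp add: emeasure_density meas)
    also have "\<dots> = emeasure (density \<mu> h) (\<Union>x\<in>J. ?A x)"
      by (rule emeasure_UN_countable[symmetric]) (use J meas in \<open>auto simp: disjoint_family_on_def\<close>)
    also have "(\<Union>x\<in>J. ?A x) = {m \<in> space \<mu>. X m \<in> J}" by auto
    also have "emeasure (density \<mu> h) \<dots> = (\<integral>\<^sup>+m. h m * indicator {m \<in> space \<mu>. X m \<in> J} m \<partial>\<mu>)"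
      by (rule emeasure_density) auto
    finally have "(\<integral>\<^sup>+m. h m * indicator {m \<in> space \<mu>. X m \<notin> J} m \<partial>\<mu>)
      + (\<integral>\<^sup>+x. (\<integral>\<^sup>+m. h m * indicator (?A x) m \<partial>\<mu>) \<partial>count_space J)
      = (\<integral>\<^sup>+m. h m * indicator {m \<in> space \<mu>. X m \<notin> J} m \<partial>\<mu>) + (\<integral>\<^sup>+m. h m * indicator {m \<in> space \<mu>. X m \<in> J} m \<partial>\<mu>)"
      by simp
    also have "\<dots> = (\<integral>\<^sup>+m. h m * indicator {m \<in> space \<mu>. X m \<notin> J} m + h m * indicator {m \<in> space \<mu>. X m \<in> J} m \<partial>\<mu>)"
      by (rule nn_integral_add[symmetric]) auto
    also have "\<dots> = (\<integral>\<^sup>+m. h m \<partial>\<mu>)"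
      by (intro nn_integral_cong) (auto simp: indicator_def)
    finally show ?thesis by simp
  qed
  show ?thesis
    unfolding split[OF assms(1)] split[OF assms(2)]
  proof (rule add_mono)
    show "(\<integral>\<^sup>+m. f m * indicator {m \<in> space \<mu>. X m \<notin> J} m \<partial>\<mu>)
        \<le> (\<integral>\<^sup>+m. g m * indicator {m \<in> space \<mu>. X m \<notin> J} m \<partial>\<mu>)"
      by (intro nn_integral_mono) (auto simp: indicator_def off)
  qed (rule nn_integral_mono, simp only: space_count_space on)
qed

text \<open>A vanishing integral over a fibre says that positive and negative part have the same
  mass there. The comparison for nonnegative functions then applies in both directions.\<close>

lemma integral_fibres_zero:
  fixes f X :: "'a \<Rightarrow> real"
  assumes f: "integrable \<mu> f" and X[measurable]: "X \<in> borel_measurable \<mu>" and J: "countable J"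
    and off: "\<And>m. m \<in> space \<mu> \<Longrightarrow> X m \<notin> J \<Longrightarrow> f m = 0"
    and on: "\<And>x. x \<in> J \<Longrightarrow> (\<integral>m. f m * indicator {m \<in> space \<mu>. X m = x} m \<partial>\<mu>) = 0"
  shows "(\<integral>m. f m \<partial>\<mu>) = 0"
proof -
  have [measurable]: "f \<in> borel_measurable \<mu>" using f by auto
  have eq: "(\<integral>\<^sup>+m. ennreal (f m) * indicator {m \<in> space \<mu>. X m = x} m \<partial>\<mu>)
      = (\<integral>\<^sup>+m. ennreal (- f m) * indicator {m \<in> space \<mu>. X m = x} m \<partial>\<mu>)" if x: "x \<in> J" for x
  proof -
    let ?A = "{m \<in> space \<mu>. X m = x}"
    let ?g = "\<lambda>m. f m * indicator ?A m"
    have g: "integrable \<mu> ?g"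
      by (rule Bochner_Integration.integrable_bound[OF f]) (auto intro!: AE_I2 simp: indicator_def)
    have "enn2real (\<integral>\<^sup>+m. ennreal (?g m) \<partial>\<mu>) = enn2real (\<integral>\<^sup>+m. ennreal (- ?g m) \<partial>\<mu>)"
      using on[OF x] real_lebesgue_integral_def[OF g] by simp
    moreover have "(\<integral>\<^sup>+m. ennreal (?g m) \<partial>\<mu>) < \<infinity>" "(\<integral>\<^sup>+m. ennreal (- ?g m) \<partial>\<mu>) < \<infinity>"
      using g unfolding real_integrable_def by (auto simp: less_top)
    ultimately have "(\<integral>\<^sup>+m. ennreal (?g m) \<partial>\<mu>) = (\<integral>\<^sup>+m. ennreal (- ?g m) \<partial>\<mu>)"
      by (metis ennreal_enn2real infinity_ennreal_def)
    moreover have "(\<integral>\<^sup>+m. ennreal (?g m) \<partial>\<mu>) = (\<integral>\<^sup>+m. ennreal (f m) * indicator ?A m \<partial>\<mu>)"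
      "(\<integral>\<^sup>+m. ennreal (- ?g m) \<partial>\<mu>) = (\<integral>\<^sup>+m. ennreal (- f m) * indicator ?A m \<partial>\<mu>)"
      by (intro nn_integral_cong; auto simp: indicator_def)+
    ultimately show ?thesis by simp
  qed
  have "(\<integral>\<^sup>+m. ennreal (f m) \<partial>\<mu>) = (\<integral>\<^sup>+m. ennreal (- f m) \<partial>\<mu>)"
  proof (rule antisym)
    show "(\<integral>\<^sup>+m. ennreal (f m) \<partial>\<mu>) \<le> (\<integral>\<^sup>+m. ennreal (- f m) \<partial>\<mu>)"
      by (rule nn_integral_fibres_mono[where X=X and J=J, OF _ _ X J _ eq[THEN eq_refl]]) (simp_all add: off)
    show "(\<integral>\<^sup>+m. ennreal (- f m) \<partial>\<mu>) \<le> (\<integral>\<^sup>+m. ennreal (f m) \<partial>\<mu>)"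
      by (rule nn_integral_fibres_mono[where X=X and J=J, OF _ _ X J _ eq[symmetric, THEN eq_refl]]) (simp_all add: off)
  qed
  then show ?thesis using real_lebesgue_integral_def[OF f] by simp
qed

section \<open>Quantile function, jumps and atoms of a fixed distribution function\<close>

locale cdf_fun =
  fixes F :: "real \<Rightarrow> real"
  assumes F: "cdf_class F"
begin

lemma mono: "mono F" and cont: "continuous (at_right x) F"
  and bot: "(F \<longlongrightarrow> 0) at_bot" and top: "(F \<longlongrightarrow> 1) at_top"
  using F by (auto simp: cdf_class_def)

lemma F_mono: "x \<le> y \<Longrightarrow> F x \<le> F y"
  using mono by (rule monoD)

lemma F_nonneg: "0 \<le> F x"
  using bot by (rule tendsto_upperbound) (auto simp: eventually_at_bot_linorder F_mono intro!: exI[of _ x])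

lemma F_le_1: "F x \<le> 1"
  using top by (rule tendsto_lowerbound) (auto simp: eventually_at_top_linorder F_mono intro!: exI[of _ x])

lemma F_measurable [measurable]: "F \<in> borel_measurable borel"
  using mono by (rule borel_measurable_mono)

lemma quant_le_iff:
  assumes "0 < m" "m < 1" shows "quant F m \<le> x \<longleftrightarrow> m \<le> F x"
  using right_continuous_mono.pseudoinverse[OF right_continuous_mono.intro[OF cont mono bot top] assms, of x]
  unfolding quant_def by (rule sym)

lemma real_distribution: "real_distribution (interval_measure F)"
  by (intro real_distribution_interval_measure F_mono cont bot top)

lemma cdf_eq: "cdf (interval_measure F) = F"
  by (intro cdf_interval_measure F_mono cont bot)

lemma quant_eq: "quant F = (\<lambda>m. Inf {x. m \<le> F x})"
  by (simp add: quant_def fun_eq_iff)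

lemma distr_quant: "distr Unif borel (quant F) = interval_measure F"
proof -
  interpret cdf_distribution "interval_measure F"
    using real_distribution by (simp add: cdf_distribution_def)
  show ?thesis using distr_I_eq_M unfolding cdf_eq Unif_def quant_eq .
qed

lemma quant_measurable [measurable]: "quant F \<in> borel_measurable Unif"
proof -
  interpret cdf_distribution "interval_measure F"
    using real_distribution by (simp add: cdf_distribution_def)
  show ?thesis using measurable_CI unfolding cdf_eq quant_eq
    unfolding measurable_cong_sets[OF sets_Unif refl] .
qed

lemma left_lim_tendsto: "(F \<longlongrightarrow> left_lim F x) (at_left x)"
proof -
  interpret real_distribution "interval_measure F" by (rule real_distribution)
  have "(F \<longlongrightarrow> measure (interval_measure F) {..<x}) (at_left x)"
    using cdf_at_left[of x] unfolding cdf_eq .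
  then show ?thesis unfolding left_lim_def using tendsto_Lim[of "at_left x" F] by simp
qed

lemma left_lim_ge: "y < x \<Longrightarrow> F y \<le> left_lim F x"
  using left_lim_tendsto[of x]
  by (rule tendsto_lowerbound) (auto simp: eventually_at_left_field intro!: exI[of _ y] F_mono)

lemma left_lim_le: "left_lim F x \<le> F x"
  using left_lim_tendsto[of x]
  by (rule tendsto_upperbound) (auto simp: eventually_at_left_field intro!: exI[of _ "x - 1"] F_mono)

lemma left_lim_nonneg: "0 \<le> left_lim F x"
  using left_lim_ge[of "x - 1" x] F_nonneg[of "x - 1"] by simp

lemma mono_left_lim: "mono (left_lim F)"
proof (rule monoI)
  fix x y :: real assume "x \<le> y"
  then show "left_lim F x \<le> left_lim F y"
    using left_lim_ge[of x y] left_lim_le[of x] by (cases "x = y") auto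
qed

lemma left_lim_measurable [measurable]: "left_lim F \<in> borel_measurable borel"
  using mono_left_lim by (rule borel_measurable_mono)

definition jumps :: "real set" where "jumps = {x. F x \<noteq> left_lim F x}"

lemma countable_jumps: "countable jumps"
proof (rule countable_subset[OF _ mono_ctble_discont[OF mono]])
  show "jumps \<subseteq> {a. \<not> isCont F a}"
  proof safe
    fix x assume "x \<in> jumps" "isCont F x"
    then have "(F \<longlongrightarrow> F x) (at_left x)" by (simp add: isCont_def filterlim_at_split)
    then have "F x = left_lim F x" using left_lim_tendsto[of x] by (intro tendsto_unique[of "at_left x" F]) auto
    then show False using \<open>x \<in> jumps\<close> by (simp add: jumps_def)
  qed
qed

lemma jumps_borel [measurable]: "jumps \<in> sets borel"
  using countable_jumps by (rule sets.countable[rotated]) auto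

lemma le_F_quant: "0 < m \<Longrightarrow> m < 1 \<Longrightarrow> m \<le> F (quant F m)"
  by (subst quant_le_iff[symmetric]) auto

text \<open>If the left limit exceeded \<open>m\<close>, then \<open>F\<close> would exceed
  \<open>m\<close> already at some \<open>y < quant F m\<close>, against the Galois
  relation.\<close>

lemma left_lim_quant_le: assumes "0 < m" "m < 1" shows "left_lim F (quant F m) \<le> m"
proof (rule ccontr)
  assume "\<not> ?thesis"
  then have "eventually (\<lambda>y. m < F y) (at_left (quant F m))"
    using order_tendstoD(1)[OF left_lim_tendsto] by (simp add: not_le)
  moreover have "eventually (\<lambda>y. y < quant F m) (at_left (quant F m))"
    by (simp add: eventually_at_filter)
  ultimately have "eventually (\<lambda>y. m < F y \<and> y < quant F m) (at_left (quant F m))"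
    by (rule eventually_conj)
  then obtain y where "m < F y" "y < quant F m"
    using eventually_happens'[OF trivial_limit_at_left_real] by blast
  then show False using quant_le_iff[OF assms, of y] by simp
qed

lemma F_quant_off: "0 < m \<Longrightarrow> m < 1 \<Longrightarrow> quant F m \<notin> jumps \<Longrightarrow> F (quant F m) = m"
  using le_F_quant[of m] left_lim_quant_le[of m] by (simp add: jumps_def)

text \<open>The fibre of the quantile over \<open>x\<close> is the mass interval between left limit
  and value. Whether the lower endpoint belongs to it depends on \<open>F\<close>, so that level is
  excluded; it is a single point and is discarded almost everywhere.\<close>

lemma quant_eq_iff:
  assumes "0 < m" "m < 1" "m \<noteq> left_lim F x"
  shows "quant F m = x \<longleftrightarrow> left_lim F x < m \<and> m \<le> F x"
proof
  assume "quant F m = x"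
  then show "left_lim F x < m \<and> m \<le> F x"
    using le_F_quant[of m] left_lim_quant_le[of m] assms by auto
next
  assume *: "left_lim F x < m \<and> m \<le> F x"
  have "quant F m \<ge> x"
  proof (rule ccontr)
    assume "\<not> quant F m \<ge> x"
    then have "F (quant F m) \<le> left_lim F x" by (intro left_lim_ge) auto
    then show False using le_F_quant[OF assms(1,2)] * by simp
  qed
  then show "quant F m = x" using * quant_le_iff[OF assms(1,2), of x] by simp
qed

lemma atom_sets: "{m \<in> space Unif. quant F m = x} \<in> sets Unif"
  by measurable

lemma integrable_atom:
  fixes G :: "real \<Rightarrow> real"
  shows "integrable Unif G \<Longrightarrow> integrable Unif (\<lambda>m. G m * indicator {m \<in> space Unif. quant F m = x} m)"
  by (rule integrable_real_mult_indicator[OF atom_sets])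

lemma integral_atom:
  fixes G :: "real \<Rightarrow> real"
  assumes G: "integrable Unif G"
  shows "(\<integral>m. G m * indicator {m \<in> space Unif. quant F m = x} m \<partial>Unif) = prim G (F x) - prim G (left_lim F x)"
proof -
  have [measurable]: "G \<in> borel_measurable Unif" using G by auto
  have "(\<integral>m. G m * indicator {m \<in> space Unif. quant F m = x} m \<partial>Unif)
      = (\<integral>m. indicator {left_lim F x<..F x} m * G m \<partial>Unif)"
  proof (rule integral_cong_AE)
    show "(\<lambda>m. indicator {left_lim F x<..F x} m * G m) \<in> borel_measurable Unif"
      by (rule borel_measurable_integrable[OF integrable_Unif_indicator[OF G]]) simp
    show "(\<lambda>m. G m * indicator {m \<in> space Unif. quant F m = x} m) \<in> borel_measurable Unif"
      by measurable
    show "AE m in Unif. G m * indicator {m \<in> space Unif. quant F m = x} m = indicator {left_lim F x<..F x} m * G m"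
      using AE_Unif_neq[of "left_lim F x"] AE_space
    proof eventually_elim
      case (elim m)
      then show ?case using quant_eq_iff[of m x] by (auto simp: indicator_def)
    qed
  qed
  also have "\<dots> = prim G (F x) - prim G (left_lim F x)"
    by (rule prim_diff[symmetric, OF G left_lim_le])
  finally show ?thesis .
qed

text \<open>The conditional expectation of \<open>G\<close> given the quantile, as a function of its
  value \<open>x\<close>: the mean of \<open>G\<close> over the fibre at a jump, and
  \<open>G (F x)\<close> elsewhere. Reusing \<open>U_prime\<close> makes the velocity of the theorem
  equal to \<open>avg (Phi t)\<close> as soon as the flux is identified with a primitive on
  \<open>[0,1]\<close>.\<close>

definition avg :: "(real \<Rightarrow> real) \<Rightarrow> real \<Rightarrow> real" where
  "avg G = U_prime (prim G) G F"

lemma avg_off: "0 < m \<Longrightarrow> m < 1 \<Longrightarrow> quant F m \<notin> jumps \<Longrightarrow> avg G (quant F m) = G m"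
  using F_quant_off[of m] by (simp add: avg_def U_prime_def jumps_def)

lemma avg_on: "x \<in> jumps \<Longrightarrow> avg G x = (prim G (F x) - prim G (left_lim F x)) / (F x - left_lim F x)"
  by (simp add: avg_def U_prime_def jumps_def)

lemma avg_quant_measurable:
  assumes G: "integrable Unif G"
  shows "(\<lambda>m. avg G (quant F m)) \<in> borel_measurable Unif"
proof -
  note [measurable] = borel_measurable_integrable[OF G] prim_measurable[OF G]
  \<comment> \<open>\<open>G\<close> is measurable on the unit interval only. Off the jumps
    \<open>F (quant F m) = m\<close>, so \<open>G m\<close> stands in for the composition.\<close>
  have "(\<lambda>m. if quant F m \<in> jumps then
      (prim G (F (quant F m)) - prim G (left_lim F (quant F m))) / (F (quant F m) - left_lim F (quant F m)) else G m)
    \<in> borel_measurable Unif" by measurable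
  then show ?thesis
    by (rule measurable_cong[THEN iffD1, rotated]) (auto simp: avg_on avg_off)
qed

text \<open>The mass of a fibre is the case \<open>G = 1\<close> of \<open>integral_atom\<close>,
  the primitive of 1 being the identity on \<open>[0,1]\<close>.\<close>

lemma integral_atom_1: "(\<integral>m. indicator {m \<in> space Unif. quant F m = x} m \<partial>Unif) = F x - left_lim F x"
proof -
  have p: "prim (\<lambda>_. 1) y = y" if "0 \<le> y" "y \<le> 1" for y
  proof -
    have "prim (\<lambda>_. 1) y = (LINT m:{0<..<1}|lborel. indicator {..y} m * 1)"
      unfolding prim_def by (rule integral_Unif)
    also have "\<dots> = (\<integral>m. indicator {0<..y} m \<partial>lborel)"
      unfolding set_lebesgue_integral_def
      by (rule integral_cong_AE)
        (use AE_lborel_singleton[of 1] that in \<open>auto elim!: eventually_mono simp: indicator_def\<close>)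
    also have "\<dots> = y" using that by simp
    finally show ?thesis .
  qed
  have "(\<integral>m. 1 * indicator {m \<in> space Unif. quant F m = x} m \<partial>Unif) = prim (\<lambda>_. 1) (F x) - prim (\<lambda>_. 1) (left_lim F x)"
    by (rule integral_atom) simp
  then show ?thesis using p[OF F_nonneg F_le_1, of x]
      p[of "left_lim F x"] left_lim_nonneg[of x] left_lim_le[of x] F_le_1[of x] by simp
qed

lemma measure_atom: "measure Unif {m \<in> space Unif. quant F m = x} = F x - left_lim F x"
proof -
  define S where "S = {m \<in> space Unif. quant F m = x}"
  have "S \<inter> space Unif = S" by (auto simp: S_def)
  then have "(\<integral>m. indicator S m \<partial>Unif) = measure Unif S"
    using Bochner_Integration.integral_indicator[of Unif S] by (simp del: space_Unif)
  then show ?thesis using integral_atom_1[of x] by (simp only: S_def)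
qed

text \<open>Jensen's inequality for the conditional expectation, proved atom by atom; off the jumps
  the two integrands coincide.\<close>

lemma avg_powr:
  assumes G: "integrable Unif G" and q: "q \<ge> 1" and Gq: "integrable Unif (\<lambda>m. \<bar>G m\<bar> powr q)"
  shows "integrable Unif (\<lambda>m. \<bar>avg G (quant F m)\<bar> powr q)"
    and "(\<integral>m. \<bar>avg G (quant F m)\<bar> powr q \<partial>Unif) \<le> (\<integral>m. \<bar>G m\<bar> powr q \<partial>Unif)"
proof -
  note [measurable] = avg_quant_measurable[OF G] borel_measurable_integrable[OF G]
  have "(\<integral>\<^sup>+m. ennreal (\<bar>avg G (quant F m)\<bar> powr q) \<partial>Unif) \<le> (\<integral>\<^sup>+m. ennreal (\<bar>G m\<bar> powr q) \<partial>Unif)"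
  proof (rule nn_integral_fibres_mono[where X="quant F" and J=jumps])
    fix x assume x: "x \<in> jumps"
    let ?A = "{m \<in> space Unif. quant F m = x}"
    define c where "c = avg G x"
    define h where "h = F x - left_lim F x"
    define k where "k = q * sgn c * \<bar>c\<bar> powr (q - 1)"
    have h: "h > 0" using x left_lim_le[of x] by (simp add: h_def jumps_def)
    note A = atom_sets[of x]
    have iA: "integrable Unif (\<lambda>m. indicator ?A m :: real)"
      using integrable_atom[of "\<lambda>_. 1" x] by simp
    have iG: "integrable Unif (\<lambda>m. G m * indicator ?A m)" by (rule integrable_atom[OF G])
    have iq: "integrable Unif (\<lambda>m. \<bar>G m\<bar> powr q * indicator ?A m)" by (rule integrable_atom[OF Gq])
    have "(\<integral>m. G m * indicator ?A m \<partial>Unif) = c * h"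
      using h x unfolding integral_atom[OF G] by (simp add: c_def h_def avg_on)
    \<comment> \<open>The supporting line at \<open>c\<close> is integrated over the atom. Its
      linear term has integral zero because the integral of \<open>G\<close> over the atom is
      \<open>c * h\<close>.\<close>
    then have "(\<integral>m. \<bar>c\<bar> powr q * indicator ?A m + k * (G m * indicator ?A m - c * indicator ?A m) \<partial>Unif) = \<bar>c\<bar> powr q * h"
      using iA iG integral_atom_1[of x] by (simp add: h_def)
    moreover have "(\<integral>m. \<bar>c\<bar> powr q * indicator ?A m + k * (G m * indicator ?A m - c * indicator ?A m) \<partial>Unif)
        \<le> (\<integral>m. \<bar>G m\<bar> powr q * indicator ?A m \<partial>Unif)"
    proof (intro integral_mono iq)
      show "integrable Unif (\<lambda>m. \<bar>c\<bar> powr q * indicator ?A m + k * (G m * indicator ?A m - c * indicator ?A m))"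
        using iA iG by (intro Bochner_Integration.integrable_add Bochner_Integration.integrable_diff
            integrable_mult_right)
      show "\<bar>c\<bar> powr q * indicator ?A m + k * (G m * indicator ?A m - c * indicator ?A m) \<le> \<bar>G m\<bar> powr q * indicator ?A m" for m
        using powr_tangent[OF q, of c "G m"] by (auto simp: indicator_def k_def)
    qed
    ultimately have le: "\<bar>c\<bar> powr q * h \<le> (\<integral>m. \<bar>G m\<bar> powr q * indicator ?A m \<partial>Unif)" by simp
    have "(\<integral>\<^sup>+m. ennreal (\<bar>avg G (quant F m)\<bar> powr q) * indicator ?A m \<partial>Unif)
        = (\<integral>\<^sup>+m. ennreal (\<bar>c\<bar> powr q) * indicator ?A m \<partial>Unif)"
      by (intro nn_integral_cong) (auto simp: indicator_def c_def)
    also have "\<dots> = ennreal (\<bar>c\<bar> powr q) * emeasure Unif ?A"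
      using A by (simp add: nn_integral_cmult_indicator)
    also have "emeasure Unif ?A = ennreal h"
      unfolding Unif.emeasure_eq_measure measure_atom h_def ..
    also have "ennreal (\<bar>c\<bar> powr q) * ennreal h = ennreal (\<bar>c\<bar> powr q * h)"
      using h by (simp add: ennreal_mult)
    also have "\<dots> \<le> ennreal (\<integral>m. \<bar>G m\<bar> powr q * indicator ?A m \<partial>Unif)" using le by (rule ennreal_leI)
    also have "\<dots> = (\<integral>\<^sup>+m. ennreal (\<bar>G m\<bar> powr q * indicator ?A m) \<partial>Unif)"
      by (rule nn_integral_eq_integral[symmetric]) (use iq in auto)
    also have "\<dots> = (\<integral>\<^sup>+m. ennreal (\<bar>G m\<bar> powr q) * indicator ?A m \<partial>Unif)"
      by (intro nn_integral_cong) (auto simp: indicator_def)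
    finally show "(\<integral>\<^sup>+m. ennreal (\<bar>avg G (quant F m)\<bar> powr q) * indicator ?A m \<partial>Unif)
      \<le> (\<integral>\<^sup>+m. ennreal (\<bar>G m\<bar> powr q) * indicator ?A m \<partial>Unif)" .
  qed (auto simp: avg_off countable_jumps)
  also have eq: "(\<integral>\<^sup>+m. ennreal (\<bar>G m\<bar> powr q) \<partial>Unif) = ennreal (\<integral>m. \<bar>G m\<bar> powr q \<partial>Unif)"
    by (rule nn_integral_eq_integral) (use Gq in auto)
  finally have le: "(\<integral>\<^sup>+m. ennreal (\<bar>avg G (quant F m)\<bar> powr q) \<partial>Unif) \<le> ennreal (\<integral>m. \<bar>G m\<bar> powr q \<partial>Unif)" .
  show int: "integrable Unif (\<lambda>m. \<bar>avg G (quant F m)\<bar> powr q)"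
    by (rule integrableI_nonneg) (use le in \<open>auto intro: le_less_trans\<close>)
  have "ennreal (\<integral>m. \<bar>avg G (quant F m)\<bar> powr q \<partial>Unif) \<le> ennreal (\<integral>m. \<bar>G m\<bar> powr q \<partial>Unif)"
    using le by (subst nn_integral_eq_integral[symmetric]) (use int in auto)
  then show "(\<integral>m. \<bar>avg G (quant F m)\<bar> powr q \<partial>Unif) \<le> (\<integral>m. \<bar>G m\<bar> powr q \<partial>Unif)"
    by (simp add: ennreal_le_iff)
qed

lemma avg_integrable:
  assumes G: "integrable Unif G"
  shows "integrable Unif (\<lambda>m. avg G (quant F m))"
    and "(\<integral>m. \<bar>avg G (quant F m)\<bar> \<partial>Unif) \<le> (\<integral>m. \<bar>G m\<bar> \<partial>Unif)"
proof -
  have "integrable Unif (\<lambda>m. \<bar>G m\<bar> powr 1)" using G by simp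
  note * = avg_powr[OF G order_refl this]
  show "integrable Unif (\<lambda>m. avg G (quant F m))"
    using *(1) avg_quant_measurable[OF G] by (simp add: integrable_abs_iff)
  show "(\<integral>m. \<bar>avg G (quant F m)\<bar> \<partial>Unif) \<le> (\<integral>m. \<bar>G m\<bar> \<partial>Unif)" using *(2) by simp
qed

text \<open>The tower property. On an atom the factor \<xi> is constant and comes out of the
  integral, leaving \<open>G\<close> minus its own mean, of integral zero; off the atoms the
  integrands agree.\<close>

lemma integral_avg:
  assumes G: "integrable Unif G"
    and 1: "integrable Unif (\<lambda>m. G m * \<xi> (quant F m))"
    and 2: "integrable Unif (\<lambda>m. avg G (quant F m) * \<xi> (quant F m))"
  shows "(\<integral>m. avg G (quant F m) * \<xi> (quant F m) \<partial>Unif) = (\<integral>m. G m * \<xi> (quant F m) \<partial>Unif)"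
proof -
  have "(\<integral>m. avg G (quant F m) * \<xi> (quant F m) - G m * \<xi> (quant F m) \<partial>Unif) = 0"
  proof (rule integral_fibres_zero[where X="quant F" and J=jumps])
    fix x assume x: "x \<in> jumps"
    let ?A = "{m \<in> space Unif. quant F m = x}"
    have iA: "integrable Unif (\<lambda>m. indicator ?A m :: real)"
      using integrable_atom[of "\<lambda>_. 1" x] by simp
    have iG: "integrable Unif (\<lambda>m. G m * indicator ?A m)" by (rule integrable_atom[OF G])
    have "(\<integral>m. (avg G (quant F m) * \<xi> (quant F m) - G m * \<xi> (quant F m)) * indicator ?A m \<partial>Unif)
      = (\<integral>m. \<xi> x * (avg G x * indicator ?A m - G m * indicator ?A m) \<partial>Unif)"
      by (intro Bochner_Integration.integral_cong) (auto simp: indicator_def algebra_simps)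
    also have "\<dots> = \<xi> x * (avg G x * (F x - left_lim F x) - (prim G (F x) - prim G (left_lim F x)))"
      using iA iG integral_atom_1[of x] integral_atom[OF G, of x] by simp
    also have "\<dots> = 0" using x by (simp add: avg_on jumps_def)
    finally show "(\<integral>m. (avg G (quant F m) * \<xi> (quant F m) - G m * \<xi> (quant F m)) * indicator ?A m \<partial>Unif) = 0" .
  qed (use 1 2 countable_jumps in \<open>auto simp: avg_off\<close>)
  then show ?thesis using 1 2 by simp
qed

lemma integral_quant:
  fixes f :: "real \<Rightarrow> real"
  assumes "f \<in> borel_measurable borel"
  shows "(\<integral>x. f x \<partial>interval_measure F) = (\<integral>m. f (quant F m) \<partial>Unif)"
  unfolding distr_quant[symmetric] using assms by (intro integral_distr) auto

lemma integrable_quant: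
  fixes f :: "real \<Rightarrow> real"
  assumes "f \<in> borel_measurable borel"
  shows "integrable (interval_measure F) f \<longleftrightarrow> integrable Unif (\<lambda>m. f (quant F m))"
  unfolding distr_quant[symmetric] using assms by (intro integrable_distr_eq) auto

text \<open>Integration by parts between mass and space. \<open>Z\<close> is the antiderivative of
  \<zeta> that vanishes at plus infinity; by Fubini and
  \<open>quant F m \<le> y \<longleftrightarrow> m \<le> F y\<close>, the mass integral at fixed
  \<open>y\<close> becomes \<open>prim G (F y)\<close>. Statements about quantiles thereby become
  statements about the distribution function.\<close>

lemma integral_tail_quant:
  fixes \<zeta> :: "real \<Rightarrow> real"
  assumes G: "integrable Unif G" and z: "integrable lborel \<zeta>"
    and Z: "\<And>x. Z x = - (\<integral>y. indicator {x..} y * \<zeta> y \<partial>lborel)"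
  shows "(\<integral>m. G m * Z (quant F m) \<partial>Unif) = - (\<integral>x. prim G (F x) * \<zeta> x \<partial>lborel)"
proof -
  interpret L: pair_sigma_finite Unif "lborel :: real measure"
    by (rule pair_sigma_finite.intro) (auto intro: Unif.sigma_finite_measure_axioms lborel.sigma_finite_measure_axioms)
  have [measurable]: "G \<in> borel_measurable Unif" "\<zeta> \<in> borel_measurable borel" using G z by auto
  let ?f = "\<lambda>(m, y). G m * (indicator {quant F m..} y * \<zeta> y)"
  have "(\<lambda>z. G (fst z) * ((if quant F (fst z) \<le> snd z then 1 else 0) * \<zeta> (snd z))) \<in> borel_measurable (Unif \<Otimes>\<^sub>M lborel)"
    by measurable
  then have meas: "?f \<in> borel_measurable (Unif \<Otimes>\<^sub>M lborel)"
    by (rule measurable_cong[THEN iffD1, rotated]) (auto simp: indicator_def)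
  have int: "integrable (Unif \<Otimes>\<^sub>M lborel) ?f"
  proof (rule Bochner_Integration.integrable_bound[OF _ meas])
    show "integrable (Unif \<Otimes>\<^sub>M lborel) (\<lambda>z. G (fst z) * \<zeta> (snd z))"
      by (rule L.integrable_fst_mult_snd[OF G z])
  qed (auto intro!: AE_I2 simp: indicator_def)
  have "(\<integral>m. G m * Z (quant F m) \<partial>Unif) = - (\<integral>m. (\<integral>y. ?f (m, y) \<partial>lborel) \<partial>Unif)"
    by (simp add: Z)
  also have "(\<integral>m. (\<integral>y. ?f (m, y) \<partial>lborel) \<partial>Unif) = (\<integral>y. (\<integral>m. ?f (m, y) \<partial>Unif) \<partial>lborel)"
    using L.Fubini_integral[of "\<lambda>m y. ?f (m, y)"] int by simp
  also have "\<dots> = (\<integral>y. prim G (F y) * \<zeta> y \<partial>lborel)"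
  proof (intro Bochner_Integration.integral_cong refl)
    fix y :: real
    have "(\<integral>m. ?f (m, y) \<partial>Unif) = (\<integral>m. (indicator {..F y} m * G m) * \<zeta> y \<partial>Unif)"
      by (intro Bochner_Integration.integral_cong) (auto simp: indicator_def quant_le_iff)
    also have "\<dots> = prim G (F y) * \<zeta> y" unfolding prim_def by simp
    finally show "(\<integral>m. ?f (m, y) \<partial>Unif) = prim G (F y) * \<zeta> y" .
  qed
  finally show ?thesis .
qed

end

section \<open>Mollification\<close>

text \<open>For \<open>k = 0\<close> this is the standard flat function. The index \<open>k\<close>
  is there because the derivative of \<open>hfun k\<close> is a combination of
  \<open>hfun (k + 1)\<close> and \<open>hfun (k + 2)\<close>: the family generates a class closed
  under differentiation, from which smoothness of every order follows by induction.\<close>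

definition hfun :: "nat \<Rightarrow> real \<Rightarrow> real" where
  "hfun k y = (if y > 0 then inverse y ^ k * exp (- inverse y) else 0)"

lemma hfun_nonneg: "0 \<le> hfun k y"
  by (simp add: hfun_def)

lemma hfun_tendsto_0: "(hfun k \<longlongrightarrow> 0) (at 0)"
proof (rule filterlim_split_at)
  have "((\<lambda>y. inverse y ^ k / exp (inverse y)) \<longlongrightarrow> (0::real)) (at_right 0)"
    by (rule filterlim_compose[OF tendsto_power_div_exp_0 filterlim_inverse_at_top_right])
  then show "(hfun k \<longlongrightarrow> 0) (at_right 0)"
    by (rule Lim_transform_eventually)
      (auto simp: eventually_at_filter hfun_def exp_minus field_simps)
  show "(hfun k \<longlongrightarrow> 0) (at_left 0)"
    by (rule tendsto_eventually) (auto simp: eventually_at_filter hfun_def)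
qed

lemma hfun_has_derivative:
  "(hfun k has_real_derivative (hfun (Suc (Suc k)) y - real k * hfun (Suc k) y)) (at y)"
proof -
  consider "y > 0" | "y < 0" | "y = 0" by linarith
  then show ?thesis
  proof cases
    case 1
    have d: "((\<lambda>y. inverse y ^ k * exp (- inverse y)) has_real_derivative
        (inverse y ^ Suc (Suc k) * exp (- inverse y) - real k * (inverse y ^ Suc k * exp (- inverse y)))) (at y)"
    proof -
      have i: "((\<lambda>y. inverse y) has_real_derivative - (inverse y ^ 2)) (at y)"
        using 1 by (auto intro!: derivative_eq_intros simp: power2_eq_square)
      show ?thesis
        by (rule DERIV_cong[OF DERIV_mult[OF DERIV_power[OF i] DERIV_chain2[OF DERIV_exp DERIV_minus[OF i]]]])
          (cases k; simp add: algebra_simps power2_eq_square)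
    qed
    have "eventually (\<lambda>x. inverse x ^ k * exp (- inverse x) = hfun k x) (nhds y)"
      using eventually_nhds_in_open[of "{0<..}" y] 1
      by (auto elim!: eventually_mono simp: hfun_def)
    from DERIV_cong_ev[OF refl this refl, THEN iffD1, OF d]
    have "(hfun k has_real_derivative (inverse y ^ Suc (Suc k) * exp (- inverse y)
        - real k * (inverse y ^ Suc k * exp (- inverse y)))) (at y)" .
    also have "inverse y ^ Suc (Suc k) * exp (- inverse y) - real k * (inverse y ^ Suc k * exp (- inverse y))
        = hfun (Suc (Suc k)) y - real k * hfun (Suc k) y"
      using 1 by (simp add: hfun_def)
    finally show ?thesis .
  next
    case 2
    have "eventually (\<lambda>x. 0 = hfun k x) (nhds y)"
      using eventually_nhds_in_open[of "{..<0}" y] 2 by (auto elim!: eventually_mono simp: hfun_def)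
    from DERIV_cong_ev[OF refl this refl, THEN iffD1, OF DERIV_const]
    show ?thesis using 2 by (simp add: hfun_def[of "Suc _"])
  next
    \<comment> \<open>The difference quotient of \<open>hfun k\<close> at 0 is
      \<open>hfun (Suc k)\<close>, which tends to 0.\<close>
    case 3
    have "((\<lambda>h. (hfun k (0 + h) - hfun k 0) / h) \<longlongrightarrow> 0) (at 0)"
      by (rule Lim_transform_eventually[OF hfun_tendsto_0[of "Suc k"]])
        (auto simp: eventually_at_filter hfun_def field_simps)
    then show ?thesis using 3 by (simp add: DERIV_def hfun_def)
  qed
qed

lemma continuous_hfun: "continuous_on A (hfun k)"
  by (intro continuous_at_imp_continuous_on ballI DERIV_isCont[OF hfun_has_derivative])

definition bump0 :: "real \<Rightarrow> real" where
  "bump0 y = hfun 0 (1 + y) * hfun 0 (1 - y)"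

definition bump :: "real \<Rightarrow> real" where
  "bump y = bump0 y / (\<integral>u. bump0 u \<partial>lborel)"

lemma continuous_bump0: "continuous_on A bump0"
  unfolding bump0_def by (intro continuous_intros continuous_on_compose2[OF continuous_hfun[of UNIV]]) auto

lemma bump0_nonneg: "0 \<le> bump0 y"
  by (simp add: bump0_def hfun_nonneg)

lemma bump0_eq_0: "\<bar>y\<bar> \<ge> 1 \<Longrightarrow> bump0 y = 0"
  by (auto simp: bump0_def hfun_def abs_if split: if_splits)

lemma integrable_continuous_cpt_support:
  fixes f :: "real \<Rightarrow> real"
  assumes "continuous_on UNIV f" "\<And>x. \<bar>x\<bar> > R \<Longrightarrow> f x = 0"
  shows "integrable lborel f"
proof -
  have "set_integrable lborel {-R..R} f"
    by (rule borel_integrable_atLeastAtMost') (use assms(1) continuous_on_subset in blast)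
  then show ?thesis unfolding set_integrable_def
    by (rule back_subst[of "integrable lborel"]) (use assms(2) in \<open>auto simp: indicator_def fun_eq_iff abs_le_iff not_le intro: ccontr\<close>)
qed

lemma integrable_bump0: "integrable lborel bump0"
  by (rule integrable_continuous_cpt_support[where R=1]) (auto simp: continuous_bump0 bump0_eq_0)

text \<open>A zero integral would make \<open>bump0\<close> vanish almost everywhere, but it is
  positive on \<open>(-1,1)\<close>, a set of measure 2.\<close>

lemma integral_bump0_pos: "(\<integral>u. bump0 u \<partial>lborel) > 0"
proof (rule ccontr)
  assume "\<not> ?thesis"
  then have "(\<integral>u. bump0 u \<partial>lborel) = 0"
    using Bochner_Integration.integral_nonneg[of lborel bump0] bump0_nonneg by (intro order.antisym) auto
  then have "AE u in lborel. bump0 u = 0"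
    using integral_nonneg_eq_0_iff_AE[OF integrable_bump0] bump0_nonneg by simp
  then have "AE u in lborel. u \<notin> {-1<..<1::real}"
    by eventually_elim (auto simp: bump0_def hfun_def split: if_splits)
  then have "emeasure lborel {-1<..<1::real} = 0"
    by (subst (asm) AE_iff_measurable[where N="{-1<..<1}"]) auto
  moreover have "emeasure lborel {-1<..<1::real} = ennreal 2"
    by (subst emeasure_lborel_Ioo) auto
  ultimately show False by (simp only: ennreal_eq_0_iff)
qed

lemma bump_nonneg: "0 \<le> bump y"
  using integral_bump0_pos by (simp add: bump_def bump0_nonneg)

lemma bump_eq_0: "\<bar>y\<bar> \<ge> 1 \<Longrightarrow> bump y = 0"
  by (simp add: bump_def bump0_eq_0)

lemma bump_neq_0: "bump y \<noteq> 0 \<Longrightarrow> -1 < y \<and> y < 1"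
  using bump_eq_0[of y] by (cases "\<bar>y\<bar> \<ge> 1") auto

lemma continuous_bump: "continuous_on A bump"
  unfolding bump_def by (intro continuous_intros continuous_bump0) (use integral_bump0_pos in auto)

lemma bump_measurable [measurable]: "bump \<in> borel_measurable borel"
  by (rule borel_measurable_continuous_onI) (rule continuous_bump)

lemma integrable_bump: "integrable lborel bump"
  unfolding bump_def by (intro integrable_divide integrable_bump0)

lemma integral_bump: "(\<integral>u. bump u \<partial>lborel) = 1"
  using integral_bump0_pos by (simp add: bump_def)

lemma integrable_times_bump:
  fixes f :: "real \<Rightarrow> real"
  assumes [measurable]: "f \<in> borel_measurable borel" and C: "\<And>x. \<bar>x\<bar> < 1 \<Longrightarrow> \<bar>f x\<bar> \<le> C"
  shows "integrable lborel (\<lambda>x. f x * bump x)"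
proof (rule Bochner_Integration.integrable_bound)
  show "integrable lborel (\<lambda>x. C * bump x)" using integrable_bump by simp
  have "\<bar>f x * bump x\<bar> \<le> \<bar>C * bump x\<bar>" for x
  proof (cases "\<bar>x\<bar> < 1")
    case True
    with C[OF True] show ?thesis by (auto simp: abs_mult intro!: mult_right_mono)
  qed (simp add: bump_eq_0)
  then show "AE x in lborel. norm (f x * bump x) \<le> norm (C * bump x)" by simp
qed measurable

lemma integral_times_bump_bound:
  fixes f :: "real \<Rightarrow> real"
  assumes [measurable]: "f \<in> borel_measurable borel" and C: "\<And>x. \<bar>x\<bar> < 1 \<Longrightarrow> \<bar>f x\<bar> \<le> C"
  shows "\<bar>\<integral>x. f x * bump x \<partial>lborel\<bar> \<le> C"
proof -
  have "\<bar>\<integral>x. f x * bump x \<partial>lborel\<bar> \<le> (\<integral>x. \<bar>f x * bump x\<bar> \<partial>lborel)"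
    using integral_norm_bound[of lborel "\<lambda>x. f x * bump x"] by simp
  also have "\<dots> \<le> (\<integral>x. C * bump x \<partial>lborel)"
  proof (rule integral_mono)
    show "integrable lborel (\<lambda>x. \<bar>f x * bump x\<bar>)"
      using integrable_times_bump[OF assms] by (rule integrable_abs)
    show "\<bar>f x * bump x\<bar> \<le> C * bump x" for x
      using C[of x] bump_nonneg[of x] by (cases "\<bar>x\<bar> < 1") (auto simp: abs_mult bump_eq_0 intro!: mult_right_mono)
  qed (use integrable_bump in simp)
  also have "\<dots> = C" using integral_bump by simp
  finally show ?thesis .
qed

text \<open>A smoothed Heaviside function with derivative \<open>bump\<close>. It is the mollified
  profile of a unit jump, and differences of rescaled copies serve as smooth cutoffs in
  time.\<close>

definition step :: "real \<Rightarrow> real" where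
  "step y = (\<integral>u. indicator {..y} u * bump u \<partial>lborel)"

lemma integrable_ind_bump: "A \<in> sets borel \<Longrightarrow> integrable lborel (\<lambda>u. indicator A u * bump u)"
  by (rule integrable_times_bump[where C=1]) (auto simp: indicator_def)

lemma step_nonneg: "0 \<le> step y"
  unfolding step_def by (intro Bochner_Integration.integral_nonneg) (auto simp: bump_nonneg)

lemma step_mono: "x \<le> y \<Longrightarrow> step x \<le> step y"
  unfolding step_def by (intro integral_mono integrable_ind_bump) (auto simp: indicator_def bump_nonneg)

lemma step_le: "y \<le> -1 \<Longrightarrow> step y = 0"
proof -
  assume "y \<le> -1"
  then have "step y = (\<integral>u. 0 \<partial>(lborel :: real measure))"
    unfolding step_def by (intro Bochner_Integration.integral_cong) (auto simp: indicator_def bump_eq_0)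
  then show ?thesis by simp
qed

lemma step_ge: "y \<ge> 1 \<Longrightarrow> step y = 1"
proof -
  assume "y \<ge> 1"
  then have "step y = (\<integral>u. bump u \<partial>lborel)"
    unfolding step_def by (intro Bochner_Integration.integral_cong) (auto simp: indicator_def bump_eq_0)
  then show ?thesis by (simp add: integral_bump)
qed

lemma step_le_1: "step y \<le> 1"
  using step_mono[of y "max y 1"] step_ge[of "max y 1"] by simp

lemma antiderivative:
  fixes G :: "real \<Rightarrow> real"
  assumes "continuous_on UNIV G"
  obtains P where "\<And>x. (P has_real_derivative G x) (at x)"
proof -
  have "\<exists>P. \<forall>x::real. -\<infinity> < ereal x \<longrightarrow> ereal x < \<infinity> \<longrightarrow> (P has_vector_derivative G x) (at x)"
    by (rule einterval_antiderivative) (use assms in \<open>auto simp: continuous_on_eq_continuous_at\<close>)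
  then show ?thesis using that by (auto simp: has_real_derivative_iff_has_vector_derivative)
qed

lemma integral_Icc_eq_diff:
  fixes g P :: "real \<Rightarrow> real"
  assumes "\<And>x. (P has_real_derivative g x) (at x)" "continuous_on UNIV g" "a \<le> b"
  shows "(\<integral>x. indicator {a..b} x * g x \<partial>lborel) = P b - P a"
  using integral_FTC_Icc[of a b P g] assms
  by (simp add: has_real_derivative_iff_has_vector_derivative has_vector_derivative_at_within
      continuous_on_subset[OF assms(2)])

text \<open>Any antiderivative \<open>P\<close> of \<open>bump\<close> will do:
  \<open>step y = P y - P (-1)\<close> holds on both sides of -1, since \<open>bump\<close> vanishes
  to the left of it.\<close>

lemma step_has_derivative: "(step has_real_derivative bump y) (at y)"
proof -
  obtain P where P: "\<And>x. (P has_real_derivative bump x) (at x)"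
    using antiderivative[OF continuous_bump] by blast
  have eq: "step y = P y - P (-1)" if "y \<ge> -1" for y
  proof -
    have "step y = (\<integral>x. indicator {-1..y} x * bump x \<partial>lborel)"
      unfolding step_def by (intro Bochner_Integration.integral_cong) (auto simp: indicator_def bump_eq_0)
    also have "\<dots> = P y - P (-1)" by (rule integral_Icc_eq_diff[OF P continuous_bump that])
    finally show ?thesis .
  qed
  have P0: "P y - P (-1) = 0" if "y \<le> -1" for y
  proof -
    have "P (-1) - P y = (\<integral>x. indicator {y..-1} x * bump x \<partial>lborel)"
      by (rule integral_Icc_eq_diff[OF P continuous_bump that, symmetric])
    also have "\<dots> = (\<integral>x. 0 \<partial>(lborel :: real measure))"
      by (intro Bochner_Integration.integral_cong) (auto simp: indicator_def bump_eq_0)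
    finally show ?thesis by simp
  qed
  have eq': "step y = P y - P (-1)" if "y \<le> -1" for y
    using step_le[OF that] P0[OF that] by linarith
  have "step = (\<lambda>y. P y - P (-1))"
  proof (rule ext)
    show "step y = P y - P (-1)" for y using eq[of y] eq'[of y] by linarith
  qed
  then show ?thesis using DERIV_diff[OF P[of y] DERIV_const[of "P (-1)"]] by simp
qed

lemma continuous_step: "continuous_on A step"
  by (intro continuous_at_imp_continuous_on ballI DERIV_isCont[OF step_has_derivative])

lemma step_measurable [measurable]: "step \<in> borel_measurable borel"
  by (rule borel_measurable_continuous_onI) (rule continuous_step)

text \<open>Convolution with the kernel of width \<open>e\<close>, written in the rescaled variable
  \<open>u\<close>. In this form the bounds and the blow-up limit involve no change of variables;
  \<open>moll_eq_kernel\<close> gives the usual kernel form.\<close>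

definition moll :: "real \<Rightarrow> (real \<Rightarrow> real) \<Rightarrow> real \<Rightarrow> real" where
  "moll e F x = (\<integral>u. F (x - e * u) * bump u \<partial>lborel)"

lemma moll_measurable [measurable]:
  assumes [measurable]: "F \<in> borel_measurable borel" shows "moll e F \<in> borel_measurable borel"
proof -
  have "(\<lambda>x. \<integral>u. F (x - e * u) * bump u \<partial>lborel) \<in> borel_measurable lborel"
    by (rule lborel.borel_measurable_lebesgue_integral) measurable
  then show ?thesis unfolding moll_def by simp
qed

text \<open>The chain rule wants a differentiable primitive, but \<open>prim G\<close> is constant
  outside \<open>[0,1]\<close> and may have corners at 0 and 1. On \<open>[0,1]\<close> its
  increments are those of a global antiderivative \<open>P\<close>.\<close>

lemma prim_eq_diff:
  fixes G P :: "real \<Rightarrow> real"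
  assumes P: "\<And>x. (P has_real_derivative G x) (at x)" and G: "continuous_on UNIV G"
    and ab: "0 \<le> a" "a \<le> b" "b \<le> 1" and int: "integrable Unif G"
  shows "prim G b - prim G a = P b - P a"
proof -
  have "prim G b - prim G a = (\<integral>m. indicator {a<..b} m * G m \<partial>Unif)"
    by (rule prim_diff[OF int ab(2)])
  also have "\<dots> = (\<integral>m. indicator {a..b} m * G m \<partial>lborel)"
    unfolding integral_Unif set_lebesgue_integral_def
  proof (rule integral_cong_AE)
    have [measurable]: "G \<in> borel_measurable borel" using G by (rule borel_measurable_continuous_onI)
    show "(\<lambda>x. indicator {0<..<1} x *\<^sub>R (indicator {a<..b} x * G x)) \<in> borel_measurable lborel"
      "(\<lambda>x. indicator {a..b} x * G x) \<in> borel_measurable lborel" by measurable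
    show "AE x in lborel. indicator {0<..<1} x *\<^sub>R (indicator {a<..b} x * G x) = indicator {a..b} x * G x"
      using AE_lborel_singleton[of a] AE_lborel_singleton[of 1]
    proof eventually_elim
      case (elim x)
      then show ?case using ab by (auto simp: indicator_def)
    qed
  qed
  also have "\<dots> = P b - P a" by (rule integral_Icc_eq_diff[OF P G ab(2)])
  finally show ?thesis .
qed

lemma integrable_Unif_bounded:
  fixes G :: "real \<Rightarrow> real"
  assumes "continuous_on UNIV G" "\<And>x. \<bar>G x\<bar> \<le> K" shows "integrable Unif G"
proof (rule Unif.integrable_const_bound[where B=K])
  show "G \<in> borel_measurable Unif"
    by (rule borel_measurable_Unif_of_borel, rule borel_measurable_continuous_onI, rule assms(1))
qed (simp add: assms(2))

context cdf_fun
begin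

lemma moll_bounds: "0 \<le> moll e F x" "moll e F x \<le> 1"
proof -
  show "0 \<le> moll e F x" unfolding moll_def
    by (intro Bochner_Integration.integral_nonneg) (simp add: F_nonneg bump_nonneg)
  have "\<bar>moll e F x\<bar> \<le> 1" unfolding moll_def
    by (rule integral_times_bump_bound) (auto simp: F_le_1 F_nonneg abs_of_nonneg)
  then show "moll e F x \<le> 1" by simp
qed

text \<open>A zoom on \<open>z\<close> at the scale of the kernel. The point
  \<open>z + e k * (y - u)\<close> tends to \<open>z\<close> from the right for \<open>u < y\<close>
  and from the left for \<open>u > y\<close>, so \<open>F\<close> contributes its value or its left
  limit, with weights \<open>step y\<close> and \<open>1 - step y\<close>. At a jump the rescaled
  profile crosses the whole gap.\<close>

lemma moll_blowup:
  assumes e: "\<And>k. e k > 0" "e \<longlonglongrightarrow> 0"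
  shows "(\<lambda>k. moll (e k) F (z + e k * y)) \<longlonglongrightarrow> left_lim F z + (F z - left_lim F z) * step y"
proof -
  let ?l = "\<lambda>u. indicator {..y} u * bump u * (F z - left_lim F z) + left_lim F z * bump u"
  have "(\<lambda>k. \<integral>u. F (z + e k * y - e k * u) * bump u \<partial>lborel) \<longlonglongrightarrow> (\<integral>u. ?l u \<partial>lborel)"
  proof (rule integral_dominated_convergence[where w=bump])
    show "AE u in lborel. (\<lambda>k. F (z + e k * y - e k * u) * bump u) \<longlonglongrightarrow> ?l u"
      using AE_lborel_singleton[of y]
    proof eventually_elim
      case (elim u)
      have lim: "(\<lambda>k. z + e k * y - e k * u) \<longlonglongrightarrow> z + 0 * y - 0 * u"
        by (intro tendsto_intros e)
      have less: "e k * a < e k * b" if "a < b" for a b k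
        using e(1) that by (rule mult_strict_left_mono[rotated])
      show ?case
      proof (cases "u < y")
        case True
        have "filterlim (\<lambda>k. z + e k * y - e k * u) (at_right z) sequentially"
          unfolding filterlim_at
        proof (intro conjI always_eventually allI)
          fix k
          show "z + e k * y - e k * u \<in> {z<..}" "z + e k * y - e k * u \<noteq> z"
            using less[OF True, of k] by auto
        qed (use lim in simp)
        moreover have "(F \<longlongrightarrow> F z) (at_right z)" using cont[of z] by (simp add: continuous_within)
        ultimately have "(\<lambda>k. F (z + e k * y - e k * u)) \<longlonglongrightarrow> F z" by (rule filterlim_compose[rotated])
        then have "(\<lambda>k. F (z + e k * y - e k * u) * bump u) \<longlonglongrightarrow> F z * bump u" by (intro tendsto_intros)
        then show ?thesis using True by (simp add: algebra_simps)
      next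
        case False
        with elim have "u > y" by simp
        have "filterlim (\<lambda>k. z + e k * y - e k * u) (at_left z) sequentially"
          unfolding filterlim_at
        proof (intro conjI always_eventually allI)
          fix k
          show "z + e k * y - e k * u \<in> {..<z}" "z + e k * y - e k * u \<noteq> z"
            using less[OF \<open>u > y\<close>, of k] by auto
        qed (use lim in simp)
        then have "(\<lambda>k. F (z + e k * y - e k * u)) \<longlonglongrightarrow> left_lim F z"
          using left_lim_tendsto by (rule filterlim_compose[rotated])
        then have "(\<lambda>k. F (z + e k * y - e k * u) * bump u) \<longlonglongrightarrow> left_lim F z * bump u" by (intro tendsto_intros)
        then show ?thesis using \<open>u > y\<close> by simp
      qed
    qed
    show "AE u in lborel. norm (F (z + e k * y - e k * u) * bump u) \<le> bump u" for k
      by (auto simp: abs_mult F_nonneg bump_nonneg F_le_1 intro!: AE_I2 mult_left_le_one_le)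
  qed (use integrable_bump in auto)
  moreover have "(\<integral>u. ?l u \<partial>lborel) = left_lim F z + (F z - left_lim F z) * step y"
    using integrable_ind_bump[of "{..y}"] integrable_bump by (simp add: step_def integral_bump)
  ultimately show ?thesis by (simp add: moll_def)
qed

text \<open>At a jump of height \<open>h\<close> with lower value \<open>l\<close>, the substitution
  \<open>l + h * step y\<close> turns the weight \<open>bump\<close> into the uniform density
  \<open>1 / h\<close> on the gap, which gives the mean of \<open>G\<close> there. Without a jump
  the argument of \<open>G\<close> is constant and \<open>bump\<close> has integral 1.\<close>

lemma integral_profile:
  assumes G: "continuous_on UNIV G" and K: "\<And>x. \<bar>G x\<bar> \<le> K"
  shows "(\<integral>y. G (left_lim F z + (F z - left_lim F z) * step y) * bump y \<partial>lborel) = avg G z"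
proof (cases "z \<in> jumps")
  case False
  then have "F z = left_lim F z" by (simp add: jumps_def)
  then have "avg G z = G (F z)" by (simp add: avg_def U_prime_def)
  then show ?thesis using \<open>F z = left_lim F z\<close> integral_bump by simp
next
  case True
  define h where "h = F z - left_lim F z"
  define l where "l = left_lim F z"
  have h: "h \<noteq> 0" using True by (simp add: h_def jumps_def)
  obtain P where P: "\<And>x. (P has_real_derivative G x) (at x)"
    using antiderivative[OF G] by blast
  have "(\<integral>y. G (l + h * step y) * bump y \<partial>lborel)
      = (\<integral>y. indicator {-1..1} y * (G (l + h * step y) * bump y) \<partial>lborel)"
    by (intro Bochner_Integration.integral_cong) (auto simp: indicator_def dest!: bump_neq_0)
  also have "\<dots> = P (l + h * step 1) / h - P (l + h * step (-1)) / h"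
  proof (rule integral_Icc_eq_diff)
    show "((\<lambda>x. P (l + h * step x) / h) has_real_derivative G (l + h * step x) * bump x) (at x)" for x
      using h by (auto intro!: derivative_eq_intros DERIV_chain2[OF P] step_has_derivative)
    show "continuous_on UNIV (\<lambda>x. G (l + h * step x) * bump x)"
      by (intro continuous_intros continuous_on_compose2[OF G] continuous_step continuous_bump) auto
  qed simp
  also have "\<dots> = (P (F z) - P l) / h"
    by (simp add: step_ge step_le diff_divide_distrib h_def l_def)
  also have "P (F z) - P l = prim G (F z) - prim G l"
    unfolding l_def by (rule prim_eq_diff[symmetric, OF P G left_lim_nonneg left_lim_le F_le_1 integrable_Unif_bounded[OF G K]])
  finally show ?thesis using True by (simp add: avg_on h_def l_def)
qed

lemma avg_bounded:
  assumes G: "continuous_on UNIV G" and K: "\<And>x. \<bar>G x\<bar> \<le> K"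
  shows "\<bar>avg G z\<bar> \<le> K"
proof -
  have [measurable]: "G \<in> borel_measurable borel" using G by (rule borel_measurable_continuous_onI)
  show ?thesis unfolding integral_profile[OF G K, symmetric]
    by (rule integral_times_bump_bound) (auto simp: K)
qed

lemma inner_limit:
  assumes G: "continuous_on UNIV G" and K: "\<And>x. \<bar>G x\<bar> \<le> K"
    and psi: "continuous_on UNIV \<psi>" and L: "\<And>x. \<bar>\<psi> x\<bar> \<le> L"
    and e: "\<And>k. e k > 0" "e \<longlonglongrightarrow> 0"
  shows "(\<lambda>k. \<integral>y. \<psi> (z + e k * y) * G (moll (e k) F (z + e k * y)) * bump y \<partial>lborel)
    \<longlonglongrightarrow> \<psi> z * avg G z"
proof -
  have [measurable]: "G \<in> borel_measurable borel" using G by (rule borel_measurable_continuous_onI)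
  have [measurable]: "\<psi> \<in> borel_measurable borel" using psi by (rule borel_measurable_continuous_onI)
  let ?g = "\<lambda>y. G (left_lim F z + (F z - left_lim F z) * step y)"
  have "(\<lambda>k. \<integral>y. \<psi> (z + e k * y) * G (moll (e k) F (z + e k * y)) * bump y \<partial>lborel)
      \<longlonglongrightarrow> (\<integral>y. \<psi> z * ?g y * bump y \<partial>lborel)"
  proof (rule integral_dominated_convergence[where w="\<lambda>y. L * K * bump y"])
    show "AE y in lborel. (\<lambda>k. \<psi> (z + e k * y) * G (moll (e k) F (z + e k * y)) * bump y) \<longlonglongrightarrow> \<psi> z * ?g y * bump y"
    proof (intro AE_I2 tendsto_intros)
      fix y
      have "(\<lambda>k. z + e k * y) \<longlonglongrightarrow> z + 0 * y" by (intro tendsto_intros e)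
      then show "(\<lambda>k. \<psi> (z + e k * y)) \<longlonglongrightarrow> \<psi> z"
        using psi by (auto simp: continuous_on_eq_continuous_at intro!: isCont_tendsto_compose[of z \<psi>])
      show "(\<lambda>k. G (moll (e k) F (z + e k * y))) \<longlonglongrightarrow> ?g y"
        using G by (intro isCont_tendsto_compose[of _ G] moll_blowup e) (auto simp: continuous_on_eq_continuous_at)
    qed
    show "AE y in lborel. norm (\<psi> (z + e k * y) * G (moll (e k) F (z + e k * y)) * bump y) \<le> L * K * bump y" for k
    proof (rule AE_I2)
      fix y
      have "\<bar>\<psi> (z + e k * y)\<bar> * \<bar>G (moll (e k) F (z + e k * y))\<bar> \<le> L * K"
        using L[of 0] by (intro mult_mono L K) auto
      then show "norm (\<psi> (z + e k * y) * G (moll (e k) F (z + e k * y)) * bump y) \<le> L * K * bump y"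
        using bump_nonneg[of y] by (auto simp: abs_mult intro!: mult_right_mono)
    qed
  qed (use integrable_bump in auto)
  also have "(\<integral>y. \<psi> z * ?g y * bump y \<partial>lborel) = \<psi> z * avg G z"
    using integral_profile[OF G K, of z] by (simp add: mult.assoc)
  finally show ?thesis .
qed

text \<open>By Fubini the kernel centred at \<open>quant F m\<close> is integrated in
  \<open>x\<close> before \<open>m\<close>, and \<open>x = quant F m + e * y\<close> moves the scale
  into the argument of \<open>w\<close>. With \<open>w\<close> containing the mollified profile,
  this is the blow-up situation around each quantile.\<close>

lemma integral_swap_quant:
  fixes w :: "real \<Rightarrow> real"
  assumes w[measurable]: "w \<in> borel_measurable borel" and C: "\<And>x. \<bar>w x\<bar> \<le> C"
    and Phi: "integrable Unif \<Phi>" and e: "e > 0"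
  shows "(\<integral>x. w x * (\<integral>m. \<Phi> m * (bump ((x - quant F m) / e) / e) \<partial>Unif) \<partial>lborel)
    = (\<integral>m. \<Phi> m * (\<integral>y. w (quant F m + e * y) * bump y \<partial>lborel) \<partial>Unif)"
proof -
  interpret L: pair_sigma_finite Unif "lborel :: real measure"
    by (rule pair_sigma_finite.intro) (auto intro: Unif.sigma_finite_measure_axioms lborel.sigma_finite_measure_axioms)
  have [measurable]: "\<Phi> \<in> borel_measurable Unif" using Phi by auto
  let ?f = "\<lambda>(m, x). \<Phi> m * (w x * (bump ((x - quant F m) / e) / e))"
  have aff: "(\<integral>x. h x * (bump ((x - a) / e) / e) \<partial>lborel) = (\<integral>y. h (a + e * y) * bump y \<partial>lborel)" for h a
    using e by (subst lborel_integral_real_affine[of e _ a]) (auto simp: mult.assoc[symmetric] intro!: Bochner_Integration.integral_cong)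
  have affi: "integrable lborel (\<lambda>x. w x * (bump ((x - a) / e) / e))" for a
  proof -
    have "integrable lborel (\<lambda>y. w (a + e * y) * (bump ((a + e * y - a) / e) / e))"
      using e integrable_divide[OF integrable_times_bump[of "\<lambda>y. w (a + e * y)" C], of e] C by simp
    then show ?thesis using e lborel_integrable_real_affine_iff[of e "\<lambda>x. w x * (bump ((x - a) / e) / e)" a] by simp
  qed
  have meas: "?f \<in> borel_measurable (Unif \<Otimes>\<^sub>M lborel)" by measurable
  have bnd: "(\<integral>x. \<bar>w x * (bump ((x - a) / e) / e)\<bar> \<partial>lborel) \<le> C" for a
  proof -
    have "(\<integral>x. \<bar>w x * (bump ((x - a) / e) / e)\<bar> \<partial>lborel) = (\<integral>x. \<bar>w x\<bar> * (bump ((x - a) / e) / e) \<partial>lborel)"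
      using e by (intro Bochner_Integration.integral_cong) (auto simp: abs_mult bump_nonneg)
    also have "\<dots> = (\<integral>y. \<bar>w (a + e * y)\<bar> * bump y \<partial>lborel)" by (rule aff)
    also have "\<dots> \<le> C"
      using integral_times_bump_bound[of "\<lambda>y. \<bar>w (a + e * y)\<bar>" C] C by simp
    finally show ?thesis .
  qed
  have int: "integrable (Unif \<Otimes>\<^sub>M lborel) ?f"
  proof (rule L.Fubini_integrable[OF meas])
    show "integrable Unif (\<lambda>m. \<integral>x. norm (?f (m, x)) \<partial>lborel)"
    proof (rule Bochner_Integration.integrable_bound)
      show "integrable Unif (\<lambda>m. C * \<bar>\<Phi> m\<bar>)" using Phi by simp
      show "(\<lambda>m. \<integral>x. norm (?f (m, x)) \<partial>lborel) \<in> borel_measurable Unif"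
        by (rule lborel.borel_measurable_lebesgue_integral) (use meas in measurable)
      show "AE m in Unif. norm (\<integral>x. norm (?f (m, x)) \<partial>lborel) \<le> norm (C * \<bar>\<Phi> m\<bar>)"
      proof (rule AE_I2)
        fix m
        have "(\<integral>x. norm (?f (m, x)) \<partial>lborel) = \<bar>\<Phi> m\<bar> * (\<integral>x. \<bar>w x * (bump ((x - quant F m) / e) / e)\<bar> \<partial>lborel)"
          by (simp add: abs_mult)
        also have "\<dots> \<le> \<bar>\<Phi> m\<bar> * C" by (intro mult_left_mono bnd) auto
        finally have "(\<integral>x. norm (?f (m, x)) \<partial>lborel) \<le> C * \<bar>\<Phi> m\<bar>" by (simp add: mult.commute)
        moreover have "0 \<le> (\<integral>x. norm (?f (m, x)) \<partial>lborel)" by simp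
        ultimately show "norm (\<integral>x. norm (?f (m, x)) \<partial>lborel) \<le> norm (C * \<bar>\<Phi> m\<bar>)"
          by (simp only: real_norm_def)
      qed
    qed
    show "AE m in Unif. integrable lborel (\<lambda>x. ?f (m, x))"
      by (auto simp only: split_conv intro!: AE_I2 integrable_mult_right affi)
  qed
  have "(\<integral>x. w x * (\<integral>m. \<Phi> m * (bump ((x - quant F m) / e) / e) \<partial>Unif) \<partial>lborel)
      = (\<integral>x. (\<integral>m. ?f (m, x) \<partial>Unif) \<partial>lborel)"
  proof (intro Bochner_Integration.integral_cong refl)
    fix x
    have "(\<integral>m. ?f (m, x) \<partial>Unif) = (\<integral>m. w x * (\<Phi> m * (bump ((x - quant F m) / e) / e)) \<partial>Unif)"
      by (intro Bochner_Integration.integral_cong refl) (simp add: mult.left_commute)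
    also have "\<dots> = w x * (\<integral>m. \<Phi> m * (bump ((x - quant F m) / e) / e) \<partial>Unif)"
      by (rule integral_mult_right_zero)
    finally show "w x * (\<integral>m. \<Phi> m * (bump ((x - quant F m) / e) / e) \<partial>Unif) = (\<integral>m. ?f (m, x) \<partial>Unif)" ..
  qed
  also have "\<dots> = (\<integral>m. (\<integral>x. ?f (m, x) \<partial>lborel) \<partial>Unif)"
    using L.Fubini_integral[of "\<lambda>m x. ?f (m, x)"] int by simp
  also have "\<dots> = (\<integral>m. \<Phi> m * (\<integral>y. w (quant F m + e * y) * bump y \<partial>lborel) \<partial>Unif)"
    by (simp only: split_conv integral_mult_right_zero aff)
  finally show ?thesis .
qed

text \<open>For each \<open>m\<close> the inner integral converges by the blow-up at
  \<open>quant F m\<close>, with limit \<psi> times \<open>avg G\<close>. It stays below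
  \<open>L * K\<close>, so a multiple of \<bar>\<Phi>\<bar> dominates the outer integral.\<close>

lemma mollified_flux_limit:
  assumes G: "continuous_on UNIV G" and K: "\<And>x. \<bar>G x\<bar> \<le> K"
    and psi: "continuous_on UNIV \<psi>" and L: "\<And>x. \<bar>\<psi> x\<bar> \<le> L"
    and Phi: "integrable Unif \<Phi>" and e: "\<And>k. e k > 0" "e \<longlonglongrightarrow> 0"
  shows "(\<lambda>k. \<integral>x. \<psi> x * G (moll (e k) F x) * (\<integral>m. \<Phi> m * (bump ((x - quant F m) / e k) / e k) \<partial>Unif) \<partial>lborel)
    \<longlonglongrightarrow> (\<integral>m. G m * avg \<Phi> (quant F m) * \<psi> (quant F m) \<partial>Unif)"
proof -
  have Gm[measurable]: "G \<in> borel_measurable borel" using G by (rule borel_measurable_continuous_onI)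
  have psim[measurable]: "\<psi> \<in> borel_measurable borel" using psi by (rule borel_measurable_continuous_onI)
  have Gi: "integrable Unif G" by (rule integrable_Unif_bounded[OF G K])
  note [measurable] = avg_quant_measurable[OF Gi] avg_quant_measurable[OF Phi] borel_measurable_integrable[OF Phi]
    borel_measurable_integrable[OF Gi]
  have LK: "\<bar>\<psi> x * G y\<bar> \<le> L * K" for x y
    unfolding abs_mult using L[of 0] by (intro mult_mono L K) auto
  have LK': "\<bar>\<psi> x * avg G y\<bar> \<le> L * K" for x y
    unfolding abs_mult using L[of 0] by (intro mult_mono L avg_bounded[OF G K]) auto
  let ?I = "\<lambda>k m. \<integral>y. \<psi> (quant F m + e k * y) * G (moll (e k) F (quant F m + e k * y)) * bump y \<partial>lborel"
  have "(\<lambda>k. \<integral>x. \<psi> x * G (moll (e k) F x) * (\<integral>m. \<Phi> m * (bump ((x - quant F m) / e k) / e k) \<partial>Unif) \<partial>lborel)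
      = (\<lambda>k. \<integral>m. \<Phi> m * ?I k m \<partial>Unif)"
    by (intro ext integral_swap_quant[where C="L * K"] LK Phi e) measurable
  moreover have "(\<lambda>k. \<integral>m. \<Phi> m * ?I k m \<partial>Unif) \<longlonglongrightarrow> (\<integral>m. \<Phi> m * (\<psi> (quant F m) * avg G (quant F m)) \<partial>Unif)"
  proof (rule integral_dominated_convergence[where w="\<lambda>m. \<bar>\<Phi> m\<bar> * (L * K)"])
    show "AE m in Unif. (\<lambda>k. \<Phi> m * ?I k m) \<longlonglongrightarrow> \<Phi> m * (\<psi> (quant F m) * avg G (quant F m))"
      by (intro AE_I2 tendsto_intros inner_limit[OF G K psi L e])
    show "AE m in Unif. norm (\<Phi> m * ?I k m) \<le> \<bar>\<Phi> m\<bar> * (L * K)" for k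
    proof (rule AE_I2)
      fix m
      have "\<bar>?I k m\<bar> \<le> L * K" by (rule integral_times_bump_bound) (measurable, rule LK)
      then show "norm (\<Phi> m * ?I k m) \<le> \<bar>\<Phi> m\<bar> * (L * K)" by (simp add: abs_mult mult_left_mono)
    qed
    show "(\<lambda>m. \<Phi> m * ?I k m) \<in> borel_measurable Unif" for k
    proof -
      have "?I k \<in> borel_measurable Unif"
        by (rule lborel.borel_measurable_lebesgue_integral) measurable
      then show ?thesis by measurable
    qed
  qed (use Phi in auto)
  \<comment> \<open>The average migrates from \<open>G\<close> to \<Phi> by two uses of the tower
    property: \<Phi> is replaced by its average, after which the average of \<open>G\<close> is
    replaced by \<open>G\<close>.\<close>
  moreover have "(\<integral>m. \<Phi> m * (\<psi> (quant F m) * avg G (quant F m)) \<partial>Unif) = (\<integral>m. G m * avg \<Phi> (quant F m) * \<psi> (quant F m) \<partial>Unif)"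
  proof -
    have b1: "integrable Unif (\<lambda>m. f m * (\<psi> (quant F m) * avg G (quant F m)))" if f: "integrable Unif f" for f
      by (rule Bochner_Integration.integrable_bound[where f="\<lambda>m. (L * K) * f m"])
        (use f in \<open>auto simp: abs_mult[of "f _"] abs_mult[of "L * K"] mult.commute[of "\<bar>f _\<bar>"]
            intro!: AE_I2 mult_right_mono LK'[THEN order_trans]\<close>)
    have b2: "integrable Unif (\<lambda>m. f m * (avg \<Phi> (quant F m) * \<psi> (quant F m)))"
      if [measurable]: "f \<in> borel_measurable Unif" and f: "\<And>m. \<bar>f m\<bar> \<le> K" for f
    proof (rule Bochner_Integration.integrable_bound[where f="\<lambda>m. (L * K) * avg \<Phi> (quant F m)"])
      have "\<bar>f m\<bar> * \<bar>\<psi> (quant F m)\<bar> \<le> \<bar>K * L\<bar>" for m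
        using L[of 0] f[of 0] by (subst abs_of_nonneg[of "K * L"]) (auto intro!: mult_mono L f)
      then have "\<bar>f m\<bar> * \<bar>\<psi> (quant F m)\<bar> * \<bar>avg \<Phi> (quant F m)\<bar> \<le> \<bar>K * L\<bar> * \<bar>avg \<Phi> (quant F m)\<bar>" for m
        by (intro mult_right_mono) auto
      then show "AE m in Unif. norm (f m * (avg \<Phi> (quant F m) * \<psi> (quant F m))) \<le> norm (L * K * avg \<Phi> (quant F m))"
        by (intro AE_I2) (simp add: abs_mult mult_ac)
    qed (use avg_integrable(1)[OF Phi] in auto)
    have "(\<integral>m. \<Phi> m * (\<psi> (quant F m) * avg G (quant F m)) \<partial>Unif)
        = (\<integral>m. avg \<Phi> (quant F m) * (\<psi> (quant F m) * avg G (quant F m)) \<partial>Unif)"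
      using integral_avg[OF Phi, of "\<lambda>x. \<psi> x * avg G x"] b1[OF Phi] b1[OF avg_integrable(1)[OF Phi]] by simp
    also have "\<dots> = (\<integral>m. avg G (quant F m) * (avg \<Phi> (quant F m) * \<psi> (quant F m)) \<partial>Unif)"
      by (simp add: mult_ac)
    also have "\<dots> = (\<integral>m. G m * (avg \<Phi> (quant F m) * \<psi> (quant F m)) \<partial>Unif)"
      using integral_avg[OF Gi, of "\<lambda>x. avg \<Phi> x * \<psi> x"] b2[of G] b2[of "\<lambda>m. avg G (quant F m)"] K avg_bounded[OF G K]
      by simp
    finally show ?thesis by (simp add: mult.assoc)
  qed
  ultimately show ?thesis by simp
qed

end

section \<open>Weak derivatives on an interval\<close>

text \<open>The derivative of \<open>bump\<close>. The index 2 appears because the derivative of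
  \<open>hfun 0\<close> is \<open>hfun 2\<close>, the other term carrying the factor
  \<open>k = 0\<close>.\<close>

definition bumpd :: "real \<Rightarrow> real" where
  "bumpd y = (hfun 2 (1 + y) * hfun 0 (1 - y) - hfun 0 (1 + y) * hfun 2 (1 - y)) / (\<integral>u. bump0 u \<partial>lborel)"

lemma bump_has_derivative: "(bump has_real_derivative bumpd y) (at y)"
proof -
  have 1: "((\<lambda>y. hfun 0 (1 + y)) has_real_derivative hfun 2 (1 + y) * 1) (at y)"
    using hfun_has_derivative[of 0 "1 + y"]
    by (intro DERIV_chain2[of "hfun 0"]) (auto intro!: derivative_eq_intros simp: numeral_2_eq_2)
  have 2: "((\<lambda>y. hfun 0 (1 - y)) has_real_derivative hfun 2 (1 - y) * (-1)) (at y)"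
    using hfun_has_derivative[of 0 "1 - y"]
    by (intro DERIV_chain2[of "hfun 0"]) (auto intro!: derivative_eq_intros simp: numeral_2_eq_2)
  have "((\<lambda>y. hfun 0 (1 + y) * hfun 0 (1 - y)) has_real_derivative
      hfun 2 (1 + y) * 1 * hfun 0 (1 - y) + hfun 2 (1 - y) * (-1) * hfun 0 (1 + y)) (at y)"
    by (rule DERIV_mult[OF 1 2])
  from DERIV_cdivide[OF this, of "\<integral>u. bump0 u \<partial>lborel"]
  show ?thesis by (simp add: bump_def[abs_def] bump0_def[abs_def] bumpd_def mult.commute)
qed

lemma bumpd_eq_0: "\<bar>y\<bar> \<ge> 1 \<Longrightarrow> bumpd y = 0"
  by (auto simp: bumpd_def hfun_def abs_if split: if_splits)

lemma continuous_bumpd: "continuous_on A bumpd"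
  unfolding bumpd_def using integral_bump0_pos
  by (intro continuous_intros continuous_on_compose2[OF continuous_hfun[of UNIV]]) auto

lemma bumpd_measurable [measurable]: "bumpd \<in> borel_measurable borel"
  by (rule borel_measurable_continuous_onI) (rule continuous_bumpd)

lemma integrable_bumpd: "integrable lborel bumpd"
  by (rule integrable_continuous_cpt_support[where R=1]) (auto simp: continuous_bumpd bumpd_eq_0)

lemma bump_bounded: obtains C where "\<And>y. \<bar>bump y\<bar> \<le> C"
proof -
  have "bounded (bump ` {-1..1})"
    by (intro compact_imp_bounded compact_continuous_image continuous_bump compact_Icc)
  then obtain C where "\<forall>y\<in>bump ` {-1..1}. norm y \<le> C"
    unfolding bounded_iff by blast
  then have C: "\<bar>bump y\<bar> \<le> C" if "y \<in> {-1..1}" for y using that by simp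
  have "\<bar>bump y\<bar> \<le> C" for y
  proof (cases "y \<in> {-1..1}")
    case False
    then have "bump y = 0" by (intro bump_eq_0) auto
    then show ?thesis using C[of 0] by auto
  qed (rule C)
  then show ?thesis by (rule that)
qed

lemma affine_kernel:
  fixes f k :: "real \<Rightarrow> real"
  assumes "e > 0"
  shows "(\<integral>y. f y * (k ((x - y) / e) / e) \<partial>lborel) = (\<integral>u. f (x - e * u) * k u \<partial>lborel)"
    and "integrable lborel k \<Longrightarrow> integrable lborel (\<lambda>y. k ((x - y) / e) / e)"
proof -
  show "(\<integral>y. f y * (k ((x - y) / e) / e) \<partial>lborel) = (\<integral>u. f (x - e * u) * k u \<partial>lborel)"
    using assms by (subst lborel_integral_real_affine[of "-e" _ x])
      (auto simp: mult.assoc[symmetric] intro!: Bochner_Integration.integral_cong)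
  assume k: "integrable lborel k"
  have "integrable lborel (\<lambda>y. k (x / e + (- 1 / e) * y))"
    using assms by (intro lborel_integrable_real_affine k) auto
  then have "integrable lborel (\<lambda>y. k (x / e + (- 1 / e) * y) / e)" by (rule integrable_divide)
  then show "integrable lborel (\<lambda>y. k ((x - y) / e) / e)" by (simp add: diff_divide_distrib)
qed

section \<open>Time intervals as finite measure spaces\<close>

definition Iv :: "real \<Rightarrow> real \<Rightarrow> real measure" where
  "Iv s r = restrict_space lborel {s<..<r}"

lemma space_Iv [simp]: "space (Iv s r) = {s<..<r}"
  by (simp add: Iv_def space_restrict_space)

lemma finite_measure_Iv: "finite_measure (Iv s r)"
  by (cases "s \<le> r") (auto simp: Iv_def emeasure_restrict_space space_restrict_space intro!: finite_measureI)

interpretation Iv: finite_measure "Iv s r" for s r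
  by (rule finite_measure_Iv)

lemma integral_Iv: "(\<integral>x. f x \<partial>Iv s r) = (LINT x:{s<..<r}|lborel. f x)" for f :: "real \<Rightarrow> real"
  by (simp add: Iv_def set_lebesgue_integral_def integral_restrict_space)

lemma integrable_Iv: "integrable (Iv s r) f \<longleftrightarrow> set_integrable lborel {s<..<r} f" for f :: "real \<Rightarrow> real"
  by (simp add: Iv_def set_integrable_def integrable_restrict_space)

lemma measurable_Iv: "f \<in> borel_measurable (Iv s r) \<longleftrightarrow> set_borel_measurable lborel {s<..<r} f" for f :: "real \<Rightarrow> real"
  by (simp add: Iv_def set_borel_measurable_def borel_measurable_restrict_space_iff)

lemma measurable_ident_Iv: "(\<lambda>x. x) \<in> borel_measurable (Iv s r)"
  unfolding Iv_def by (rule measurable_restrict_space1) simp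

lemma borel_measurable_Iv_continuous:
  fixes f :: "real \<Rightarrow> real"
  assumes "continuous_on A f" "{s<..<r} \<subseteq> A" shows "f \<in> borel_measurable (Iv s r)"
  unfolding measurable_Iv set_borel_measurable_def
  using borel_measurable_continuous_on_indicator[of "{s<..<r}" f] continuous_on_subset[OF assms] by simp

lemma integral_Iv_Icc:
  fixes f :: "real \<Rightarrow> real"
  assumes f: "continuous_on {s..r} f"
  shows "(\<integral>x. f x \<partial>Iv s r) = (\<integral>x. indicator {s..r} x * f x \<partial>lborel)"
  unfolding integral_Iv set_lebesgue_integral_def
proof -
  have "continuous_on {s<..<r} f" using f by (rule continuous_on_subset) auto
  then have "(\<lambda>x. indicator {s<..<r} x *\<^sub>R f x) \<in> borel_measurable lborel"
    "(\<lambda>x. indicator {s..r} x *\<^sub>R f x) \<in> borel_measurable lborel"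
    using borel_measurable_continuous_on_indicator[OF _ f]
      borel_measurable_continuous_on_indicator[of "{s<..<r}" f] by auto
  moreover have "AE x in lborel. indicator {s<..<r} x *\<^sub>R f x = indicator {s..r} x * f x"
    using AE_lborel_singleton[of s] AE_lborel_singleton[of r]
    by eventually_elim (auto simp: indicator_def)
  ultimately show "(\<integral>x. indicator {s<..<r} x *\<^sub>R f x \<partial>lborel) = (\<integral>x. indicator {s..r} x * f x \<partial>lborel)"
    by (intro integral_cong_AE) auto
qed

text \<open>The hypothesis \<open>eq\<close> is the weak form of \<open>g' = q\<close>, tested with
  a smoothed indicator of \<open>[s, r]\<close> of transition width \<open>d\<close>. As
  \<open>d\<close> tends to 0, the derivative of the cutoff becomes a point mass at \<open>s\<close>
  minus one at \<open>r\<close>, which the continuity of \<open>g\<close> turns into values, and the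
  cutoff itself becomes the indicator.\<close>

lemma weak_derivative_imp_integral:
  fixes g q :: "real \<Rightarrow> real"
  assumes sr: "0 < s" "s < r" "r < T"
    and g: "continuous_on {0..T} g" and q: "continuous_on {0..T} q"
    and eq: "\<And>d. 0 < d \<Longrightarrow> d < s \<Longrightarrow> r + d < T \<Longrightarrow>
      (\<integral>t. (bump ((t - s) / d) / d - bump ((t - r) / d) / d) * g t
        + (step ((t - s) / d) - step ((t - r) / d)) * q t \<partial>Iv 0 T) = 0"
  shows "g r - g s = (\<integral>t. q t \<partial>Iv s r)"
proof -
  note [measurable] = measurable_ident_Iv
  have bdd: "\<exists>C. \<forall>t\<in>{0..T}. \<bar>f t\<bar> \<le> C" if "continuous_on {0..T} f" for f :: "real \<Rightarrow> real"
    using compact_imp_bounded[OF compact_continuous_image[OF that compact_Icc]] by (auto simp: bounded_iff)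
  obtain Cg Cq where Cg: "\<And>t. t \<in> {0..T} \<Longrightarrow> \<bar>g t\<bar> \<le> Cg" and Cq: "\<And>t. t \<in> {0..T} \<Longrightarrow> \<bar>q t\<bar> \<le> Cq"
    using bdd[OF g] bdd[OF q] by blast
  have Cg0: "0 \<le> Cg" using Cg[of s] sr by auto
  \<comment> \<open>Half the distance from \<open>[s, r]\<close> to the ends of
    \<open>(0,T)\<close>, so that every width \<open>d k = c / (k + 1)\<close> is admissible in
    \<open>eq\<close>.\<close>
  define c where "c = min s (T - r) / 2"
  have c: "c > 0" "c < s" "r + c < T" using sr by (auto simp: c_def min_def field_simps)
  define d where "d k = c / (real k + 1)" for k :: nat
  have d: "0 < d k" "d k \<le> c" for k using c by (auto simp: d_def field_simps)
  have d0: "d \<longlonglongrightarrow> 0" unfolding d_def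
    by (rule real_tendsto_divide_at_top[OF tendsto_const])
      (auto intro!: filterlim_tendsto_add_at_top[OF tendsto_const filterlim_real_sequentially] simp: add.commute)
  have gm[measurable]: "g \<in> borel_measurable (Iv 0 T)" and qm[measurable]: "q \<in> borel_measurable (Iv 0 T)"
    by (rule borel_measurable_Iv_continuous[of "{0..T}"]; use g q in auto)+
  have delta: "(\<lambda>k. \<integral>t. bump ((t - a) / d k) / d k * g t \<partial>Iv 0 T) \<longlonglongrightarrow> g a" if a: "0 < a" "a < T" for a
  proof -
    let ?g = "\<lambda>t. indicator {0<..<T} t * g t"
    have gb[measurable]: "?g \<in> borel_measurable borel"
      using gm by (simp add: measurable_Iv set_borel_measurable_def)
    have "(\<integral>t. bump ((t - a) / d k) / d k * g t \<partial>Iv 0 T) = (\<integral>y. ?g (a + d k * y) * bump y \<partial>lborel)" for k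
    proof -
      have "(\<integral>t. bump ((t - a) / d k) / d k * g t \<partial>Iv 0 T) = (\<integral>t. ?g t * (bump ((t - a) / d k) / d k) \<partial>lborel)"
        unfolding integral_Iv set_lebesgue_integral_def by (simp add: mult_ac)
      also have "\<dots> = (\<integral>y. ?g (a + d k * y) * bump y \<partial>lborel)"
        using d(1)[of k] by (subst lborel_integral_real_affine[of "d k" _ a])
          (auto simp: mult.assoc[symmetric] intro!: Bochner_Integration.integral_cong)
      finally show ?thesis .
    qed
    moreover have "(\<lambda>k. \<integral>y. ?g (a + d k * y) * bump y \<partial>lborel) \<longlonglongrightarrow> (\<integral>y. g a * bump y \<partial>lborel)"
    proof (rule integral_dominated_convergence[where w="\<lambda>y. Cg * bump y"])
      show "AE y in lborel. (\<lambda>k. ?g (a + d k * y) * bump y) \<longlonglongrightarrow> g a * bump y"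
      proof (intro AE_I2 tendsto_intros)
        fix y
        have lim: "(\<lambda>k. a + d k * y) \<longlonglongrightarrow> a"
          using tendsto_add[OF tendsto_const[of a] tendsto_mult[OF d0 tendsto_const[of y]]] by simp
        have "isCont ?g a"
        proof -
          have "isCont g a"
            using g a by (auto intro: continuous_on_interior[of "{0..T}"])
          moreover have "eventually (\<lambda>t. g t = ?g t) (nhds a)"
            using eventually_nhds_in_open[of "{0<..<T}" a] a by (auto elim!: eventually_mono)
          ultimately show ?thesis by (rule isCont_cong[THEN iffD1, rotated])
        qed
        from isCont_tendsto_compose[OF this lim] show "(\<lambda>k. ?g (a + d k * y)) \<longlonglongrightarrow> g a"
          using a by simp
      qed
      show "AE y in lborel. norm (?g (a + d k * y) * bump y) \<le> Cg * bump y" for k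
        using Cg Cg0 bump_nonneg by (auto intro!: AE_I2 mult_right_mono simp: abs_mult indicator_def)
    qed (use integrable_bump in auto)
    ultimately show ?thesis by (simp add: integral_bump)
  qed
  have step_q: "norm ((step x - step y) * q t) \<le> Cq" if "t \<in> {0..T}" for x y t
  proof -
    have "\<bar>step x - step y\<bar> \<le> 1"
      using step_nonneg[of x] step_nonneg[of y] step_le_1[of x] step_le_1[of y] by linarith
    then have "\<bar>step x - step y\<bar> * \<bar>q t\<bar> \<le> 1 * Cq" using Cq[OF that] by (intro mult_mono) auto
    then show ?thesis by (simp add: abs_mult)
  qed
  have stepq: "(\<lambda>k. \<integral>t. (step ((t - s) / d k) - step ((t - r) / d k)) * q t \<partial>Iv 0 T)
      \<longlonglongrightarrow> (\<integral>t. indicator {s<..<r} t * q t \<partial>Iv 0 T)"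
  proof (rule integral_dominated_convergence[where w="\<lambda>t. Cq"])
    \<comment> \<open>For \<open>t \<noteq> a\<close> the quotient eventually leaves
      \<open>(-1,1)\<close>, outside of which \<open>step\<close> is constant.\<close>
    have lim: "(\<lambda>k. step ((t - a) / d k)) \<longlonglongrightarrow> (if t > a then 1 else 0)" if "t \<noteq> a" for t a
    proof -
      have "filterlim d (at_right 0) sequentially"
        using d0 d(1) by (auto simp: filterlim_at intro!: always_eventually) (metis less_irrefl)
      then have inf: "filterlim (\<lambda>k. inverse (d k)) at_top sequentially"
        by (rule filterlim_compose[OF filterlim_inverse_at_top_right])
      show ?thesis
      proof (cases "t > a")
        case True
        then have "filterlim (\<lambda>k. (t - a) * inverse (d k)) at_top sequentially"
          by (intro filterlim_tendsto_pos_mult_at_top[OF tendsto_const _ inf]) auto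
        then have "eventually (\<lambda>k. 1 \<le> (t - a) * inverse (d k)) sequentially"
          by (auto simp: filterlim_at_top)
        then show ?thesis using True
          by (auto intro!: tendsto_eventually elim!: eventually_mono simp: step_ge divide_inverse)
      next
        case False
        with that have "filterlim (\<lambda>k. (a - t) * inverse (d k)) at_top sequentially"
          by (intro filterlim_tendsto_pos_mult_at_top[OF tendsto_const _ inf]) auto
        then have "eventually (\<lambda>k. 1 \<le> (a - t) * inverse (d k)) sequentially"
          by (auto simp: filterlim_at_top)
        then show ?thesis using False
          by (auto intro!: tendsto_eventually elim!: eventually_mono simp: step_le divide_inverse algebra_simps)
      qed
    qed
    have "AE t in Iv 0 T. t \<noteq> a" for a
      unfolding Iv_def by (subst AE_restrict_space_iff)
        (use AE_lborel_singleton[of a] in \<open>auto elim!: eventually_mono\<close>)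
    from this[of s] this[of r]
    show "AE t in Iv 0 T. (\<lambda>k. (step ((t - s) / d k) - step ((t - r) / d k)) * q t) \<longlonglongrightarrow> indicator {s<..<r} t * q t"
    proof eventually_elim
      case (elim t)
      have "(\<lambda>k. (step ((t - s) / d k) - step ((t - r) / d k)) * q t) \<longlonglongrightarrow>
          ((if t > s then 1 else 0) - (if t > r then 1 else 0)) * q t"
        by (intro tendsto_intros lim elim)
      then show ?case using elim sr by (auto simp: indicator_def split: if_splits)
    qed
    show "AE t in Iv 0 T. norm ((step ((t - s) / d k) - step ((t - r) / d k)) * q t) \<le> Cq" for k
      by (intro AE_I2 step_q) auto
    show "(\<lambda>t. indicator {s<..<r} t * q t) \<in> borel_measurable (Iv 0 T)"
      by (intro borel_measurable_times qm) (simp add: Iv_def measurable_restrict_space1)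
  qed (auto intro!: borel_measurable_times borel_measurable_diff)
  have lim1: "(\<lambda>k. (\<integral>t. bump ((t - s) / d k) / d k * g t \<partial>Iv 0 T) - (\<integral>t. bump ((t - r) / d k) / d k * g t \<partial>Iv 0 T)
      + (\<integral>t. (step ((t - s) / d k) - step ((t - r) / d k)) * q t \<partial>Iv 0 T))
    \<longlonglongrightarrow> g s - g r + (\<integral>t. indicator {s<..<r} t * q t \<partial>Iv 0 T)"
    using sr by (intro tendsto_intros delta stepq) auto
  obtain Cb where Cb: "\<And>y. \<bar>bump y\<bar> \<le> Cb" using bump_bounded by blast
  have "(\<integral>t. bump ((t - s) / d k) / d k * g t \<partial>Iv 0 T) - (\<integral>t. bump ((t - r) / d k) / d k * g t \<partial>Iv 0 T)
      + (\<integral>t. (step ((t - s) / d k) - step ((t - r) / d k)) * q t \<partial>Iv 0 T) = 0" for k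
  proof -
    have i1: "integrable (Iv 0 T) (\<lambda>t. bump ((t - a) / d k) / d k * g t)" for a
    proof (rule Iv.integrable_const_bound[where B="Cb / d k * Cg"])
      show "AE t in Iv 0 T. norm (bump ((t - a) / d k) / d k * g t) \<le> Cb / d k * Cg"
        using Cb Cg d(1)[of k] order_trans[OF abs_ge_zero Cb]
        by (intro AE_I2) (auto simp: abs_mult intro!: mult_mono divide_right_mono)
    qed measurable
    have i2: "integrable (Iv 0 T) (\<lambda>t. (step ((t - s) / d k) - step ((t - r) / d k)) * q t)"
    proof (rule Iv.integrable_const_bound[where B=Cq])
      show "AE t in Iv 0 T. norm ((step ((t - s) / d k) - step ((t - r) / d k)) * q t) \<le> Cq"
        by (intro AE_I2 step_q) auto
    qed measurable
    have "(\<integral>t. bump ((t - s) / d k) / d k * g t - bump ((t - r) / d k) / d k * g t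
        + (step ((t - s) / d k) - step ((t - r) / d k)) * q t \<partial>Iv 0 T) = 0"
      using eq[of "d k"] d[of k] c by (simp add: left_diff_distrib)
    then show ?thesis using i1[of s] i1[of r] i2 by simp
  qed
  then have "g s - g r + (\<integral>t. indicator {s<..<r} t * q t \<partial>Iv 0 T) = 0"
    using lim1 by (simp add: LIMSEQ_const_iff)
  moreover have "(\<integral>t. indicator {s<..<r} t * q t \<partial>Iv 0 T) = (\<integral>t. q t \<partial>Iv s r)"
    unfolding integral_Iv set_lebesgue_integral_def
    using sr by (intro Bochner_Integration.integral_cong) (auto simp: indicator_def)
  ultimately show ?thesis by simp
qed

section \<open>Mollified solutions\<close>

text \<open>The integrals over the strip in the definition of an entropy solution become integrals
  against a product measure, for which Fubini is available.\<close>

lemma Iv_pair_lborel: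
  "Iv s r \<Otimes>\<^sub>M (lborel :: real measure) = restrict_space lborel ({s<..<r} \<times> UNIV)"
proof (rule pair_measure_eqI)
  let ?R = "restrict_space (lborel :: (real \<times> real) measure) ({s<..<r} \<times> UNIV)"
  show "sigma_finite_measure (Iv s r)" "sigma_finite_measure (lborel :: real measure)"
    by (auto intro: Iv.sigma_finite_measure_axioms lborel.sigma_finite_measure_axioms)
  have sp: "space (Iv s r \<Otimes>\<^sub>M (lborel :: real measure)) = {s<..<r} \<times> UNIV" by (simp add: space_pair_measure)
  have 1: "(\<lambda>z. z) \<in> measurable ?R (Iv s r \<Otimes>\<^sub>M lborel)"
  proof -
    have "fst \<in> measurable ?R (Iv s r)" unfolding Iv_def
      by (rule measurable_restrict_space2) (auto simp: space_restrict_space intro!: measurable_restrict_space1 borel_measurable_continuous_onI continuous_intros)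
    moreover have "snd \<in> measurable ?R lborel"
      by (auto intro!: measurable_restrict_space1 borel_measurable_continuous_onI continuous_intros)
    ultimately have "(\<lambda>z. (fst z, snd z)) \<in> measurable ?R (Iv s r \<Otimes>\<^sub>M lborel)" by (rule measurable_Pair)
    then show ?thesis by simp
  qed
  have 2: "(\<lambda>z. z) \<in> measurable (Iv s r \<Otimes>\<^sub>M lborel) (borel \<Otimes>\<^sub>M borel)"
  proof -
    have "(\<lambda>z. (fst z, snd z)) \<in> measurable (Iv s r \<Otimes>\<^sub>M lborel) (borel \<Otimes>\<^sub>M borel)"
      by (intro measurable_Pair measurable_compose[OF measurable_fst measurable_ident_Iv]) measurable
    then show ?thesis by simp
  qed
  show "sets (Iv s r \<Otimes>\<^sub>M lborel) = sets ?R"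
  proof (intro equalityI subsetI)
    fix E assume E: "E \<in> sets (Iv s r \<Otimes>\<^sub>M (lborel :: real measure))"
    then have "E \<subseteq> {s<..<r} \<times> UNIV" using sets.sets_into_space[OF E] sp by simp
    moreover have "(\<lambda>z. z) -` E \<inter> space ?R \<in> sets ?R" using 1 E by (rule measurable_sets)
    ultimately show "E \<in> sets ?R" by (simp add: space_restrict_space Int_absorb2)
  next
    fix E assume "E \<in> sets ?R"
    then obtain E' where E': "E' \<in> sets borel" "E = ({s<..<r} \<times> UNIV) \<inter> E'"
      by (auto simp: sets_restrict_space)
    then have "(\<lambda>z. z) -` E' \<inter> space (Iv s r \<Otimes>\<^sub>M (lborel :: real measure)) \<in> sets (Iv s r \<Otimes>\<^sub>M (lborel :: real measure))"
      using 2 by (intro measurable_sets) (auto simp: borel_prod)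
    then show "E \<in> sets (Iv s r \<Otimes>\<^sub>M (lborel :: real measure))"
      unfolding sp E'(2) by (simp add: Int_commute)
  qed
next
  fix A C :: "real set" assume A: "A \<in> sets (Iv s r)" and C: "C \<in> sets lborel"
  have A': "A \<subseteq> {s<..<r}" "A \<in> sets lborel"
    using A sets.sets_into_space[OF A] by (auto simp: Iv_def sets_restrict_space)
  have "emeasure (restrict_space lborel ({s<..<r} \<times> UNIV)) (A \<times> C) = emeasure (lborel \<Otimes>\<^sub>M lborel) (A \<times> C)"
    using A' by (subst emeasure_restrict_space) (auto simp: open_Times lborel_prod)
  also have "\<dots> = emeasure lborel A * emeasure lborel C"
    using A' C by (intro lborel.emeasure_pair_measure_Times) auto
  also have "emeasure lborel A = emeasure (Iv s r) A"
    using A' by (simp add: Iv_def emeasure_restrict_space)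
  finally show "emeasure (Iv s r) A * emeasure lborel C = emeasure (restrict_space lborel ({s<..<r} \<times> UNIV)) (A \<times> C)" ..
qed

lemma integrable_ind_Icc: "integrable lborel (\<lambda>u. indicator {a..b} u :: real)" for a b :: real
  by (rule integrable_real_indicator) (auto simp: emeasure_lborel_Icc_eq)

text \<open>Data and their regularity, without the equation: the weak formulation is derived from
  the entropy inequalities inside this locale and then becomes the extra assumption of
  \<open>claw\<close>. The end times 0 and \<open>T\<close> are included because the Wasserstein
  estimate reaches them.\<close>

locale claw0 =
  fixes T :: real and n :: nat and M :: "real \<Rightarrow> real \<Rightarrow> real" and B F :: "nat \<Rightarrow> real \<Rightarrow> real"
  assumes T: "T > 0"
    and M: "\<And>t. t \<in> {0..T} \<Longrightarrow> cdf_class (M t)"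
    and M_L1: "\<And>s R. s \<in> {0..T} \<Longrightarrow>
      ((\<lambda>t. LINT x:{-R..R}|lborel. \<bar>M t x - M s x\<bar>) \<longlongrightarrow> 0) (at s within {0..T})"
    and M_meas: "set_borel_measurable lborel ({0<..<T} \<times> UNIV) (\<lambda>z. M (fst z) (snd z))"
    and B: "\<And>i. i \<le> n \<Longrightarrow> continuous_on {0..T} (B i)"
    and F: "\<And>i. i \<le> n \<Longrightarrow> F i \<in> borel_measurable Unif"
    and F2: "\<And>i. i \<le> n \<Longrightarrow> integrable Unif (\<lambda>m. \<bar>F i m\<bar> powr 2)"
begin

definition Phi :: "real \<Rightarrow> real \<Rightarrow> real" where
  "Phi t m = (\<Sum>i\<le>n. B i t * F i m)"

definition Uf :: "real \<Rightarrow> real \<Rightarrow> real" where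
  "Uf t y = (\<Sum>i\<le>n. B i t * prim (F i) y)"

text \<open>The time derivative of the mollified solution. It is minus the kernel applied to
  \<partial>_x U(t,M), that measure being written as the image of \<open>Phi t\<close> times
  Lebesgue measure under the quantile map.\<close>

definition q :: "real \<Rightarrow> real \<Rightarrow> real \<Rightarrow> real" where
  "q e x t = - (\<integral>m. Phi t m * (bump ((x - quant (M t) m) / e) / e) \<partial>Unif)"

lemma cdf_fun_M: "t \<in> {0..T} \<Longrightarrow> cdf_fun (M t)"
  by (simp add: cdf_fun_def M)

lemma F_int: "i \<le> n \<Longrightarrow> integrable Unif (F i)"
proof -
  assume i: "i \<le> n"
  have "integrable Unif (\<lambda>m. \<bar>F i m\<bar> powr 1)"
    by (rule integrable_powr_le[OF Unif.finite_measure_axioms F[OF i] F2[OF i]]) auto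
  then show ?thesis using F[OF i] by (simp add: integrable_abs_iff)
qed

lemma Phi_int: "integrable Unif (Phi t)"
  unfolding Phi_def using F_int by (intro Bochner_Integration.integrable_sum integrable_mult_right) auto

lemma prim_Phi: "prim (Phi t) y = Uf t y"
proof -
  have "prim (Phi t) y = (\<integral>m. (\<Sum>i\<le>n. B i t * (indicator {..y} m * F i m)) \<partial>Unif)"
    unfolding prim_def Phi_def
    by (intro Bochner_Integration.integral_cong refl) (simp add: sum_distrib_left mult_ac)
  also have "\<dots> = (\<Sum>i\<le>n. \<integral>m. B i t * (indicator {..y} m * F i m) \<partial>Unif)"
    using F_int by (intro Bochner_Integration.integral_sum integrable_mult_right integrable_Unif_indicator) auto
  also have "\<dots> = Uf t y" by (simp add: Uf_def prim_def)
  finally show ?thesis .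
qed

lemma M_measurable:
  assumes "0 \<le> s" "r \<le> T"
  shows "(\<lambda>z. M (fst z) (snd z)) \<in> borel_measurable (Iv s r \<Otimes>\<^sub>M lborel)"
proof -
  have 1: "(\<lambda>z. indicator ({0<..<T} \<times> UNIV) z *\<^sub>R M (fst z) (snd z)) \<in> borel_measurable (borel \<Otimes>\<^sub>M borel)"
    using M_meas unfolding set_borel_measurable_def by (simp add: borel_prod)
  have 2: "(\<lambda>z. (fst z, snd z)) \<in> measurable (Iv s r \<Otimes>\<^sub>M lborel) (borel \<Otimes>\<^sub>M borel)"
    by (intro measurable_Pair measurable_compose[OF measurable_fst measurable_ident_Iv]) measurable
  have "(\<lambda>z. indicator ({0<..<T} \<times> UNIV) (fst z, snd z) *\<^sub>R M (fst z) (snd z)) \<in> borel_measurable (Iv s r \<Otimes>\<^sub>M lborel)"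
    using measurable_compose[OF 2 1] by simp
  then show ?thesis
    by (rule measurable_cong[THEN iffD1, rotated]) (use assms in \<open>auto simp: space_pair_measure indicator_def\<close>)
qed

lemma M_measurable_split:
  "0 \<le> s \<Longrightarrow> r \<le> T \<Longrightarrow> case_prod M \<in> borel_measurable (Iv s r \<Otimes>\<^sub>M lborel)"
  using M_measurable by (simp add: case_prod_unfold)

lemma integrable_abs_diff_M:
  assumes "s \<in> {0..T}" "t \<in> {0..T}"
  shows "integrable lborel (\<lambda>u. indicator {-R..R} u * \<bar>M t u - M s u\<bar>)"
proof -
  interpret s: cdf_fun "M s" by (rule cdf_fun_M) fact
  interpret t: cdf_fun "M t" by (rule cdf_fun_M) fact
  show ?thesis
  proof (rule Bochner_Integration.integrable_bound)
    show "integrable lborel (\<lambda>u. indicator {-R..R} u :: real)" by (rule integrable_ind_Icc)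
    have "\<bar>M t u - M s u\<bar> \<le> 1" for u
      using s.F_nonneg[of u] s.F_le_1[of u] t.F_nonneg[of u] t.F_le_1[of u] by linarith
    then show "AE u in lborel. norm (indicator {-R..R} u * \<bar>M t u - M s u\<bar>) \<le> norm (indicator {-R..R} u :: real)"
      by (intro AE_I2) (auto simp: indicator_def)
  qed measurable
qed

text \<open>Monotonicity in the space variable upgrades local \<open>L\<^sup>1\<close> continuity in time to pointwise
  continuity in time at every continuity point of the limiting profile.\<close>

lemma M_tendsto:
  assumes s: "s \<in> {0..T}" and x: "M s x = left_lim (M s) x"
  shows "((\<lambda>t. M t x) \<longlongrightarrow> M s x) (at s within {0..T})"
proof (rule order_tendstoI)
  interpret s: cdf_fun "M s" by (rule cdf_fun_M) fact
  have T_ev: "eventually (\<lambda>t. t \<in> {0..T}) (at s within {0..T})" by (simp add: eventually_at_filter)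
  fix a
  {
    assume a: "M s x < a"
    have "eventually (\<lambda>y. M s y < a) (at_right x)"
      using s.cont[of x] a by (intro order_tendstoD) (auto simp: continuous_within)
    then obtain b where b: "b > x" "\<And>y. x < y \<Longrightarrow> y < b \<Longrightarrow> M s y < a"
      by (auto simp: eventually_at_right_field)
    define y where "y = (x + b) / 2"
    have y: "x < y" "M s y < a" using b by (auto simp: y_def)
    define R where "R = \<bar>x\<bar> + \<bar>y\<bar>"
    \<comment> \<open>If \<open>M t x\<close> reached \<open>a\<close>, then \<open>M t\<close>
      would exceed \<open>M s\<close> by at least \<open>a - M s y\<close> on all of
      \<open>[x, y]\<close>, and the \<open>L^1\<close> distance would be at least this
      product.\<close>
    have "0 < (a - M s y) * (y - x)" using y by simp
    from order_tendstoD(2)[OF M_L1[OF s, of R] this] T_ev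
    show "eventually (\<lambda>t. M t x < a) (at s within {0..T})"
    proof eventually_elim
      case (elim t)
      interpret t: cdf_fun "M t" by (rule cdf_fun_M) fact
      have "(M t x - M s y) * (y - x) = (\<integral>u. indicator {x..y} u * (M t x - M s y) \<partial>lborel)"
        using y by simp
      also have "\<dots> \<le> (\<integral>u. indicator {-R..R} u * \<bar>M t u - M s u\<bar> \<partial>lborel)"
      proof (intro integral_mono integrable_abs_diff_M s elim)
        show "integrable lborel (\<lambda>u. indicator {x..y} u * (M t x - M s y))"
          by (intro integrable_mult_left integrable_ind_Icc)
        show "indicator {x..y} u * (M t x - M s y) \<le> indicator {-R..R} u * \<bar>M t u - M s u\<bar>" for u
          using t.F_mono[of x u] s.F_mono[of u y] by (auto simp: indicator_def R_def)
      qed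
      also have "\<dots> < (a - M s y) * (y - x)" using elim by (simp add: set_lebesgue_integral_def)
      finally show ?case using y by (simp add: mult_less_cancel_right)
    qed
  next
    assume a: "a < M s x"
    have "eventually (\<lambda>y. a < M s y) (at_left x)"
      using s.left_lim_tendsto[of x] a x by (intro order_tendstoD) auto
    then obtain b where b: "b < x" "\<And>y. b < y \<Longrightarrow> y < x \<Longrightarrow> a < M s y"
      by (auto simp: eventually_at_left_field)
    define y where "y = (x + b) / 2"
    have y: "y < x" "a < M s y" using b by (auto simp: y_def)
    define R where "R = \<bar>x\<bar> + \<bar>y\<bar>"
    have "0 < (M s y - a) * (x - y)" using y by simp
    from order_tendstoD(2)[OF M_L1[OF s, of R] this] T_ev
    show "eventually (\<lambda>t. a < M t x) (at s within {0..T})"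
    proof eventually_elim
      case (elim t)
      interpret t: cdf_fun "M t" by (rule cdf_fun_M) fact
      have "(M s y - M t x) * (x - y) = (\<integral>u. indicator {y..x} u * (M s y - M t x) \<partial>lborel)"
        using y by simp
      also have "\<dots> \<le> (\<integral>u. indicator {-R..R} u * \<bar>M t u - M s u\<bar> \<partial>lborel)"
      proof (intro integral_mono integrable_abs_diff_M s elim)
        show "integrable lborel (\<lambda>u. indicator {y..x} u * (M s y - M t x))"
          by (intro integrable_mult_left integrable_ind_Icc)
        show "indicator {y..x} u * (M s y - M t x) \<le> indicator {-R..R} u * \<bar>M t u - M s u\<bar>" for u
          using t.F_mono[of u x] s.F_mono[of y u] by (auto simp: indicator_def R_def)
      qed
      also have "\<dots> < (M s y - a) * (x - y)" using elim by (simp add: set_lebesgue_integral_def)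
      finally show ?case using y by (simp add: mult_less_cancel_right)
    qed
  }
qed

lemma AE_continuity_point: "s \<in> {0..T} \<Longrightarrow> AE x in lborel. M s x = left_lim (M s) x"
proof -
  assume "s \<in> {0..T}"
  then interpret s: cdf_fun "M s" by (rule cdf_fun_M)
  have "AE x in lborel. x \<notin> s.jumps"
    by (intro AE_not_in countable_imp_null_set_lborel s.countable_jumps)
  then show ?thesis by eventually_elim (simp add: s.jumps_def)
qed

lemma M_LIMSEQ:
  assumes s: "s \<in> {0..T}" and x: "M s x = left_lim (M s) x"
    and u: "\<And>k. u k \<in> {0..T}" "u \<longlonglongrightarrow> s"
  shows "(\<lambda>k. M (u k) x) \<longlonglongrightarrow> M s x"
proof -
  have "continuous (at s within {0..T}) (\<lambda>t. M t x)"
    using M_tendsto[OF s x] by (simp add: continuous_within)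
  then show ?thesis using u unfolding continuous_within_sequentially o_def by blast
qed

lemma continuous_on_bdd_01:
  fixes f :: "real \<Rightarrow> real"
  assumes "continuous_on UNIV f" obtains C where "\<And>y. 0 \<le> y \<Longrightarrow> y \<le> 1 \<Longrightarrow> \<bar>f y\<bar> \<le> C"
proof -
  have "bounded (f ` {0..1})"
    by (intro compact_imp_bounded compact_continuous_image continuous_on_subset[OF assms]) auto
  then obtain C where "\<forall>y\<in>f ` {0..1}. norm y \<le> C" unfolding bounded_iff by blast
  then show ?thesis by (intro that[of C]) auto
qed

text \<open>Along a sequence of times \<open>M\<close> converges at every continuity point of the
  limiting profile, hence off a countable set. As \<open>M\<close> takes values in
  \<open>[0,1]\<close>, where \<open>f\<close> is bounded, a multiple of \<bar>\<beta>\<bar>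
  dominates.\<close>

lemma continuous_integral_M:
  fixes f \<beta> :: "real \<Rightarrow> real"
  assumes f: "continuous_on UNIV f" and \<beta>: "integrable lborel \<beta>"
  shows "continuous_on {0..T} (\<lambda>t. \<integral>x. f (M t x) * \<beta> x \<partial>lborel)"
proof -
  have [measurable]: "f \<in> borel_measurable borel" using f by (rule borel_measurable_continuous_onI)
  have [measurable]: "\<beta> \<in> borel_measurable borel" using \<beta> by auto
  obtain C where C: "\<And>y. 0 \<le> y \<Longrightarrow> y \<le> 1 \<Longrightarrow> \<bar>f y\<bar> \<le> C" using continuous_on_bdd_01[OF f] by blast
  show ?thesis unfolding continuous_on_sequentially o_def
  proof (intro allI ballI impI)
    fix u s assume s: "s \<in> {0..T}" and u: "(\<forall>k. u k \<in> {0..T}) \<and> u \<longlonglongrightarrow> s"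
    interpret s: cdf_fun "M s" by (rule cdf_fun_M) fact
    interpret u: cdf_fun "M (u k)" for k using u by (intro cdf_fun_M) auto
    show "(\<lambda>k. \<integral>x. f (M (u k) x) * \<beta> x \<partial>lborel) \<longlonglongrightarrow> (\<integral>x. f (M s x) * \<beta> x \<partial>lborel)"
    proof (rule integral_dominated_convergence[where w="\<lambda>x. C * \<bar>\<beta> x\<bar>"])
      show "AE x in lborel. (\<lambda>k. f (M (u k) x) * \<beta> x) \<longlonglongrightarrow> f (M s x) * \<beta> x"
        using AE_continuity_point[OF s]
      proof eventually_elim
        case (elim x)
        have "(\<lambda>k. M (u k) x) \<longlonglongrightarrow> M s x" using u by (intro M_LIMSEQ s elim) auto
        then show ?case using f
          by (intro tendsto_intros isCont_tendsto_compose[of _ f]) (auto simp: continuous_on_eq_continuous_at)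
      qed
      show "AE x in lborel. norm (f (M (u k) x) * \<beta> x) \<le> C * \<bar>\<beta> x\<bar>" for k
        using C u.F_nonneg u.F_le_1 by (intro AE_I2) (auto simp: abs_mult intro!: mult_right_mono)
    qed (use \<beta> in auto)
  qed
qed

lemma moll_eq_kernel:
  "e > 0 \<Longrightarrow> moll e (M t) x = (\<integral>y. M t y * (bump ((x - y) / e) / e) \<partial>lborel)"
  unfolding moll_def by (rule affine_kernel(1)[symmetric])

lemma integrable_kernel: "e > 0 \<Longrightarrow> integrable lborel (\<lambda>y. bump ((x - y) / e) / e)"
  by (rule affine_kernel(2)[OF _ integrable_bump])

lemma integrable_kernel_deriv: "e > 0 \<Longrightarrow> integrable lborel (\<lambda>y. - bumpd ((x - y) / e) / e\<^sup>2)"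
  using integrable_divide[OF affine_kernel(2)[OF _ integrable_bumpd, of e x], of "-e"]
  by (simp add: power2_eq_square)

text \<open>\<open>integral_tail_quant\<close> with the kernel as \<open>Z\<close>: the derivative
  falls on the kernel, and the mass integral becomes \<open>Uf t (M t y)\<close>, the expression
  occurring in the weak formulation.\<close>

lemma q_eq:
  assumes e: "e > 0" and t: "t \<in> {0..T}"
  shows "q e x t = (\<integral>y. Uf t (M t y) * (- bumpd ((x - y) / e) / e\<^sup>2) \<partial>lborel)"
proof -
  interpret t: cdf_fun "M t" by (rule cdf_fun_M) fact
  let ?\<zeta> = "\<lambda>y. - bumpd ((x - y) / e) / e\<^sup>2"
  let ?Z = "\<lambda>y. bump ((x - y) / e) / e"
  have Z: "?Z z = - (\<integral>y. indicator {z..} y * ?\<zeta> y \<partial>lborel)" for z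
  proof -
    \<comment> \<open>Beyond \<open>x + e\<close> the kernel and its derivative vanish, so the tail
      integral lives on \<open>[z, R]\<close>, where the fundamental theorem applies.\<close>
    define R where "R = max z (x + e)"
    have R: "z \<le> R" "(x - R) / e \<le> -1" using e by (auto simp: R_def divide_le_eq)
    have far: "(x - y) / e \<le> - 1" if "y \<ge> R" for y
      using that e unfolding R_def by (simp add: divide_le_eq)
    have far': "bumpd ((x - y) / e) = 0" if "y \<ge> R" for y
      using far[OF that] by (intro bumpd_eq_0) linarith
    have "(\<integral>y. indicator {z..} y * ?\<zeta> y \<partial>lborel) = (\<integral>y. indicator {z..R} y * ?\<zeta> y \<partial>lborel)"
    proof (intro Bochner_Integration.integral_cong refl)
      show "indicator {z..} y * ?\<zeta> y = indicator {z..R} y * ?\<zeta> y" for y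
        using far'[of y] by (cases "y \<ge> R") (auto simp: indicator_def)
    qed
    also have "\<dots> = ?Z R - ?Z z"
    proof (rule integral_Icc_eq_diff)
      show "(?Z has_real_derivative ?\<zeta> y) (at y)" for y
        using e by (auto intro!: derivative_eq_intros DERIV_chain2[OF bump_has_derivative] simp: power2_eq_square)
      show "continuous_on UNIV ?\<zeta>"
        using e by (intro continuous_intros continuous_on_compose2[OF continuous_bumpd[of UNIV]]) auto
    qed (use R in auto)
    also have "bump ((x - R) / e) = 0" using R(2) by (intro bump_eq_0) linarith
    finally show ?thesis by simp
  qed
  have "q e x t = (\<integral>y. prim (Phi t) (M t y) * ?\<zeta> y \<partial>lborel)"
    unfolding q_def t.integral_tail_quant[OF Phi_int[of t] integrable_kernel_deriv[OF e, of x] Z] by simp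
  then show ?thesis by (simp only: prim_Phi)
qed

lemma continuous_prim_F: "i \<le> n \<Longrightarrow> continuous_on UNIV (prim (F i))"
  by (rule continuous_prim[OF F_int])

text \<open>Time now enters only through the continuous factors \<open>B i\<close> and through
  \<open>M t\<close> inside a fixed continuous function; continuity in time and joint measurability
  can be read off.\<close>

lemma q_sum:
  assumes e: "e > 0" and t: "t \<in> {0..T}"
  shows "q e x t = (\<Sum>i\<le>n. B i t * (\<integral>y. prim (F i) (M t y) * (- bumpd ((x - y) / e) / e\<^sup>2) \<partial>lborel))"
proof -
  interpret t: cdf_fun "M t" by (rule cdf_fun_M) fact
  let ?\<zeta> = "\<lambda>y. - bumpd ((x - y) / e) / e\<^sup>2"
  have int: "integrable lborel (\<lambda>y. prim (F i) (M t y) * ?\<zeta> y)" if i: "i \<le> n" for i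
  proof (rule Bochner_Integration.integrable_bound)
    have [measurable]: "(\<lambda>y. prim (F i) (M t y)) \<in> borel_measurable borel"
      by (rule measurable_compose[OF t.F_measurable prim_measurable[OF F_int[OF i]]])
    show "(\<lambda>y. prim (F i) (M t y) * ?\<zeta> y) \<in> borel_measurable lborel" by measurable
    show "integrable lborel (\<lambda>y. (\<integral>m. \<bar>F i m\<bar> \<partial>Unif) * \<bar>?\<zeta> y\<bar>)"
      using integrable_kernel_deriv[OF e] by (intro integrable_mult_right integrable_abs)
    show "AE y in lborel. norm (prim (F i) (M t y) * ?\<zeta> y) \<le> norm ((\<integral>m. \<bar>F i m\<bar> \<partial>Unif) * \<bar>?\<zeta> y\<bar>)"
      using prim_bound[OF F_int[OF i]] by (intro AE_I2) (auto simp: abs_mult intro!: mult_right_mono divide_right_mono)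
  qed
  have "q e x t = (\<integral>y. (\<Sum>i\<le>n. B i t * (prim (F i) (M t y) * ?\<zeta> y)) \<partial>lborel)"
    unfolding q_eq[OF e t] Uf_def by (simp only: sum_distrib_right mult.assoc)
  also have "\<dots> = (\<Sum>i\<le>n. \<integral>y. B i t * (prim (F i) (M t y) * ?\<zeta> y) \<partial>lborel)"
    using int by (intro Bochner_Integration.integral_sum integrable_mult_right) auto
  finally show ?thesis by (simp only: integral_mult_right_zero)
qed

lemma continuous_q: "e > 0 \<Longrightarrow> continuous_on {0..T} (q e x)"
proof -
  assume e: "e > 0"
  have "continuous_on {0..T} (\<lambda>t. \<Sum>i\<le>n. B i t * (\<integral>y. prim (F i) (M t y) * (- bumpd ((x - y) / e) / e\<^sup>2) \<partial>lborel))"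
    by (intro continuous_intros B continuous_integral_M continuous_prim_F integrable_kernel_deriv e) auto
  then show ?thesis
    by (rule continuous_on_cong[THEN iffD1, rotated 2]) (auto simp: q_sum[OF e])
qed

lemma continuous_moll: "e > 0 \<Longrightarrow> continuous_on {0..T} (\<lambda>t. moll e (M t) x)"
  unfolding moll_eq_kernel using continuous_integral_M[OF continuous_on_id integrable_kernel] by simp

lemma B_bounded: obtains C where "\<And>i t. i \<le> n \<Longrightarrow> t \<in> {0..T} \<Longrightarrow> \<bar>B i t\<bar> \<le> C" "C \<ge> 0"
proof -
  have "\<exists>c. \<forall>t\<in>{0..T}. \<bar>B i t\<bar> \<le> c" if "i \<le> n" for i
    using compact_imp_bounded[OF compact_continuous_image[OF B[OF that] compact_Icc]] by (auto simp: bounded_iff)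
  then obtain c where c: "\<And>i t. i \<le> n \<Longrightarrow> t \<in> {0..T} \<Longrightarrow> \<bar>B i t\<bar> \<le> c i" by metis
  have "\<bar>B i t\<bar> \<le> (\<Sum>i\<le>n. \<bar>c i\<bar>)" if "i \<le> n" "t \<in> {0..T}" for i t
  proof -
    have "\<bar>c i\<bar> \<le> (\<Sum>i\<le>n. \<bar>c i\<bar>)" using that by (intro member_le_sum) auto
    then show ?thesis using c[OF that] by linarith
  qed
  then show ?thesis by (rule that) (auto intro: sum_nonneg)
qed

lemma B_measurable: "i \<le> n \<Longrightarrow> 0 \<le> s \<Longrightarrow> r \<le> T \<Longrightarrow> B i \<in> borel_measurable (Iv s r)"
  by (rule borel_measurable_Iv_continuous[OF B]) auto

lemma Uf_measurable:
  assumes "0 \<le> s" "r \<le> T"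
  shows "(\<lambda>z. Uf (fst z) (M (fst z) (snd z))) \<in> borel_measurable (Iv s r \<Otimes>\<^sub>M lborel)"
  unfolding Uf_def
proof (rule borel_measurable_sum)
  fix i assume "i \<in> {..n}"
  then have i: "i \<le> n" by simp
  note [measurable] = B_measurable[OF i assms] M_measurable[OF assms] prim_measurable[OF F_int[OF i]]
  show "(\<lambda>z. B i (fst z) * prim (F i) (M (fst z) (snd z))) \<in> borel_measurable (Iv s r \<Otimes>\<^sub>M lborel)"
    by measurable
qed

lemma Uf_bounded: obtains C where "\<And>t y. t \<in> {0..T} \<Longrightarrow> \<bar>Uf t y\<bar> \<le> C" "C \<ge> 0"
proof -
  obtain c where c: "\<And>i t. i \<le> n \<Longrightarrow> t \<in> {0..T} \<Longrightarrow> \<bar>B i t\<bar> \<le> c" "c \<ge> 0" using B_bounded by blast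
  have "\<bar>Uf t y\<bar> \<le> (\<Sum>i\<le>n. c * (\<integral>m. \<bar>F i m\<bar> \<partial>Unif))" if "t \<in> {0..T}" for t y
    unfolding Uf_def using that c prim_bound[OF F_int]
    by (intro order_trans[OF sum_abs] sum_mono) (auto simp: abs_mult intro!: mult_mono)
  then show ?thesis by (rule that) (use c in \<open>auto intro!: sum_nonneg\<close>)
qed

lemma pair_Iv_lborel: "pair_sigma_finite (Iv s r) (lborel :: real measure)"
  by (rule pair_sigma_finite.intro) (auto intro: Iv.sigma_finite_measure_axioms lborel.sigma_finite_measure_axioms)

lemma M_abs_le_1: "t \<in> {0..T} \<Longrightarrow> \<bar>M t y\<bar> \<le> 1"
  using cdf_fun.F_nonneg[OF cdf_fun_M, of t y] cdf_fun.F_le_1[OF cdf_fun_M, of t y] by simp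

lemma weak_integrable:
  assumes d: "d > 0" and e: "e > 0"
  shows "integrable (Iv 0 T \<Otimes>\<^sub>M lborel) (\<lambda>z. M (fst z) (snd z)
      * ((bump ((fst z - s) / d) / d - bump ((fst z - r) / d) / d) * (bump ((x - snd z) / e) / e)))"
    and "integrable (Iv 0 T \<Otimes>\<^sub>M lborel) (\<lambda>z. Uf (fst z) (M (fst z) (snd z))
      * ((step ((fst z - s) / d) - step ((fst z - r) / d)) * (- bumpd ((x - snd z) / e) / e\<^sup>2)))"
proof -
  let ?k = "\<lambda>y. bump ((x - y) / e) / e"
  let ?\<zeta> = "\<lambda>y. - bumpd ((x - y) / e) / e\<^sup>2"
  let ?a = "\<lambda>t. bump ((t - s) / d) / d - bump ((t - r) / d) / d"
  let ?b = "\<lambda>t. step ((t - s) / d) - step ((t - r) / d)"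
  interpret P: pair_sigma_finite "Iv 0 T" "lborel :: real measure" by (rule pair_Iv_lborel)
  obtain Cb where Cb: "\<And>y. \<bar>bump y\<bar> \<le> Cb" using bump_bounded by blast
  have Cb0: "0 \<le> Cb" using order_trans[OF abs_ge_zero Cb] by blast
  obtain C where C: "\<And>t y. t \<in> {0..T} \<Longrightarrow> \<bar>Uf t y\<bar> \<le> C" "C \<ge> 0" using Uf_bounded by blast
  have Mm[measurable]: "(\<lambda>z. M (fst z) (snd z)) \<in> borel_measurable (Iv 0 T \<Otimes>\<^sub>M lborel)"
    by (rule M_measurable) auto
  have Um[measurable]: "(\<lambda>z. Uf (fst z) (M (fst z) (snd z))) \<in> borel_measurable (Iv 0 T \<Otimes>\<^sub>M lborel)"
    by (rule Uf_measurable) auto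
  have [measurable]: "(\<lambda>z. fst z) \<in> borel_measurable (Iv 0 T \<Otimes>\<^sub>M (lborel :: real measure))"
    by (rule measurable_compose[OF measurable_fst measurable_ident_Iv])
  show "integrable (Iv 0 T \<Otimes>\<^sub>M lborel) (\<lambda>z. M (fst z) (snd z) * (?a (fst z) * ?k (snd z)))"
  proof (rule Bochner_Integration.integrable_bound)
    show "integrable (Iv 0 T \<Otimes>\<^sub>M lborel) (\<lambda>z. (2 * Cb / d) * ?k (snd z))"
      using P.integrable_fst_mult_snd[of "\<lambda>_. 2 * Cb / d" ?k] integrable_kernel[OF e] by simp
    have a: "\<bar>?a t\<bar> \<le> 2 * Cb / d" for t
    proof -
      have "\<bar>?a t\<bar> \<le> \<bar>bump ((t - s) / d)\<bar> / d + \<bar>bump ((t - r) / d)\<bar> / d"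
        using d abs_triangle_ineq4[of "bump ((t - s) / d) / d" "bump ((t - r) / d) / d"] by simp
      also have "\<dots> \<le> Cb / d + Cb / d" using Cb d by (intro add_mono divide_right_mono) auto
      finally show ?thesis by simp
    qed
    show "AE z in Iv 0 T \<Otimes>\<^sub>M lborel. norm (M (fst z) (snd z) * (?a (fst z) * ?k (snd z))) \<le> norm ((2 * Cb / d) * ?k (snd z))"
    proof (rule AE_I2)
      fix z assume "z \<in> space (Iv 0 T \<Otimes>\<^sub>M (lborel :: real measure))"
      then have "fst z \<in> {0..T}" by (auto simp: space_pair_measure)
      from M_abs_le_1[OF this, of "snd z"] a[of "fst z"]
      have "\<bar>M (fst z) (snd z)\<bar> * \<bar>?a (fst z)\<bar> \<le> 1 * (2 * Cb / d)" by (intro mult_mono) auto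
      then have "\<bar>M (fst z) (snd z)\<bar> * \<bar>?a (fst z)\<bar> * \<bar>?k (snd z)\<bar> \<le> (2 * Cb / d) * \<bar>?k (snd z)\<bar>"
        by (intro mult_right_mono) auto
      moreover have "0 \<le> 2 * Cb / d" using Cb0 d by simp
      ultimately show "norm (M (fst z) (snd z) * (?a (fst z) * ?k (snd z))) \<le> norm ((2 * Cb / d) * ?k (snd z))"
        by (simp only: real_norm_def abs_mult mult.assoc abs_of_nonneg)
    qed
  qed measurable
  show "integrable (Iv 0 T \<Otimes>\<^sub>M lborel) (\<lambda>z. Uf (fst z) (M (fst z) (snd z)) * (?b (fst z) * ?\<zeta> (snd z)))"
  proof (rule Bochner_Integration.integrable_bound)
    show "integrable (Iv 0 T \<Otimes>\<^sub>M lborel) (\<lambda>z. C * ?\<zeta> (snd z))"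
      using P.integrable_fst_mult_snd[of "\<lambda>_. C" ?\<zeta>] integrable_kernel_deriv[OF e] by simp
    have b: "\<bar>?b t\<bar> \<le> 1" for t
      using step_nonneg[of "(t - s) / d"] step_nonneg[of "(t - r) / d"] step_le_1[of "(t - s) / d"] step_le_1[of "(t - r) / d"]
      by linarith
    show "AE z in Iv 0 T \<Otimes>\<^sub>M lborel. norm (Uf (fst z) (M (fst z) (snd z)) * (?b (fst z) * ?\<zeta> (snd z))) \<le> norm (C * ?\<zeta> (snd z))"
    proof (rule AE_I2)
      fix z assume "z \<in> space (Iv 0 T \<Otimes>\<^sub>M (lborel :: real measure))"
      then have "fst z \<in> {0..T}" by (auto simp: space_pair_measure)
      from C(1)[OF this, of "M (fst z) (snd z)"] b[of "fst z"] C(2)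
      have "\<bar>Uf (fst z) (M (fst z) (snd z))\<bar> * \<bar>?b (fst z)\<bar> \<le> C * 1" by (intro mult_mono) auto
      then have "\<bar>Uf (fst z) (M (fst z) (snd z))\<bar> * \<bar>?b (fst z)\<bar> * \<bar>?\<zeta> (snd z)\<bar> \<le> C * 1 * \<bar>?\<zeta> (snd z)\<bar>"
        by (intro mult_right_mono) auto
      then show "norm (Uf (fst z) (M (fst z) (snd z)) * (?b (fst z) * ?\<zeta> (snd z))) \<le> norm (C * ?\<zeta> (snd z))"
        using C(2) by (simp only: real_norm_def abs_mult mult.assoc abs_of_nonneg mult_1_left)
    qed
  qed measurable
qed

end

text \<open>The weak formulation is recorded for products of a smoothed time indicator and the
  kernel centred at \<open>x\<close>, exactly what governs the evolution of
  \<open>moll e (M t) x\<close>.\<close>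

locale claw = claw0 +
  assumes weak: "\<And>s r d x e. 0 < s \<Longrightarrow> s < r \<Longrightarrow> r < T \<Longrightarrow> 0 < d \<Longrightarrow> d < s \<Longrightarrow> r + d < T \<Longrightarrow> 0 < e \<Longrightarrow>
      (LINT z:{0<..<T} \<times> UNIV|lborel. M (fst z) (snd z)
          * ((bump ((fst z - s) / d) / d - bump ((fst z - r) / d) / d) * (bump ((x - snd z) / e) / e))
        + (\<Sum>i\<le>n. B i (fst z) * prim (F i) (M (fst z) (snd z)))
          * ((step ((fst z - s) / d) - step ((fst z - r) / d)) * (- bumpd ((x - snd z) / e) / e\<^sup>2))) = 0"
begin

text \<open>By Fubini, the space integral against the kernel is \<open>moll\<close>, and the one
  against its derivative is \<open>q\<close> in the form of \<open>q_eq\<close>.\<close>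

lemma weak_integrand:
  assumes "0 < s" "s < r" "r < T" "0 < d" "d < s" "r + d < T" and e: "0 < e"
  shows "(\<integral>t. (bump ((t - s) / d) / d - bump ((t - r) / d) / d) * moll e (M t) x
      + (step ((t - s) / d) - step ((t - r) / d)) * q e x t \<partial>Iv 0 T) = 0"
proof -
  let ?k = "\<lambda>y. bump ((x - y) / e) / e"
  let ?\<zeta> = "\<lambda>y. - bumpd ((x - y) / e) / e\<^sup>2"
  let ?a = "\<lambda>t. bump ((t - s) / d) / d - bump ((t - r) / d) / d"
  let ?b = "\<lambda>t. step ((t - s) / d) - step ((t - r) / d)"
  interpret P: pair_sigma_finite "Iv 0 T" "lborel :: real measure" by (rule pair_Iv_lborel)
  obtain C where C: "\<And>t y. t \<in> {0..T} \<Longrightarrow> \<bar>Uf t y\<bar> \<le> C" "C \<ge> 0" using Uf_bounded by blast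
  note M1 = M_abs_le_1
  note i1 = weak_integrable(1)[OF assms(4) e, of s r x] and i2 = weak_integrable(2)[OF assms(4) e, of s r x]
  let ?f = "\<lambda>t y. M t y * (?a t * ?k y) + Uf t (M t y) * (?b t * ?\<zeta> y)"
  have int: "integrable (Iv 0 T \<Otimes>\<^sub>M lborel) (\<lambda>z. ?f (fst z) (snd z))"
    using i1 i2 by (rule Bochner_Integration.integrable_add)
  have "(\<integral>t. (\<integral>y. ?f t y \<partial>lborel) \<partial>Iv 0 T) = (\<integral>z. ?f (fst z) (snd z) \<partial>(Iv 0 T \<Otimes>\<^sub>M lborel))"
    using P.integral_fst'[OF int] by simp
  also have "\<dots> = (LINT z:{0<..<T} \<times> UNIV|lborel. ?f (fst z) (snd z))"
    unfolding Iv_pair_lborel set_lebesgue_integral_def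
    by (subst integral_restrict_space) (auto simp: open_Times)
  also have "\<dots> = 0" using weak[OF assms, of x] unfolding Uf_def .
  finally have "(\<integral>t. (\<integral>y. ?f t y \<partial>lborel) \<partial>Iv 0 T) = 0" .
  moreover have "(\<integral>y. ?f t y \<partial>lborel) = ?a t * moll e (M t) x + ?b t * q e x t" if "t \<in> {0<..<T}" for t
  proof -
    from that have t: "t \<in> {0..T}" by auto
    interpret t: cdf_fun "M t" by (rule cdf_fun_M) fact
    have Uft: "Uf t \<in> borel_measurable borel"
      using prim_measurable[OF Phi_int, of t] unfolding prim_Phi[abs_def] .
    have j1: "integrable lborel (\<lambda>y. M t y * ?k y)"
      by (rule Bochner_Integration.integrable_bound[OF integrable_kernel[OF e]])
        (use M1[OF t] in \<open>auto intro!: AE_I2 mult_left_le_one_le divide_right_mono simp: abs_mult\<close>)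
    have j2: "integrable lborel (\<lambda>y. Uf t (M t y) * ?\<zeta> y)"
    proof (rule Bochner_Integration.integrable_bound)
      show "integrable lborel (\<lambda>y. C * ?\<zeta> y)" using integrable_kernel_deriv[OF e] by (rule integrable_mult_right)
      have [measurable]: "(\<lambda>y. Uf t (M t y)) \<in> borel_measurable borel"
        by (rule measurable_compose[OF t.F_measurable Uft])
      show "(\<lambda>y. Uf t (M t y) * ?\<zeta> y) \<in> borel_measurable lborel" by measurable
      show "AE y in lborel. norm (Uf t (M t y) * ?\<zeta> y) \<le> norm (C * ?\<zeta> y)"
        using C(1)[OF t] C(2) by (intro AE_I2) (simp only: real_norm_def abs_mult abs_of_nonneg, rule mult_right_mono, auto)
    qed
    have "(\<integral>y. ?f t y \<partial>lborel) = (\<integral>y. ?a t * (M t y * ?k y) + ?b t * (Uf t (M t y) * ?\<zeta> y) \<partial>lborel)"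
      by (intro Bochner_Integration.integral_cong refl) (simp only: mult_ac)
    also have "\<dots> = ?a t * (\<integral>y. M t y * ?k y \<partial>lborel) + ?b t * (\<integral>y. Uf t (M t y) * ?\<zeta> y \<partial>lborel)"
      using j1 j2 by (subst Bochner_Integration.integral_add) (auto simp del: minus_divide_left simp only: integral_mult_right_zero intro: integrable_mult_right)
    finally show ?thesis unfolding q_eq[OF e t] moll_eq_kernel[OF e] .
  qed
  ultimately show ?thesis
    by (subst Bochner_Integration.integral_cong[OF refl, of _ _ "\<lambda>t. \<integral>y. ?f t y \<partial>lborel"]) auto
qed

lemma moll_diff_interior:
  assumes "0 < s" "s < r" "r < T" and e: "e > 0"
  shows "moll e (M r) x - moll e (M s) x = (\<integral>t. q e x t \<partial>Iv s r)"
  by (rule weak_derivative_imp_integral[OF assms(1-3) continuous_moll[OF e] continuous_q[OF e]])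
    (rule weak_integrand[OF assms(1-3) _ _ _ e])

text \<open>The integrated identity is known for \<open>0 < s < r < T\<close> only. There the
  difference \<open>h\<close> between \<open>moll\<close> and the primitive \<open>Q\<close> of
  \<open>q\<close> is constant, and by continuity it is constant on \<open>[0,T]\<close>. So the
  derivative exists also at the two ends, in the one-sided sense.\<close>

lemma moll_has_derivative:
  assumes e: "e > 0" and t: "t \<in> {0..T}"
  shows "((\<lambda>t. moll e (M t) x) has_real_derivative q e x t) (at t within {0..T})"
proof -
  have cq: "continuous_on {a..b} (q e x)" if "0 \<le> a" "b \<le> T" for a b
    by (rule continuous_on_subset[OF continuous_q[OF e]]) (use that in auto)
  define Q where "Q t = integral {0..t} (q e x)" for t
  have dQ: "(Q has_real_derivative q e x t) (at t within {0..T})" if "t \<in> {0..T}" for t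
    unfolding Q_def using that by (intro integral_has_real_derivative continuous_q e) auto
  define h where "h t = moll e (M t) x - Q t" for t
  have ch: "continuous_on {0..T} h"
    unfolding h_def by (intro continuous_intros continuous_moll e DERIV_continuous_on[OF dQ])
  have eq: "h r = h s" if "0 < s" "s < r" "r < T" for s r
  proof -
    have "(\<integral>t. q e x t \<partial>Iv s r) = integral {s..r} (q e x)"
      unfolding integral_Iv_Icc[OF cq[of s r, OF less_imp_le less_imp_le, OF that(1) that(3)]]
      using that cq[of s r] by (subst set_borel_integral_eq_integral(2)[of "{s..r}" "q e x", unfolded set_lebesgue_integral_def real_scaleR_def])
        (auto intro: borel_integrable_atLeastAtMost')
    also have "\<dots> = Q r - Q s"
    proof -
      have "Q s + integral {s..r} (q e x) = Q r" unfolding Q_def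
        using that by (intro Henstock_Kurzweil_Integration.integral_combine integrable_continuous_interval cq) auto
      then show ?thesis by simp
    qed
    finally show ?thesis using moll_diff_interior[OF that e, of x] by (simp add: h_def)
  qed
  define c where "c = h (T / 2)"
  have "h t = c" if "t \<in> {0<..<T}" for t
    using eq[of t "T / 2"] eq[of "T / 2" t] that T unfolding c_def by (cases t "T / 2" rule: linorder_cases) auto
  moreover have "closure {0<..<T} = {0..T}" using T by (rule closure_greaterThanLessThan)
  ultimately have hc: "h t = c" if "t \<in> {0..T}" for t
    using continuous_constant_on_closure[of "{0<..<T}" h c t] ch that by auto
  have "((\<lambda>t. c + Q t) has_real_derivative q e x t) (at t within {0..T})"
    using DERIV_add[OF DERIV_const dQ[OF t]] by simp
  then show ?thesis
    by (rule has_field_derivative_transform_within[OF _ zero_less_one t])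
      (use hc in \<open>auto simp: h_def algebra_simps\<close>)
qed

end

section \<open>Transport of functions of the mass coordinate\<close>

context cdf_fun
begin

text \<open>After the swap the kernel has unit mass, so the bound is independent of
  \<open>e\<close>. It supplies the majorant in time when \<open>e\<close> tends to 0.\<close>

lemma mollified_flux_bound:
  assumes G: "G \<in> borel_measurable borel" and K: "\<And>x. \<bar>G x\<bar> \<le> K"
    and psi: "\<psi> \<in> borel_measurable borel" and L: "\<And>x. \<bar>\<psi> x\<bar> \<le> L"
    and Phi: "integrable Unif \<Phi>" and e: "e > 0"
  shows "\<bar>\<integral>x. \<psi> x * G (moll e F x) * (\<integral>m. \<Phi> m * (bump ((x - quant F m) / e) / e) \<partial>Unif) \<partial>lborel\<bar>
    \<le> L * K * (\<integral>m. \<bar>\<Phi> m\<bar> \<partial>Unif)"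
proof -
  note [measurable] = G psi
  have LK: "\<bar>\<psi> x * G y\<bar> \<le> L * K" for x y
    unfolding abs_mult using order_trans[OF abs_ge_zero L] by (intro mult_mono L K) auto
  define J where "J m = (\<integral>y. \<psi> (quant F m + e * y) * G (moll e F (quant F m + e * y)) * bump y \<partial>lborel)" for m
  have Jm: "J \<in> borel_measurable Unif"
    unfolding J_def[abs_def] by (rule lborel.borel_measurable_lebesgue_integral) measurable
  have Jb: "\<bar>J m\<bar> \<le> L * K" for m
    unfolding J_def by (rule integral_times_bump_bound) (measurable, rule LK)
  have "(\<integral>x. \<psi> x * G (moll e F x) * (\<integral>m. \<Phi> m * (bump ((x - quant F m) / e) / e) \<partial>Unif) \<partial>lborel)
      = (\<integral>m. \<Phi> m * J m \<partial>Unif)"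
    unfolding J_def by (rule integral_swap_quant[where C="L * K"]) (use LK Phi e in auto)
  also have "\<bar>\<dots>\<bar> \<le> (\<integral>m. \<bar>\<Phi> m * J m\<bar> \<partial>Unif)"
    using integral_norm_bound[of Unif "\<lambda>m. \<Phi> m * J m"] by simp
  also have "\<dots> \<le> (\<integral>m. L * K * \<bar>\<Phi> m\<bar> \<partial>Unif)"
  proof (rule integral_mono)
    have le: "\<bar>\<Phi> m * J m\<bar> \<le> L * K * \<bar>\<Phi> m\<bar>" for m
      using mult_left_mono[OF Jb[of m], of "\<bar>\<Phi> m\<bar>"] by (simp add: abs_mult mult_ac)
    then show "\<bar>\<Phi> m * J m\<bar> \<le> L * K * \<bar>\<Phi> m\<bar>" for m .
    show i: "integrable Unif (\<lambda>m. L * K * \<bar>\<Phi> m\<bar>)" using Phi by simp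
    show "integrable Unif (\<lambda>m. \<bar>\<Phi> m * J m\<bar>)"
    proof (rule Bochner_Integration.integrable_bound[OF i])
      show "(\<lambda>m. \<bar>\<Phi> m * J m\<bar>) \<in> borel_measurable Unif" using Jm Phi by measurable
      show "AE m in Unif. norm \<bar>\<Phi> m * J m\<bar> \<le> norm (L * K * \<bar>\<Phi> m\<bar>)"
        using le by (intro AE_I2) (simp add: order_trans[OF le abs_ge_self])
    qed
  qed
  finally show ?thesis by simp
qed

lemma moll_LIMSEQ:
  assumes e: "\<And>k. e k > 0" "e \<longlonglongrightarrow> 0" and x: "F x = left_lim F x"
  shows "(\<lambda>k. moll (e k) F x) \<longlonglongrightarrow> F x"
  using moll_blowup[OF e, of x 0] x by simp

end

context claw
begin

definition V :: "real \<Rightarrow> real \<Rightarrow> real" where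
  "V t m = U_prime (prim (Phi t)) (Phi t) (M t) (quant (M t) m)"

lemma V_eq_avg: "t \<in> {0..T} \<Longrightarrow> V t m = cdf_fun.avg (M t) (Phi t) (quant (M t) m)"
  using cdf_fun.avg_def[OF cdf_fun_M] by (simp add: V_def)

lemma Phi_powr:
  assumes k: "k \<ge> 1" and Fq: "\<And>i. i \<le> n \<Longrightarrow> integrable Unif (\<lambda>m. \<bar>F i m\<bar> powr k)"
  shows "integrable Unif (\<lambda>m. \<bar>Phi t m\<bar> powr k)"
    and "(\<integral>m. \<bar>Phi t m\<bar> powr k \<partial>Unif) powr (1 / k) \<le> (\<Sum>i\<le>n. \<bar>B i t\<bar> * (\<integral>m. \<bar>F i m\<bar> powr k \<partial>Unif) powr (1 / k))"
proof -
  have 1: "(\<lambda>m. B i t * F i m) \<in> borel_measurable Unif" if "i \<in> {..n}" for i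
    using F[of i] that by simp
  have eq: "\<bar>B i t * F i m\<bar> powr k = \<bar>B i t\<bar> powr k * \<bar>F i m\<bar> powr k" for i m
    by (simp add: abs_mult powr_mult)
  have 2: "integrable Unif (\<lambda>m. \<bar>B i t * F i m\<bar> powr k)" if "i \<in> {..n}" for i
    unfolding eq using Fq[of i] that by simp
  note * = integral_powr_sum_le[of "{..n}" "\<lambda>i m. B i t * F i m", OF _ 1 2 k]
  then show "integrable Unif (\<lambda>m. \<bar>Phi t m\<bar> powr k)" by (simp add: Phi_def)
  have "(\<integral>m. \<bar>B i t * F i m\<bar> powr k \<partial>Unif) powr (1 / k) = \<bar>B i t\<bar> * (\<integral>m. \<bar>F i m\<bar> powr k \<partial>Unif) powr (1 / k)" for i
    unfolding eq using k by (simp add: powr_mult powr_powr)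
  then show "(\<integral>m. \<bar>Phi t m\<bar> powr k \<partial>Unif) powr (1 / k) \<le> (\<Sum>i\<le>n. \<bar>B i t\<bar> * (\<integral>m. \<bar>F i m\<bar> powr k \<partial>Unif) powr (1 / k))"
    using * by (simp add: Phi_def)
qed

text \<open>Jensen for the average over atoms, followed by Minkowski for the \<open>n + 1\<close>
  terms of \<open>Phi t\<close>. Both norm estimates of the theorem come from here.\<close>

lemma V_powr:
  assumes t: "t \<in> {0..T}" and k: "k \<ge> 1" and Fq: "\<And>i. i \<le> n \<Longrightarrow> integrable Unif (\<lambda>m. \<bar>F i m\<bar> powr k)"
  shows "integrable Unif (\<lambda>m. \<bar>V t m\<bar> powr k)"
    and "(\<integral>m. \<bar>V t m\<bar> powr k \<partial>Unif) powr (1 / k) \<le> (\<Sum>i\<le>n. \<bar>B i t\<bar> * (\<integral>m. \<bar>F i m\<bar> powr k \<partial>Unif) powr (1 / k))"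
proof -
  interpret t: cdf_fun "M t" by (rule cdf_fun_M) fact
  note * = t.avg_powr[OF Phi_int[of t] k Phi_powr(1)[OF k Fq]]
  show "integrable Unif (\<lambda>m. \<bar>V t m\<bar> powr k)" unfolding V_eq_avg[OF t] by (rule *(1)) 
  have "(\<integral>m. \<bar>V t m\<bar> powr k \<partial>Unif) powr (1 / k) \<le> (\<integral>m. \<bar>Phi t m\<bar> powr k \<partial>Unif) powr (1 / k)"
    unfolding V_eq_avg[OF t] using k by (intro powr_mono2 *(2)) auto
  also note Phi_powr(2)[OF k Fq]
  finally show "(\<integral>m. \<bar>V t m\<bar> powr k \<partial>Unif) powr (1 / k) \<le> (\<Sum>i\<le>n. \<bar>B i t\<bar> * (\<integral>m. \<bar>F i m\<bar> powr k \<partial>Unif) powr (1 / k))"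
    by simp
qed

lemma V_measurable:
  assumes "t \<in> {0..T}" shows "V t \<in> borel_measurable Unif"
proof -
  have "V t = (\<lambda>m. cdf_fun.avg (M t) (Phi t) (quant (M t) m))"
    using V_eq_avg[OF assms] by (rule ext)
  then show ?thesis using cdf_fun.avg_quant_measurable[OF cdf_fun_M[OF assms] Phi_int] by simp
qed

lemma V_L2:
  "\<exists>K. \<forall>t\<in>{0..T}. integrable Unif (\<lambda>m. (V t m)\<^sup>2) \<and> (\<integral>m. (V t m)\<^sup>2 \<partial>Unif) \<le> K"
proof -
  obtain C where C: "\<And>i t. i \<le> n \<Longrightarrow> t \<in> {0..T} \<Longrightarrow> \<bar>B i t\<bar> \<le> C" "C \<ge> 0" using B_bounded by blast
  define c where "c = (\<Sum>i\<le>n. C * (\<integral>m. \<bar>F i m\<bar> powr 2 \<partial>Unif) powr (1 / 2))"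
  have 2: "integrable Unif (\<lambda>m. \<bar>V t m\<bar> powr 2)" "(\<integral>m. \<bar>V t m\<bar> powr 2 \<partial>Unif) \<le> c powr 2" if t: "t \<in> {0..T}" for t
  proof -
    show "integrable Unif (\<lambda>m. \<bar>V t m\<bar> powr 2)" by (rule V_powr(1)[OF t _ F2]) auto
    have "(\<integral>m. \<bar>V t m\<bar> powr 2 \<partial>Unif) powr (1 / 2) \<le> (\<Sum>i\<le>n. \<bar>B i t\<bar> * (\<integral>m. \<bar>F i m\<bar> powr 2 \<partial>Unif) powr (1 / 2))"
      by (rule V_powr(2)[OF t _ F2]) auto
    also have "\<dots> \<le> c" unfolding c_def using C(1)[OF _ t] by (intro sum_mono mult_right_mono) auto
    finally have "((\<integral>m. \<bar>V t m\<bar> powr 2 \<partial>Unif) powr (1 / 2)) powr 2 \<le> c powr 2" by (intro powr_mono2) auto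
    then show "(\<integral>m. \<bar>V t m\<bar> powr 2 \<partial>Unif) \<le> c powr 2"
      by (simp add: powr_powr)
  qed
  show ?thesis by (rule exI[of _ "c powr 2"]) (use 2 in simp)
qed

lemma Phi_L1: obtains c where "\<And>t. t \<in> {0..T} \<Longrightarrow> (\<integral>m. \<bar>Phi t m\<bar> \<partial>Unif) \<le> c"
proof -
  obtain C where C: "\<And>i t. i \<le> n \<Longrightarrow> t \<in> {0..T} \<Longrightarrow> \<bar>B i t\<bar> \<le> C" "C \<ge> 0" using B_bounded by blast
  have "(\<integral>m. \<bar>Phi t m\<bar> \<partial>Unif) \<le> (\<integral>m. (\<Sum>i\<le>n. C * \<bar>F i m\<bar>) \<partial>Unif)" if t: "t \<in> {0..T}" for t
  proof (rule integral_mono)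
    show "integrable Unif (\<lambda>m. \<bar>Phi t m\<bar>)" using Phi_int by (rule integrable_abs)
    show "integrable Unif (\<lambda>m. \<Sum>i\<le>n. C * \<bar>F i m\<bar>)"
      using F_int by (intro Bochner_Integration.integrable_sum integrable_mult_right integrable_abs) auto
    show "\<bar>Phi t m\<bar> \<le> (\<Sum>i\<le>n. C * \<bar>F i m\<bar>)" for m
      unfolding Phi_def using C(1)[OF _ t]
      by (intro order_trans[OF sum_abs] sum_mono) (auto simp: abs_mult intro!: mult_right_mono)
  qed
  then show ?thesis by (rule that)
qed

text \<open>The crude inequality \<bar>ab\<bar> \<le> a^2 + b^2 replaces Cauchy-Schwarz:
  integrability and a bound uniform in time are all that the limit passages ask for.\<close>

lemma L2_mult_V:
  assumes t: "t \<in> {0..T}" and G: "G \<in> borel_measurable Unif" and G2: "integrable Unif (\<lambda>m. (G m)\<^sup>2)"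
  shows "integrable Unif (\<lambda>m. G m * V t m)"
    and "(\<integral>m. \<bar>G m * V t m\<bar> \<partial>Unif) \<le> (\<integral>m. (G m)\<^sup>2 \<partial>Unif) + (\<integral>m. (V t m)\<^sup>2 \<partial>Unif)"
proof -
  note [measurable] = G V_measurable[OF t]
  have V2: "integrable Unif (\<lambda>m. (V t m)\<^sup>2)" using V_L2 t by (elim exE) simp
  have le: "\<bar>a * b\<bar> \<le> a\<^sup>2 + b\<^sup>2" for a b :: real
  proof -
    have "2 * \<bar>a\<bar> * \<bar>b\<bar> \<le> a\<^sup>2 + b\<^sup>2" using sum_squares_bound[of "\<bar>a\<bar>" "\<bar>b\<bar>"] by simp
    moreover have "0 \<le> \<bar>a\<bar> * \<bar>b\<bar>" by simp
    ultimately show ?thesis unfolding abs_mult by linarith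
  qed
  show i: "integrable Unif (\<lambda>m. G m * V t m)"
    by (rule Bochner_Integration.integrable_bound[OF Bochner_Integration.integrable_add[OF G2 V2]])
      (use le in \<open>auto intro!: AE_I2\<close>)
  have "(\<integral>m. \<bar>G m * V t m\<bar> \<partial>Unif) \<le> (\<integral>m. (G m)\<^sup>2 + (V t m)\<^sup>2 \<partial>Unif)"
    by (intro integral_mono integrable_abs i Bochner_Integration.integrable_add G2 V2 le)
  then show "(\<integral>m. \<bar>G m * V t m\<bar> \<partial>Unif) \<le> (\<integral>m. (G m)\<^sup>2 \<partial>Unif) + (\<integral>m. (V t m)\<^sup>2 \<partial>Unif)"
    using G2 V2 by simp
qed

end

text \<open>\<psi> stands for the space derivative of a test function and \<psi>t for its time
  derivative. The support is bounded in \<open>x\<close> only, and \<open>[s, r]\<close> may touch 0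
  and \<open>T\<close>: the displacement estimate uses a \<psi> that is constant in time.\<close>

locale claw_test = claw +
  fixes \<psi> \<psi>t :: "real \<Rightarrow> real \<Rightarrow> real" and R L s r :: real
  assumes psi_cont: "continuous_on UNIV (\<lambda>z. \<psi> (fst z) (snd z))"
    and psit_cont: "continuous_on UNIV (\<lambda>z. \<psi>t (fst z) (snd z))"
    and psi_deriv: "\<And>t x. ((\<lambda>t. \<psi> t x) has_real_derivative \<psi>t t x) (at t)"
    and psi_supp: "\<And>t x. \<bar>x\<bar> > R \<Longrightarrow> \<psi> t x = 0" "\<And>t x. \<bar>x\<bar> > R \<Longrightarrow> \<psi>t t x = 0"
    and psi_bound: "\<And>t x. \<bar>\<psi> t x\<bar> \<le> L" "\<And>t x. \<bar>\<psi>t t x\<bar> \<le> L"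
    and sr: "0 \<le> s" "s < r" "r \<le> T"
begin

definition flow :: "(real \<Rightarrow> real) \<Rightarrow> real \<Rightarrow> real" where
  "flow G t = (\<integral>m. G m * V t m * \<psi> t (quant (M t) m) \<partial>Unif)"

definition mass :: "(real \<Rightarrow> real) \<Rightarrow> real \<Rightarrow> real" where
  "mass G t = (\<integral>x. prim G (M t x) * \<psi> t x \<partial>lborel)"

definition drift :: "(real \<Rightarrow> real) \<Rightarrow> real \<Rightarrow> real" where
  "drift G t = (\<integral>x. prim G (M t x) * \<psi>t t x \<partial>lborel)"

text \<open>The integrated form of "rate of \<open>mass\<close> equals \<open>drift\<close> minus
  \<open>flow\<close>". Measurability in time is included so that it passes to limits in
  \<open>G\<close> together with the identity.\<close>

definition balance :: "(real \<Rightarrow> real) \<Rightarrow> bool" where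
  "balance G \<longleftrightarrow> flow G \<in> borel_measurable (Iv s r) \<and> drift G \<in> borel_measurable (Iv s r)
    \<and> mass G r - mass G s = (\<integral>t. drift G t - flow G t \<partial>Iv s r)"

lemma psi_cont_x: "continuous_on UNIV (\<psi> t)" "continuous_on UNIV (\<psi>t t)"
proof -
  have "continuous_on UNIV (\<lambda>x. (t, x))" by (intro continuous_intros)
  from continuous_on_compose2[OF psi_cont this] continuous_on_compose2[OF psit_cont this]
  show "continuous_on UNIV (\<psi> t)" "continuous_on UNIV (\<psi>t t)" by simp_all
qed

lemma psit_cont_t: "continuous_on UNIV (\<lambda>t. \<psi>t t x)"
proof -
  have "continuous_on UNIV (\<lambda>t. (t, x))" by (intro continuous_intros)
  from continuous_on_compose2[OF psit_cont this] show ?thesis by simp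
qed

lemma psi_cont_t: "continuous_on UNIV (\<lambda>t. \<psi> t x)"
proof -
  have "continuous_on UNIV (\<lambda>t. (t, x))" by (intro continuous_intros)
  from continuous_on_compose2[OF psi_cont this] show ?thesis by simp
qed

lemma psi_meas_x [measurable]: "\<psi> t \<in> borel_measurable borel" "\<psi>t t \<in> borel_measurable borel"
  using psi_cont_x by (auto intro: borel_measurable_continuous_onI)

lemma psi_meas:
  "(\<lambda>z. \<psi> (fst z) (snd z)) \<in> borel_measurable (Iv a b \<Otimes>\<^sub>M lborel)"
  "(\<lambda>z. \<psi>t (fst z) (snd z)) \<in> borel_measurable (Iv a b \<Otimes>\<^sub>M lborel)"
  unfolding Iv_pair_lborel using psi_cont psit_cont
  by (auto intro!: measurable_restrict_space1 borel_measurable_continuous_onI)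

lemma L_nonneg: "0 \<le> L"
  using order_trans[OF abs_ge_zero psi_bound(1)] by blast

lemma Iv_sub: "t \<in> {s<..<r} \<Longrightarrow> t \<in> {0..T}"
  using sr by auto

lemma integrable_psi_times:
  fixes f :: "real \<Rightarrow> real"
  assumes "f \<in> borel_measurable borel" "\<And>x. \<bar>f x\<bar> \<le> C"
  shows "integrable lborel (\<lambda>x. f x * \<psi> t x)" "integrable lborel (\<lambda>x. f x * \<psi>t t x)"
    and "\<bar>\<integral>x. f x * \<psi> t x \<partial>lborel\<bar> \<le> C * L * (2 * \<bar>R\<bar>)" "\<bar>\<integral>x. f x * \<psi>t t x \<partial>lborel\<bar> \<le> C * L * (2 * \<bar>R\<bar>)"
proof -
  note [measurable] = assms(1)
  have int: "integrable lborel (\<lambda>x. C * L * indicator {-\<bar>R\<bar>..\<bar>R\<bar>} x)"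
    by (intro integrable_mult_right integrable_ind_Icc)
  have C: "0 \<le> C" using order_trans[OF abs_ge_zero assms(2)] by blast
  have le: "\<bar>f x * h x\<bar> \<le> C * L * indicator {-\<bar>R\<bar>..\<bar>R\<bar>} x"
    if "\<And>x. \<bar>h x\<bar> \<le> L" "\<And>x. \<bar>x\<bar> > R \<Longrightarrow> h x = 0" for x and h :: "real \<Rightarrow> real"
  proof (cases "\<bar>x\<bar> > R")
    case False
    then have "x \<in> {-\<bar>R\<bar>..\<bar>R\<bar>}" by auto
    then show ?thesis using assms(2)[of x] that(1)[of x] C by (auto simp: abs_mult intro!: mult_mono)
  qed (use that C L_nonneg in auto)
  have *: "integrable lborel (\<lambda>x. f x * h x) \<and> \<bar>\<integral>x. f x * h x \<partial>lborel\<bar> \<le> C * L * (2 * \<bar>R\<bar>)"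
    if h: "h \<in> borel_measurable borel" "\<And>x. \<bar>h x\<bar> \<le> L" "\<And>x. \<bar>x\<bar> > R \<Longrightarrow> h x = 0" for h
  proof
    note [measurable] = h(1)
    show i: "integrable lborel (\<lambda>x. f x * h x)"
      by (rule Bochner_Integration.integrable_bound[OF int])
        (measurable, use le[OF h(2,3)] C L_nonneg in \<open>auto intro!: AE_I2\<close>)
    have "\<bar>\<integral>x. f x * h x \<partial>lborel\<bar> \<le> (\<integral>x. \<bar>f x * h x\<bar> \<partial>lborel)"
      using integral_norm_bound[of lborel "\<lambda>x. f x * h x"] by simp
    also have "\<dots> \<le> (\<integral>x. C * L * indicator {-\<bar>R\<bar>..\<bar>R\<bar>} x \<partial>lborel)"
      by (intro integral_mono int integrable_abs i le h)
    also have "\<dots> = C * L * (2 * \<bar>R\<bar>)" by simp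
    finally show "\<bar>\<integral>x. f x * h x \<partial>lborel\<bar> \<le> C * L * (2 * \<bar>R\<bar>)" .
  qed
  show "integrable lborel (\<lambda>x. f x * \<psi> t x)" "integrable lborel (\<lambda>x. f x * \<psi>t t x)"
    "\<bar>\<integral>x. f x * \<psi> t x \<partial>lborel\<bar> \<le> C * L * (2 * \<bar>R\<bar>)" "\<bar>\<integral>x. f x * \<psi>t t x \<partial>lborel\<bar> \<le> C * L * (2 * \<bar>R\<bar>)"
    using *[OF psi_meas_x(1) psi_bound(1) psi_supp(1)] *[OF psi_meas_x(2) psi_bound(2) psi_supp(2)] by auto
qed

lemma integral_psi_LIMSEQ:
  fixes f :: "nat \<Rightarrow> real \<Rightarrow> real"
  assumes [measurable]: "\<And>k. f k \<in> borel_measurable borel" "g \<in> borel_measurable borel"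
    and C: "\<And>k x. \<bar>f k x\<bar> \<le> C" and lim: "AE x in lborel. (\<lambda>k. f k x) \<longlonglongrightarrow> g x"
  shows "(\<lambda>k. \<integral>x. f k x * \<psi> t x \<partial>lborel) \<longlonglongrightarrow> (\<integral>x. g x * \<psi> t x \<partial>lborel)"
    and "(\<lambda>k. \<integral>x. f k x * \<psi>t t x \<partial>lborel) \<longlonglongrightarrow> (\<integral>x. g x * \<psi>t t x \<partial>lborel)"
proof -
  have C0: "0 \<le> C" using order_trans[OF abs_ge_zero C] by blast
  have *: "(\<lambda>k. \<integral>x. f k x * h x \<partial>lborel) \<longlonglongrightarrow> (\<integral>x. g x * h x \<partial>lborel)"
    if hm: "h \<in> borel_measurable borel" and h: "integrable lborel (\<lambda>x. 1 * h x)" for h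
  proof (rule integral_dominated_convergence[where w="\<lambda>x. C * \<bar>h x\<bar>"])
    note [measurable] = hm
    show "(\<lambda>x. g x * h x) \<in> borel_measurable lborel" "(\<lambda>x. f k x * h x) \<in> borel_measurable lborel" for k by measurable
    show "AE x in lborel. (\<lambda>k. f k x * h x) \<longlonglongrightarrow> g x * h x"
      using lim by eventually_elim (intro tendsto_intros)
    show "AE x in lborel. norm (f k x * h x) \<le> C * \<bar>h x\<bar>" for k
      using C by (intro AE_I2) (auto simp: abs_mult intro!: mult_right_mono)
    show "integrable lborel (\<lambda>x. C * \<bar>h x\<bar>)" using h by simp
  qed
  show "(\<lambda>k. \<integral>x. f k x * \<psi> t x \<partial>lborel) \<longlonglongrightarrow> (\<integral>x. g x * \<psi> t x \<partial>lborel)"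
    by (rule *[OF psi_meas_x(1) integrable_psi_times(1)[where C=1]]) auto
  show "(\<lambda>k. \<integral>x. f k x * \<psi>t t x \<partial>lborel) \<longlonglongrightarrow> (\<integral>x. g x * \<psi>t t x \<partial>lborel)"
    by (rule *[OF psi_meas_x(2) integrable_psi_times(2)[where C=1]]) auto
qed

lemma moll_meas2:
  "(\<lambda>z. moll e (M (fst z)) (snd z)) \<in> borel_measurable (Iv s r \<Otimes>\<^sub>M lborel)"
proof -
  note [measurable] = M_measurable_split[OF sr(1,3)]
  show ?thesis unfolding moll_def
    by (rule lborel.borel_measurable_lebesgue_integral) measurable
qed

text \<open>The expansion \<open>q_sum\<close> contains \<open>M\<close> but no quantile, so joint
  measurability in time and space is inherited from \<open>M\<close>.\<close>

lemma q_meas2: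
  assumes e: "e > 0"
  shows "(\<lambda>z. q e (snd z) (fst z)) \<in> borel_measurable (Iv s r \<Otimes>\<^sub>M lborel)"
proof -
  have "(\<lambda>z. \<Sum>i\<le>n. B i (fst z) * (\<integral>y. prim (F i) (M (fst z) y) * (- bumpd ((snd z - y) / e) / e\<^sup>2) \<partial>lborel))
      \<in> borel_measurable (Iv s r \<Otimes>\<^sub>M lborel)"
  proof (rule borel_measurable_sum)
    fix i assume "i \<in> {..n}"
    then have i: "i \<le> n" by simp
    note [measurable] = B_measurable[OF i sr(1,3)] prim_measurable[OF F_int[OF i]] M_measurable_split[OF sr(1,3)]
    have "(\<lambda>z. \<integral>y. prim (F i) (M (fst z) y) * (- bumpd ((snd z - y) / e) / e\<^sup>2) \<partial>lborel) \<in> borel_measurable (Iv s r \<Otimes>\<^sub>M lborel)"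
      by (rule lborel.borel_measurable_lebesgue_integral) measurable
    then show "(\<lambda>z. B i (fst z) * (\<integral>y. prim (F i) (M (fst z) y) * (- bumpd ((snd z - y) / e) / e\<^sup>2) \<partial>lborel)) \<in> borel_measurable (Iv s r \<Otimes>\<^sub>M lborel)"
      by measurable
  qed
  then show ?thesis
    by (rule measurable_cong[THEN iffD1, rotated], subst q_sum[OF e Iv_sub])
      (auto simp: space_pair_measure)
qed

lemma q_bounded:
  assumes e: "e > 0" obtains C where "\<And>x t. t \<in> {0..T} \<Longrightarrow> \<bar>q e x t\<bar> \<le> C" "0 \<le> C"
proof -
  obtain Cb where Cb: "\<And>y. \<bar>bump y\<bar> \<le> Cb" using bump_bounded by blast
  have Cb0: "0 \<le> Cb / e" using order_trans[OF abs_ge_zero Cb] e by auto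
  obtain c where c: "\<And>t. t \<in> {0..T} \<Longrightarrow> (\<integral>m. \<bar>Phi t m\<bar> \<partial>Unif) \<le> c" using Phi_L1 by blast
  have "\<bar>q e x t\<bar> \<le> Cb / e * c" if t: "t \<in> {0..T}" for x t
  proof -
    interpret t: cdf_fun "M t" by (rule cdf_fun_M) fact
    note [measurable] = borel_measurable_integrable[OF Phi_int]
    have le: "\<bar>Phi t m * (bump ((x - quant (M t) m) / e) / e)\<bar> \<le> Cb / e * \<bar>Phi t m\<bar>" for m
    proof -
      have "\<bar>bump ((x - quant (M t) m) / e) / e\<bar> \<le> Cb / e"
        using Cb[of "(x - quant (M t) m) / e"] e by (simp add: divide_right_mono)
      then have "\<bar>bump ((x - quant (M t) m) / e) / e\<bar> * \<bar>Phi t m\<bar> \<le> Cb / e * \<bar>Phi t m\<bar>"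
        by (rule mult_right_mono) simp
      then show ?thesis by (simp only: abs_mult mult.commute)
    qed
    have int: "integrable Unif (\<lambda>m. Cb / e * \<bar>Phi t m\<bar>)" using Phi_int by (intro integrable_mult_right integrable_abs)
    have "\<bar>q e x t\<bar> \<le> (\<integral>m. \<bar>Phi t m * (bump ((x - quant (M t) m) / e) / e)\<bar> \<partial>Unif)"
      unfolding q_def abs_minus_cancel
      using integral_norm_bound[of Unif "\<lambda>m. Phi t m * (bump ((x - quant (M t) m) / e) / e)"] by simp
    also have "\<dots> \<le> (\<integral>m. Cb / e * \<bar>Phi t m\<bar> \<partial>Unif)"
    proof (rule integral_mono[OF _ int le])
      show "integrable Unif (\<lambda>m. \<bar>Phi t m * (bump ((x - quant (M t) m) / e) / e)\<bar>)"
      proof (rule Bochner_Integration.integrable_bound[OF int])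
        show "AE m in Unif. norm \<bar>Phi t m * (bump ((x - quant (M t) m) / e) / e)\<bar> \<le> norm (Cb / e * \<bar>Phi t m\<bar>)"
          unfolding real_norm_def abs_idempotent by (intro AE_I2 order_trans[OF le abs_ge_self])
      qed measurable
    qed
    also have "\<dots> = Cb / e * (\<integral>m. \<bar>Phi t m\<bar> \<partial>Unif)" by (rule integral_mult_right_zero)
    also have "\<dots> \<le> Cb / e * c" using c[OF t] Cb0 by (rule mult_left_mono)
    finally show ?thesis .
  qed
  moreover have "0 \<le> Cb / e * c"
  proof -
    have "0 \<le> (\<integral>m. \<bar>Phi 0 m\<bar> \<partial>Unif)" by simp
    also have "\<dots> \<le> c" using T by (intro c) auto
    finally have "0 \<le> c" .
    then show ?thesis using Cb0 by (rule mult_nonneg_nonneg[rotated])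
  qed
  ultimately show ?thesis by (rule that)
qed

text \<open>At fixed \<open>x\<close> the mollified solution is differentiable in time, so
  \<open>prim G (moll e (M t) x) * \<psi> t x\<close> obeys the ordinary chain and product rules.
  Its increment over \<open>[s, r]\<close> is integrated in \<open>x\<close>, and the two integrals
  are exchanged.\<close>

lemma mollified_balance:
  assumes G: "continuous_on UNIV G" and K: "\<And>y. \<bar>G y\<bar> \<le> K" and e: "e > 0"
  shows "(\<integral>x. prim G (moll e (M r) x) * \<psi> r x \<partial>lborel) - (\<integral>x. prim G (moll e (M s) x) * \<psi> s x \<partial>lborel)
    = (\<integral>t. (\<integral>x. \<psi> t x * G (moll e (M t) x) * q e x t \<partial>lborel) + (\<integral>x. prim G (moll e (M t) x) * \<psi>t t x \<partial>lborel) \<partial>Iv s r)"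
    and "(\<lambda>t. \<integral>x. \<psi> t x * G (moll e (M t) x) * q e x t \<partial>lborel) \<in> borel_measurable (Iv s r)"
    and "(\<lambda>t. \<integral>x. prim G (moll e (M t) x) * \<psi>t t x \<partial>lborel) \<in> borel_measurable (Iv s r)"
proof -
  interpret P: pair_sigma_finite "Iv s r" "lborel :: real measure" by (rule pair_Iv_lborel)
  have Gi: "integrable Unif G" by (rule integrable_Unif_bounded[OF G K])
  have Gm: "G \<in> borel_measurable borel" using G by (rule borel_measurable_continuous_onI)
  have K0: "0 \<le> K" using order_trans[OF abs_ge_zero K] by blast
  define K1 where "K1 = (\<integral>m. \<bar>G m\<bar> \<partial>Unif)"
  have K1: "\<bar>prim G y\<bar> \<le> K1" for y unfolding K1_def by (rule prim_bound[OF Gi])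
  have K10: "0 \<le> K1" by (simp add: K1_def)
  obtain Cq where Cq: "\<And>x t. t \<in> {0..T} \<Longrightarrow> \<bar>q e x t\<bar> \<le> Cq" "0 \<le> Cq" using q_bounded[OF e] by blast
  note [measurable] = Gm prim_measurable[OF Gi] moll_meas2 q_meas2[OF e] psi_meas
  have m1: "(\<lambda>z. \<psi> (fst z) (snd z) * G (moll e (M (fst z)) (snd z)) * q e (snd z) (fst z)) \<in> borel_measurable (Iv s r \<Otimes>\<^sub>M lborel)"
    by measurable
  have m2: "(\<lambda>z. prim G (moll e (M (fst z)) (snd z)) * \<psi>t (fst z) (snd z)) \<in> borel_measurable (Iv s r \<Otimes>\<^sub>M lborel)"
    by measurable
  show "(\<lambda>t. \<integral>x. \<psi> t x * G (moll e (M t) x) * q e x t \<partial>lborel) \<in> borel_measurable (Iv s r)"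
    by (rule lborel.borel_measurable_lebesgue_integral) (use m1 in \<open>simp add: case_prod_unfold\<close>)
  show "(\<lambda>t. \<integral>x. prim G (moll e (M t) x) * \<psi>t t x \<partial>lborel) \<in> borel_measurable (Iv s r)"
    by (rule lborel.borel_measurable_lebesgue_integral) (use m2 in \<open>simp add: case_prod_unfold\<close>)
  let ?I1 = "\<lambda>t x. \<psi> t x * G (moll e (M t) x) * q e x t"
  let ?I2 = "\<lambda>t x. prim G (moll e (M t) x) * \<psi>t t x"
  define D where "D = L * K * Cq + K1 * L"
  have D0: "0 \<le> D" unfolding D_def using L_nonneg K0 Cq K10 by (intro add_nonneg_nonneg mult_nonneg_nonneg)
  have bnd: "\<bar>?I1 t x\<bar> \<le> D * indicator {-\<bar>R\<bar>..\<bar>R\<bar>} x" "\<bar>?I2 t x\<bar> \<le> D * indicator {-\<bar>R\<bar>..\<bar>R\<bar>} x"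
    if t: "t \<in> {0..T}" for t x
  proof -
    have "\<bar>?I1 t x\<bar> \<le> L * K * Cq" unfolding abs_mult
      using L_nonneg K0 Cq(2) by (intro mult_mono psi_bound K Cq(1)[OF t]) auto
    moreover have "\<bar>?I2 t x\<bar> \<le> K1 * L" unfolding abs_mult
      using K10 by (intro mult_mono psi_bound K1) auto
    moreover have "0 \<le> L * K * Cq" "0 \<le> K1 * L" using L_nonneg K0 Cq K10 by auto
    ultimately have "\<bar>?I1 t x\<bar> \<le> D" "\<bar>?I2 t x\<bar> \<le> D" unfolding D_def by linarith+
    moreover have "\<bar>?I1 t x\<bar> = 0 \<and> \<bar>?I2 t x\<bar> = 0" if "x \<notin> {-\<bar>R\<bar>..\<bar>R\<bar>}"
    proof -
      have "\<bar>x\<bar> > R" using that by auto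
      then show ?thesis by (simp add: psi_supp)
    qed
    ultimately show "\<bar>?I1 t x\<bar> \<le> D * indicator {-\<bar>R\<bar>..\<bar>R\<bar>} x" "\<bar>?I2 t x\<bar> \<le> D * indicator {-\<bar>R\<bar>..\<bar>R\<bar>} x"
      using D0 by (auto simp: indicator_def)
  qed
  have dom: "integrable (Iv s r \<Otimes>\<^sub>M lborel) (\<lambda>z. D * indicator {-\<bar>R\<bar>..\<bar>R\<bar>} (snd z) :: real)"
    using P.integrable_fst_mult_snd[of "\<lambda>_. D" "indicator {-\<bar>R\<bar>..\<bar>R\<bar>}"] integrable_ind_Icc by simp
  have i1: "integrable (Iv s r \<Otimes>\<^sub>M lborel) (\<lambda>z. ?I1 (fst z) (snd z))"
    by (rule Bochner_Integration.integrable_bound[OF dom m1])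
      (auto intro!: AE_I2 order_trans[OF bnd(1)] Iv_sub simp: space_pair_measure)
  have i2: "integrable (Iv s r \<Otimes>\<^sub>M lborel) (\<lambda>z. ?I2 (fst z) (snd z))"
    by (rule Bochner_Integration.integrable_bound[OF dom m2])
      (auto intro!: AE_I2 order_trans[OF bnd(2)] Iv_sub simp: space_pair_measure)
  have ft: "(\<integral>t. ?I1 t x + ?I2 t x \<partial>Iv s r) = prim G (moll e (M r) x) * \<psi> r x - prim G (moll e (M s) x) * \<psi> s x" for x
  proof -
    obtain P where P: "\<And>x. (P has_real_derivative G x) (at x)" using antiderivative[OF G] by blast
    have moll01: "0 \<le> moll e (M t) x" "moll e (M t) x \<le> 1" if "t \<in> {0..T}" for t
      using cdf_fun.moll_bounds[OF cdf_fun_M[OF that]] by auto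
    \<comment> \<open>Mollified values lie in \<open>[0,1]\<close>, where \<open>prim G\<close> can
      be traded for the globally differentiable \<open>P\<close>.\<close>
    have pP: "prim G (moll e (M t) x) = P (moll e (M t) x) - P 0" if "t \<in> {0..T}" for t
      using prim_eq_diff[OF P G order_refl moll01(1)[OF that] moll01(2)[OF that] Gi] by simp
    have d: "((\<lambda>t. (P (moll e (M t) x) - P 0) * \<psi> t x) has_real_derivative
        (G (moll e (M t) x) * q e x t) * \<psi> t x + \<psi>t t x * (P (moll e (M t) x) - P 0)) (at t within {0..T})"
      if t: "t \<in> {0..T}" for t
    proof -
      have "((\<lambda>t. P (moll e (M t) x) - P 0) has_real_derivative G (moll e (M t) x) * q e x t - 0) (at t within {0..T})"
        by (intro DERIV_diff DERIV_const DERIV_chain2[OF P] moll_has_derivative e t)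
      from DERIV_mult[OF this has_field_derivative_at_within[OF psi_deriv]] show ?thesis by simp
    qed
    have dG: "((\<lambda>t. (P (moll e (M t) x) - P 0) * \<psi> t x) has_vector_derivative ?I1 t x + ?I2 t x) (at t within {s..r})"
      if t: "s \<le> t" "t \<le> r" for t
    proof -
      have t': "t \<in> {0..T}" using t sr by auto
      have "((\<lambda>t. (P (moll e (M t) x) - P 0) * \<psi> t x) has_real_derivative
        (G (moll e (M t) x) * q e x t) * \<psi> t x + \<psi>t t x * (P (moll e (M t) x) - P 0)) (at t within {s..r})"
        by (rule DERIV_subset[OF d[OF t']]) (use sr in auto)
      also have "(G (moll e (M t) x) * q e x t) * \<psi> t x + \<psi>t t x * (P (moll e (M t) x) - P 0) = ?I1 t x + ?I2 t x"
        using pP[OF t'] by (simp add: mult_ac)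
      finally show ?thesis by (simp add: has_real_derivative_iff_has_vector_derivative)
    qed
    have sub: "{s..r} \<subseteq> {0..T}" using sr by auto
    have cont: "continuous_on {s..r} (\<lambda>t. ?I1 t x + ?I2 t x)"
      by (intro continuous_intros continuous_on_subset[OF psi_cont_t] continuous_on_subset[OF psit_cont_t]
          continuous_on_compose2[OF G] continuous_on_compose2[OF continuous_prim[OF Gi]]
          continuous_on_subset[OF continuous_moll[OF e] sub] continuous_on_subset[OF continuous_q[OF e] sub]) auto
    have "(\<integral>t. ?I1 t x + ?I2 t x \<partial>Iv s r) = (\<integral>t. indicator {s..r} t * (?I1 t x + ?I2 t x) \<partial>lborel)"
      by (rule integral_Iv_Icc[OF cont])
    also have "\<dots> = (P (moll e (M r) x) - P 0) * \<psi> r x - (P (moll e (M s) x) - P 0) * \<psi> s x"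
      using integral_FTC_Icc[OF less_imp_le[OF sr(2)] dG cont] by simp
    finally show ?thesis using pP[of s] pP[of r] sr by simp
  qed
  have mollm: "moll e (M t) \<in> borel_measurable borel" if "t \<in> {0..T}" for t
    by (rule moll_measurable[OF cdf_fun.F_measurable[OF cdf_fun_M[OF that]]])
  have "(\<integral>x. prim G (moll e (M r) x) * \<psi> r x \<partial>lborel) - (\<integral>x. prim G (moll e (M s) x) * \<psi> s x \<partial>lborel)
      = (\<integral>x. prim G (moll e (M r) x) * \<psi> r x - prim G (moll e (M s) x) * \<psi> s x \<partial>lborel)"
    using mollm[of r] mollm[of s] sr
    by (intro Bochner_Integration.integral_diff[symmetric] integrable_psi_times(1)[where C=K1] K1
        measurable_compose[OF _ prim_measurable[OF Gi]]) auto
  also have "\<dots> = (\<integral>x. (\<integral>t. ?I1 t x + ?I2 t x \<partial>Iv s r) \<partial>lborel)" by (simp only: ft)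
  also have "\<dots> = (\<integral>t. (\<integral>x. ?I1 t x + ?I2 t x \<partial>lborel) \<partial>Iv s r)"
    using P.Fubini_integral[of "\<lambda>t x. ?I1 t x + ?I2 t x"] Bochner_Integration.integrable_add[OF i1 i2]
    by (simp add: case_prod_unfold)
  also have "\<dots> = (\<integral>t. (\<integral>x. ?I1 t x \<partial>lborel) + (\<integral>x. ?I2 t x \<partial>lborel) \<partial>Iv s r)"
  proof (intro Bochner_Integration.integral_cong refl)
    fix t assume "t \<in> space (Iv s r)"
    then have t: "t \<in> {0..T}" and t': "t \<in> {s<..<r}" using sr by auto
    have dom: "integrable lborel (\<lambda>x. D * indicator {-\<bar>R\<bar>..\<bar>R\<bar>} x)"
      by (intro integrable_mult_right integrable_ind_Icc)
    have mx: "(\<lambda>x. f t x) \<in> borel_measurable lborel"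
      if f: "(\<lambda>z. f (fst z) (snd z)) \<in> borel_measurable (Iv s r \<Otimes>\<^sub>M (lborel :: real measure))" for f :: "real \<Rightarrow> real \<Rightarrow> real"
      using measurable_compose[OF measurable_Pair1'[of t "Iv s r" lborel] f] t' by simp
    show "(\<integral>x. ?I1 t x + ?I2 t x \<partial>lborel) = (\<integral>x. ?I1 t x \<partial>lborel) + (\<integral>x. ?I2 t x \<partial>lborel)"
    proof (rule Bochner_Integration.integral_add)
      show "integrable lborel (\<lambda>x. ?I1 t x)"
        by (rule Bochner_Integration.integrable_bound[OF dom mx[OF m1]]) (auto intro!: AE_I2 order_trans[OF bnd(1)[OF t]])
      show "integrable lborel (\<lambda>x. ?I2 t x)"
        by (rule Bochner_Integration.integrable_bound[OF dom mx[OF m2]]) (auto intro!: AE_I2 order_trans[OF bnd(2)[OF t]])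
    qed
  qed
  finally show "(\<integral>x. prim G (moll e (M r) x) * \<psi> r x \<partial>lborel) - (\<integral>x. prim G (moll e (M s) x) * \<psi> s x \<partial>lborel)
    = (\<integral>t. (\<integral>x. ?I1 t x \<partial>lborel) + (\<integral>x. ?I2 t x \<partial>lborel) \<partial>Iv s r)" .
qed

text \<open>The limit \<open>e\<close> to 0 of the mollified balance. Continuity of \<open>G\<close>
  is what lets \<open>G\<close> pass through the blow-up limit at each time; bounds uniform in
  \<open>e\<close> and \<open>t\<close> then carry the time integral along.\<close>

lemma balance_continuous:
  assumes G: "continuous_on UNIV G" and K: "\<And>y. \<bar>G y\<bar> \<le> K"
  shows "balance G"
proof -
  have Gi: "integrable Unif G" by (rule integrable_Unif_bounded[OF G K])
  have Gm: "G \<in> borel_measurable borel" using G by (rule borel_measurable_continuous_onI)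
  have K0: "0 \<le> K" using order_trans[OF abs_ge_zero K] by blast
  define K1 where "K1 = (\<integral>m. \<bar>G m\<bar> \<partial>Unif)"
  have K1: "\<bar>prim G y\<bar> \<le> K1" for y unfolding K1_def by (rule prim_bound[OF Gi])
  define e where "e k = inverse (real (Suc k))" for k
  have e: "e k > 0" "e \<longlonglongrightarrow> 0" for k
    using LIMSEQ_inverse_real_of_nat by (simp_all add: e_def[abs_def])
  obtain c where c: "\<And>t. t \<in> {0..T} \<Longrightarrow> (\<integral>m. \<bar>Phi t m\<bar> \<partial>Unif) \<le> c" using Phi_L1 by blast
  let ?J1 = "\<lambda>k t. \<integral>x. \<psi> t x * G (moll (e k) (M t) x) * q (e k) x t \<partial>lborel"
  let ?J2 = "\<lambda>k t. \<integral>x. prim G (moll (e k) (M t) x) * \<psi>t t x \<partial>lborel"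
  have J1: "(\<lambda>k. ?J1 k t) \<longlonglongrightarrow> - flow G t" "\<bar>?J1 k t\<bar> \<le> L * K * c" if t: "t \<in> {0..T}" for t k
  proof -
    interpret t: cdf_fun "M t" by (rule cdf_fun_M) fact
    let ?S = "\<lambda>k. \<integral>x. \<psi> t x * G (moll (e k) (M t) x) * (\<integral>m. Phi t m * (bump ((x - quant (M t) m) / e k) / e k) \<partial>Unif) \<partial>lborel"
    have eq: "?J1 k t = - ?S k" for k unfolding q_def by simp
    have "?S \<longlonglongrightarrow> (\<integral>m. G m * t.avg (Phi t) (quant (M t) m) * \<psi> t (quant (M t) m) \<partial>Unif)"
      by (rule t.mollified_flux_limit[OF G K psi_cont_x(1) psi_bound(1) Phi_int e])
    then have "?S \<longlonglongrightarrow> flow G t" unfolding flow_def V_eq_avg[OF t] .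
    then show "(\<lambda>k. ?J1 k t) \<longlonglongrightarrow> - flow G t" unfolding eq by (rule tendsto_minus)
    have "\<bar>?S k\<bar> \<le> L * K * (\<integral>m. \<bar>Phi t m\<bar> \<partial>Unif)"
      by (rule t.mollified_flux_bound[OF Gm K psi_meas_x(1) psi_bound(1) Phi_int e(1)])
    also have "\<dots> \<le> L * K * c" using c[OF t] K0 L_nonneg by (intro mult_left_mono) auto
    finally show "\<bar>?J1 k t\<bar> \<le> L * K * c" unfolding eq by simp
  qed
  have pm: "(\<lambda>x. prim G (moll (e k) (M t) x)) \<in> borel_measurable borel"
    "(\<lambda>x. prim G (M t x)) \<in> borel_measurable borel" if t: "t \<in> {0..T}" for t k
    by (rule measurable_compose[OF _ prim_measurable[OF Gi]],
        rule moll_measurable cdf_fun.F_measurable[OF cdf_fun_M[OF t]],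
        (rule cdf_fun.F_measurable[OF cdf_fun_M[OF t]])?)+
  have lim: "AE x in lborel. (\<lambda>k. prim G (moll (e k) (M t) x)) \<longlonglongrightarrow> prim G (M t x)" if t: "t \<in> {0..T}" for t
    using AE_continuity_point[OF t]
  proof eventually_elim
    case (elim x)
    have "(\<lambda>k. moll (e k) (M t) x) \<longlonglongrightarrow> M t x"
      by (rule cdf_fun.moll_LIMSEQ[OF cdf_fun_M[OF t] e elim])
    then show ?case using continuous_prim[OF Gi]
      by (intro isCont_tendsto_compose[of _ "prim G"]) (auto simp: continuous_on_eq_continuous_at)
  qed
  note J2 = integral_psi_LIMSEQ[OF pm(1) pm(2) K1 lim]
  have J2b: "\<bar>?J2 k t\<bar> \<le> K1 * L * (2 * \<bar>R\<bar>)" if t: "t \<in> {0..T}" for t k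
    by (rule integrable_psi_times(4)[OF pm(1)[OF t] K1])
  have m1: "?J1 k \<in> borel_measurable (Iv s r)" and m2: "?J2 k \<in> borel_measurable (Iv s r)" for k
    by (rule mollified_balance(2,3)[OF G K e(1)])+
  have "(\<lambda>t. - flow G t) \<in> borel_measurable (Iv s r)"
    by (rule borel_measurable_LIMSEQ_real[where u="?J1", OF _ m1]) (use J1(1) Iv_sub in auto)
  then have fm: "flow G \<in> borel_measurable (Iv s r)" by simp
  have dm: "drift G \<in> borel_measurable (Iv s r)"
    by (rule borel_measurable_LIMSEQ_real[where u="?J2", OF _ m2]) (use J2(2) Iv_sub in \<open>auto simp: drift_def\<close>)
  have rhs: "(\<lambda>k. \<integral>t. ?J1 k t + ?J2 k t \<partial>Iv s r) \<longlonglongrightarrow> (\<integral>t. - flow G t + drift G t \<partial>Iv s r)"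
  proof (rule integral_dominated_convergence[where w="\<lambda>t. L * K * c + K1 * L * (2 * \<bar>R\<bar>)"])
    show "AE t in Iv s r. (\<lambda>k. ?J1 k t + ?J2 k t) \<longlonglongrightarrow> - flow G t + drift G t"
      unfolding drift_def using J1(1) J2(2) Iv_sub by (intro AE_I2 tendsto_add) auto
    show "AE t in Iv s r. norm (?J1 k t + ?J2 k t) \<le> L * K * c + K1 * L * (2 * \<bar>R\<bar>)" for k
    proof (rule AE_I2)
      fix t assume "t \<in> space (Iv s r)"
      then have t: "t \<in> {0..T}" using Iv_sub by simp
      show "norm (?J1 k t + ?J2 k t) \<le> L * K * c + K1 * L * (2 * \<bar>R\<bar>)"
        using J1(2)[OF t, of k] J2b[OF t, of k] abs_triangle_ineq[of "?J1 k t" "?J2 k t"]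
        unfolding real_norm_def by linarith
    qed
  qed (use m1 m2 fm dm in auto)
  have rs: "r \<in> {0..T}" "s \<in> {0..T}" using sr by auto
  have lhs: "(\<lambda>k. (\<integral>x. prim G (moll (e k) (M r) x) * \<psi> r x \<partial>lborel) - (\<integral>x. prim G (moll (e k) (M s) x) * \<psi> s x \<partial>lborel))
      \<longlonglongrightarrow> mass G r - mass G s"
    unfolding mass_def by (intro tendsto_diff J2(1) rs)
  have "mass G r - mass G s = (\<integral>t. - flow G t + drift G t \<partial>Iv s r)"
    using lhs rhs unfolding mollified_balance(1)[OF G K e(1)] by (rule LIMSEQ_unique)
  then show ?thesis unfolding balance_def using fm dm by simp
qed

text \<open>The balance survives almost everywhere convergence under a square-integrable majorant
  \<open>H\<close>. The delicate term is the flow: its integrand is dominated by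
  \<open>L * \<bar>H m * V t m\<bar>\<close>, whose integral is bounded uniformly in time because
  \<open>V t\<close> is bounded in \<open>L^2\<close>.\<close>

lemma balance_dominated:
  fixes G :: "nat \<Rightarrow> real \<Rightarrow> real"
  assumes bal: "\<And>k. balance (G k)"
    and Gm: "\<And>k. G k \<in> borel_measurable Unif" and gm: "g \<in> borel_measurable Unif" and Hm: "H \<in> borel_measurable Unif"
    and H2: "integrable Unif (\<lambda>m. (H m)\<^sup>2)"
    and le: "\<And>k m. m \<in> {0<..<1} \<Longrightarrow> \<bar>G k m\<bar> \<le> H m"
    and lim: "AE m in Unif. (\<lambda>k. G k m) \<longlonglongrightarrow> g m"
  shows "balance g"
proof -
  note [measurable] = Gm gm Hm
  have H1: "integrable Unif H"
  proof (rule Bochner_Integration.integrable_bound)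
    show "integrable Unif (\<lambda>m. 1 + (H m)\<^sup>2)" using H2 by simp
    have "\<bar>a\<bar> \<le> 1 + a\<^sup>2" for a :: real
      using sum_squares_bound[of "\<bar>a\<bar>" 1] abs_ge_zero[of a] by simp
    then show "AE m in Unif. norm (H m) \<le> norm (1 + (H m)\<^sup>2)" by (intro AE_I2) simp
  qed measurable
  have Gi: "integrable Unif (G k)" for k
    by (rule Bochner_Integration.integrable_bound[OF H1])
      (use le in \<open>auto intro!: AE_I2 intro: order_trans[OF _ abs_ge_self]\<close>)
  have gi: "integrable Unif g"
    by (rule integrable_dominated_convergence[OF _ _ H1 lim]) (use le in auto)
  define C where "C = (\<integral>m. H m \<partial>Unif)"
  have primC: "\<bar>prim (G k) y\<bar> \<le> C" for k y
  proof -
    have "(\<integral>m. \<bar>G k m\<bar> \<partial>Unif) \<le> C" unfolding C_def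
      by (intro integral_mono integrable_abs Gi H1 le) simp
    then show ?thesis using prim_bound[OF Gi[of k], of y] by linarith
  qed
  have primlim: "(\<lambda>k. prim (G k) y) \<longlonglongrightarrow> prim g y" for y
    unfolding prim_def
  proof (rule integral_dominated_convergence[where w=H])
    show "AE m in Unif. (\<lambda>k. indicator {..y} m * G k m) \<longlonglongrightarrow> indicator {..y} m * g m"
      using lim by eventually_elim (intro tendsto_intros)
    show "AE m in Unif. norm (indicator {..y} m * G k m) \<le> H m" for k
      using le by (intro AE_I2) (auto simp: indicator_def intro: order_trans[OF abs_ge_zero])
  qed (auto intro!: borel_measurable_integrable integrable_Unif_indicator Gi gi H1)
  have pm: "(\<lambda>x. prim h (M t x)) \<in> borel_measurable borel" if "t \<in> {0..T}" "integrable Unif h" for t h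
    by (rule measurable_compose[OF cdf_fun.F_measurable[OF cdf_fun_M[OF that(1)]] prim_measurable[OF that(2)]])
  have "AE x in lborel. (\<lambda>k. prim (G k) (M t x)) \<longlonglongrightarrow> prim g (M t x)" for t using primlim by simp
  note P = integral_psi_LIMSEQ[OF pm[OF _ Gi] pm[OF _ gi] primC this]
  have Pb: "\<bar>drift (G k) t\<bar> \<le> C * L * (2 * \<bar>R\<bar>)" if t: "t \<in> {0..T}" for t k
    unfolding drift_def by (rule integrable_psi_times(4)[OF pm[OF t Gi] primC])
  from V_L2 obtain K2 where K2': "\<forall>t\<in>{0..T}. integrable Unif (\<lambda>m. (V t m)\<^sup>2) \<and> (\<integral>m. (V t m)\<^sup>2 \<partial>Unif) \<le> K2"
    by (elim exE)
  have K2: "(\<integral>m. (V t m)\<^sup>2 \<partial>Unif) \<le> K2" if "t \<in> {0..T}" for t using K2' that by simp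
  define D where "D = L * ((\<integral>m. (H m)\<^sup>2 \<partial>Unif) + K2)"
  have fl: "(\<lambda>k. flow (G k) t) \<longlonglongrightarrow> flow g t" "\<bar>flow (G k) t\<bar> \<le> D" if t: "t \<in> {0..T}" for t k
  proof -
    interpret t: cdf_fun "M t" by (rule cdf_fun_M) fact
    note [measurable] = V_measurable[OF t]
    have HV: "integrable Unif (\<lambda>m. L * \<bar>H m * V t m\<bar>)"
      using L2_mult_V(1)[OF t Hm H2] by (intro integrable_mult_right integrable_abs)
    have bd: "\<bar>G k m * V t m * \<psi> t (quant (M t) m)\<bar> \<le> L * \<bar>H m * V t m\<bar>" if "m \<in> {0<..<1}" for k m
    proof -
      have "\<bar>G k m\<bar> * \<bar>V t m\<bar> * \<bar>\<psi> t (quant (M t) m)\<bar> \<le> \<bar>H m\<bar> * \<bar>V t m\<bar> * L"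
        using le[OF that, of k] by (intro mult_mono psi_bound) auto
      then show ?thesis by (simp add: abs_mult mult_ac)
    qed
    show "(\<lambda>k. flow (G k) t) \<longlonglongrightarrow> flow g t" unfolding flow_def
    proof (rule integral_dominated_convergence[OF _ _ HV])
      show "AE m in Unif. (\<lambda>k. G k m * V t m * \<psi> t (quant (M t) m)) \<longlonglongrightarrow> g m * V t m * \<psi> t (quant (M t) m)"
        using lim by eventually_elim (intro tendsto_intros)
      show "AE m in Unif. norm (G k m * V t m * \<psi> t (quant (M t) m)) \<le> L * \<bar>H m * V t m\<bar>" for k
        using bd by (intro AE_I2) simp
    qed measurable
    have "\<bar>flow (G k) t\<bar> \<le> (\<integral>m. \<bar>G k m * V t m * \<psi> t (quant (M t) m)\<bar> \<partial>Unif)"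
      unfolding flow_def using integral_norm_bound[of Unif "\<lambda>m. G k m * V t m * \<psi> t (quant (M t) m)"] by simp
    also have "\<dots> \<le> (\<integral>m. L * \<bar>H m * V t m\<bar> \<partial>Unif)"
    proof (rule integral_mono[OF _ HV])
      show "integrable Unif (\<lambda>m. \<bar>G k m * V t m * \<psi> t (quant (M t) m)\<bar>)"
      proof (rule Bochner_Integration.integrable_bound[OF HV])
        show "AE m in Unif. norm \<bar>G k m * V t m * \<psi> t (quant (M t) m)\<bar> \<le> norm (L * \<bar>H m * V t m\<bar>)"
          using bd by (intro AE_I2) (simp add: order_trans[OF _ abs_ge_self])
      qed measurable
    qed (use bd in simp)
    also have "\<dots> = L * (\<integral>m. \<bar>H m * V t m\<bar> \<partial>Unif)" by (rule integral_mult_right_zero)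
    also have "\<dots> \<le> D" unfolding D_def
      using L2_mult_V(2)[OF t Hm H2] K2[OF t] L_nonneg by (intro mult_left_mono) linarith+
    finally show "\<bar>flow (G k) t\<bar> \<le> D" .
  qed
  have fmk: "flow (G k) \<in> borel_measurable (Iv s r)" and dmk: "drift (G k) \<in> borel_measurable (Iv s r)" for k
    using bal[of k] by (auto simp: balance_def)
  have fm: "flow g \<in> borel_measurable (Iv s r)"
    by (rule borel_measurable_LIMSEQ_real[where u="\<lambda>k. flow (G k)", OF _ fmk]) (use fl(1) Iv_sub in auto)
  have dm: "drift g \<in> borel_measurable (Iv s r)"
    by (rule borel_measurable_LIMSEQ_real[where u="\<lambda>k. drift (G k)", OF _ dmk]) (use P(2) Iv_sub in \<open>auto simp: drift_def\<close>)
  have rhs: "(\<lambda>k. \<integral>t. drift (G k) t - flow (G k) t \<partial>Iv s r) \<longlonglongrightarrow> (\<integral>t. drift g t - flow g t \<partial>Iv s r)"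
  proof (rule integral_dominated_convergence[where w="\<lambda>t. C * L * (2 * \<bar>R\<bar>) + D"])
    show "AE t in Iv s r. (\<lambda>k. drift (G k) t - flow (G k) t) \<longlonglongrightarrow> drift g t - flow g t"
      unfolding drift_def using P(2) fl(1) Iv_sub by (intro AE_I2 tendsto_diff) auto
    show "AE t in Iv s r. norm (drift (G k) t - flow (G k) t) \<le> C * L * (2 * \<bar>R\<bar>) + D" for k
    proof (rule AE_I2)
      fix t assume "t \<in> space (Iv s r)"
      then have t: "t \<in> {0..T}" using Iv_sub by simp
      show "norm (drift (G k) t - flow (G k) t) \<le> C * L * (2 * \<bar>R\<bar>) + D"
        using Pb[OF t, of k] fl(2)[OF t, of k] abs_triangle_ineq4[of "drift (G k) t" "flow (G k) t"]
        unfolding real_norm_def by linarith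
    qed
  qed (use fm dm fmk dmk in auto)
  have rs: "r \<in> {0..T}" "s \<in> {0..T}" using sr by auto
  have lhs: "(\<lambda>k. mass (G k) r - mass (G k) s) \<longlonglongrightarrow> mass g r - mass g s"
    unfolding mass_def by (intro tendsto_diff P(1) rs)
  have "mass (G k) r - mass (G k) s = (\<integral>t. drift (G k) t - flow (G k) t \<partial>Iv s r)" for k
    using bal[of k] by (simp add: balance_def)
  then have "mass g r - mass g s = (\<integral>t. drift g t - flow g t \<partial>Iv s r)"
    using lhs rhs by (simp add: LIMSEQ_unique)
  then show ?thesis unfolding balance_def using fm dm by simp
qed

text \<open>A Lebesgue measurable function is an almost everywhere limit of continuous ones, which
  is the content of \<open>measurable_on\<close>. Clipping these at \<open>-K\<close> and
  \<open>K\<close> restores the bound and leaves the limit unchanged.\<close>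

lemma balance_bounded:
  assumes G: "G \<in> borel_measurable Unif" and K: "\<And>m. m \<in> {0<..<1} \<Longrightarrow> \<bar>G m\<bar> \<le> K"
  shows "balance G"
proof -
  have K0: "0 \<le> K" using order_trans[OF abs_ge_zero K[of "1/2"]] by simp
  let ?G = "\<lambda>m. indicator {0<..<1} m * G m"
  have "?G \<in> borel_measurable lebesgue"
    using G by (intro measurable_completion) (simp add: measurable_Unif set_borel_measurable_def)
  then have "?G measurable_on UNIV" by (intro lebesgue_measurable_imp_measurable_on_real) auto
  then obtain N g where N: "negligible N" and g: "\<And>k. continuous_on UNIV (g k)"
    and lim: "\<And>x. x \<notin> N \<Longrightarrow> (\<lambda>k. g k x) \<longlonglongrightarrow> ?G x"
    by (auto simp: measurable_on_def)
  define h where "h k x = max (- K) (min K (g k x))" for k :: nat and x :: real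
  have hc: "continuous_on UNIV (h k)" for k unfolding h_def by (intro continuous_intros g)
  have hK: "\<bar>h k x\<bar> \<le> K" for k x using K0 by (auto simp: h_def)
  show ?thesis
  proof (rule balance_dominated[where G=h and H="\<lambda>_. K"])
    show "balance (h k)" for k by (rule balance_continuous[OF hc hK])
    show "h k \<in> borel_measurable Unif" for k
      by (rule borel_measurable_integrable[OF integrable_Unif_bounded[OF hc hK]])
    have "AE x in lebesgue. x \<notin> N"
      using N by (intro AE_not_in) (simp add: negligible_iff_null_sets)
    then have "AE x in lborel. x \<notin> N" by (simp add: AE_completion_iff)
    then have "AE x in Unif. x \<notin> N" unfolding AE_Unif by eventually_elim simp
    then show "AE m in Unif. (\<lambda>k. h k m) \<longlonglongrightarrow> G m"
      using AE_space
    proof eventually_elim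
      case (elim m)
      have "(\<lambda>k. h k m) \<longlonglongrightarrow> max (- K) (min K (?G m))"
        unfolding h_def by (intro tendsto_intros lim elim)
      moreover have "max (- K) (min K (?G m)) = G m" using K[of m] elim by auto
      ultimately show ?case by simp
    qed
  qed (use G hK in auto)
qed

text \<open>Truncation at height \<open>k\<close>, dominated by \<bar>G\<bar> itself.\<close>

lemma balance_L2:
  assumes G: "G \<in> borel_measurable Unif" and G2: "integrable Unif (\<lambda>m. (G m)\<^sup>2)"
  shows "balance G"
proof (rule balance_dominated[where G="\<lambda>k m. max (- real k) (min (real k) (G m))" and H="\<lambda>m. \<bar>G m\<bar>"])
  note [measurable] = G
  show "(\<lambda>m. max (- real k) (min (real k) (G m))) \<in> borel_measurable Unif" for k by measurable
  then show "balance (\<lambda>m. max (- real k) (min (real k) (G m)))" for k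
    by (rule balance_bounded[where K="real k"]) auto
  show "AE m in Unif. (\<lambda>k. max (- real k) (min (real k) (G m))) \<longlonglongrightarrow> G m"
  proof (rule AE_I2)
    fix m
    obtain k0 :: nat where k0: "\<bar>G m\<bar> \<le> real k0" using real_arch_simple by blast
    have "eventually (\<lambda>k. max (- real k) (min (real k) (G m)) = G m) sequentially"
      using eventually_ge_at_top[of k0] by eventually_elim (use k0 in auto)
    then show "(\<lambda>k. max (- real k) (min (real k) (G m))) \<longlonglongrightarrow> G m" by (rule tendsto_eventually)
  qed
qed (use G G2 in auto)

end

section \<open>From entropy inequalities to the weak formulation\<close>

context cdf_fun
begin

lemma gen_inv_mono_on: "mono_on {0<..<1} (gen_inv F)"
proof (rule mono_onI)
  fix m m' :: real assume m: "m \<in> {0<..<1}" "m' \<in> {0<..<1}" "m \<le> m'"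
  have "{x. F x > m'} \<noteq> {}"
    using order_tendstoD(1)[OF top, of m'] m by (auto dest!: eventually_happens'[OF trivial_limit_at_top_linorder])
  moreover have "bdd_below {x. F x > m}"
  proof -
    obtain y where y: "F y < m"
      using order_tendstoD(2)[OF bot, of m] m by (auto dest!: eventually_happens'[OF trivial_limit_at_bot_linorder])
    show ?thesis
    proof (rule bdd_belowI[of _ y])
      fix x assume "x \<in> {x. F x > m}"
      then show "y \<le> x" using y F_mono[of x y] by (cases "y \<le> x") auto
    qed
  qed
  ultimately show "gen_inv F m \<le> gen_inv F m'"
    unfolding gen_inv_def using m(3) by (intro cInf_superset_mono) auto
qed

lemma quant_le_gen_inv:
  assumes "0 < m" "m < 1" shows "quant F m \<le> gen_inv F m"
proof -
  have "{x. F x > m} \<noteq> {}"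
    using order_tendstoD(1)[OF top, of m] assms by (auto dest!: eventually_happens'[OF trivial_limit_at_top_linorder])
  then show ?thesis unfolding gen_inv_def
    by (rule cInf_greatest) (use quant_le_iff[OF assms] in auto)
qed

lemma gen_inv_le_quant:
  assumes "0 < m" "m < m'" "m' < 1" shows "gen_inv F m \<le> quant F m'"
proof -
  have "m < F (quant F m')" using le_F_quant[of m'] assms by simp
  moreover have "bdd_below {x. F x > m}"
  proof -
    obtain y where y: "F y < m"
      using order_tendstoD(2)[OF bot, of m] assms by (auto dest!: eventually_happens'[OF trivial_limit_at_bot_linorder])
    show ?thesis
    proof (rule bdd_belowI[of _ y])
      fix x assume "x \<in> {x. F x > m}"
      then show "y \<le> x" using y F_mono[of x y] by (cases "y \<le> x") auto
    qed
  qed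
  ultimately show ?thesis unfolding gen_inv_def by (intro cInf_lower) auto
qed

lemma quant_mono_on: "mono_on {0<..<1} (quant F)"
proof (rule mono_onI)
  fix m m' :: real assume "m \<in> {0<..<1}" "m' \<in> {0<..<1}" "m \<le> m'"
  then show "quant F m \<le> quant F m'" using le_F_quant[of m'] by (subst quant_le_iff) auto
qed

text \<open>\<open>gen_inv F m\<close> lies between \<open>quant F m\<close> and
  \<open>quant F m'\<close> for every \<open>m' > m\<close>. At a continuity point of the monotone
  function \<open>quant F\<close> the bounds meet, and all but countably many points are of this
  kind.\<close>

lemma AE_gen_inv_eq_quant: "AE m in Unif. gen_inv F m = quant F m"
proof -
  let ?N = "{a \<in> {0<..<1}. \<not> continuous (at a within {0<..<1}) (quant F)}"
  have "AE m in lborel. m \<notin> ?N"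
    by (intro AE_not_in countable_imp_null_set_lborel mono_on_ctble_discont quant_mono_on)
  then show ?thesis unfolding AE_Unif
  proof eventually_elim
    case (elim m)
    show ?case
    proof
      assume m: "0 < m \<and> m < 1"
      then have "isCont (quant F) m"
        using elim by (auto simp: at_within_open[of m "{0<..<1}"])
      then have lim: "(quant F \<longlongrightarrow> quant F m) (at_right m)"
        by (simp add: isCont_def filterlim_at_split)
      have "eventually (\<lambda>m'. gen_inv F m \<le> quant F m') (at_right m)"
        using eventually_at_right_real[of m 1] m by (auto elim!: eventually_mono intro: gen_inv_le_quant)
      then have "gen_inv F m \<le> quant F m"
        using lim by (intro tendsto_lowerbound[OF lim]) auto
      then show "gen_inv F m = quant F m" using quant_le_gen_inv[of m] m by auto
    qed
  qed
qed

lemma gen_inv_measurable: "gen_inv F \<in> borel_measurable Unif"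
  using borel_measurable_mono_on_fnc[OF gen_inv_mono_on] unfolding measurable_cong_sets[OF sets_Unif refl] .

lemma avg_measurable:
  assumes G: "G \<in> borel_measurable Unif" "integrable Unif G"
  shows "avg G \<in> borel_measurable borel"
proof -
  have g: "(\<lambda>m. indicator {0<..<1} m * G m) \<in> borel_measurable borel"
    using G(1) by (simp add: measurable_Unif set_borel_measurable_def)
  note [measurable] = measurable_compose[OF F_measurable g] measurable_compose[OF F_measurable prim_measurable[OF G(2)]]
    measurable_compose[OF left_lim_measurable prim_measurable[OF G(2)]]
  \<comment> \<open>\<open>G\<close> is measurable on the open unit interval only; the levels
    \<open>F x = 0\<close> and \<open>F x = 1\<close>, where \<open>avg G\<close> takes the constant
    values \<open>G 0\<close> and \<open>G 1\<close> off the jumps, are therefore split off.\<close>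
  have "(\<lambda>x. if x \<in> jumps then (prim G (F x) - prim G (left_lim F x)) / (F x - left_lim F x)
      else if F x = 0 then G 0 else if F x = 1 then G 1 else indicator {0<..<1} (F x) * G (F x)) \<in> borel_measurable borel"
    by measurable
  also have "(\<lambda>x. if x \<in> jumps then (prim G (F x) - prim G (left_lim F x)) / (F x - left_lim F x)
      else if F x = 0 then G 0 else if F x = 1 then G 1 else indicator {0<..<1} (F x) * G (F x)) = avg G"
    using F_nonneg F_le_1 left_lim_nonneg order_trans[OF left_lim_le F_le_1]
    by (auto simp: fun_eq_iff avg_on avg_def U_prime_def jumps_def indicator_def less_le)
  finally show ?thesis .
qed

end

section \<open>Smooth test functions of product form\<close>

inductive smooth_gen :: "(real \<times> real \<Rightarrow> real) \<Rightarrow> bool" where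
  smooth_const: "smooth_gen (\<lambda>z. c)"
| smooth_hfun: "smooth_gen (\<lambda>z. hfun k (a * fst z + b * snd z + c))"
| smooth_step: "smooth_gen (\<lambda>z. step (a * fst z + b * snd z + c))"
| smooth_add: "smooth_gen f \<Longrightarrow> smooth_gen g \<Longrightarrow> smooth_gen (\<lambda>z. f z + g z)"
| smooth_mult: "smooth_gen f \<Longrightarrow> smooth_gen g \<Longrightarrow> smooth_gen (\<lambda>z. f z * g z)"

lemma smooth_bump: "smooth_gen (\<lambda>z. bump (a * fst z + b * snd z + c))"
proof -
  have "smooth_gen (\<lambda>z. hfun 0 (a * fst z + b * snd z + (c + 1)) * hfun 0 ((- a) * fst z + (- b) * snd z + (1 - c))
      * (1 / (\<integral>u. bump0 u \<partial>lborel)))"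
    by (intro smooth_gen.intros)
  also have "(\<lambda>z. hfun 0 (a * fst z + b * snd z + (c + 1)) * hfun 0 ((- a) * fst z + (- b) * snd z + (1 - c))
      * (1 / (\<integral>u. bump0 u \<partial>lborel))) = (\<lambda>z. bump (a * fst z + b * snd z + c))"
    by (simp add: fun_eq_iff bump_def bump0_def algebra_simps)
  finally show ?thesis .
qed

text \<open>The class is closed under partial derivatives: \<open>hfun\<close> differentiates into
  \<open>hfun\<close> with larger index, and \<open>step\<close> into \<open>bump\<close>, which is
  a product of two \<open>hfun\<close> up to a constant. Iterating this gives
  \<open>smooth2\<close>.\<close>

lemma smooth_gen_derivative:
  assumes "smooth_gen f"
  shows "\<exists>f1 f2. smooth_gen f1 \<and> smooth_gen f2 \<and> (\<forall>z. (f has_derivative (\<lambda>w. fst w * f1 z + snd w * f2 z)) (at z))"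
  using assms
proof induction
  case (smooth_const c)
  have "((\<lambda>z. c) has_derivative (\<lambda>w. fst w * 0 + snd w * 0)) (at z)" for z :: "real \<times> real" by simp
  then show ?case using smooth_gen.smooth_const[of 0] by blast
next
  case (smooth_hfun k a b c)
  let ?d = "\<lambda>z. hfun (Suc (Suc k)) (a * fst z + b * snd z + c) + (- real k) * hfun (Suc k) (a * fst z + b * snd z + c)"
  have "smooth_gen (\<lambda>z. a * ?d z)" "smooth_gen (\<lambda>z. b * ?d z)" by (intro smooth_gen.intros)+
  moreover have "((\<lambda>z. hfun k (a * fst z + b * snd z + c)) has_derivative (\<lambda>w. fst w * (a * ?d z) + snd w * (b * ?d z))) (at z)" for z
  proof -
    have "((\<lambda>z. a * fst z + b * snd z + c) has_derivative (\<lambda>w. a * fst w + b * snd w)) (at z)"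
      by (auto intro!: derivative_eq_intros)
    from DERIV_compose_FDERIV[OF hfun_has_derivative this, of k]
    show ?thesis by (rule has_derivative_eq_rhs) (auto simp: fun_eq_iff algebra_simps)
  qed
  ultimately show ?case by blast
next
  case (smooth_step a b c)
  let ?d = "\<lambda>z. bump (a * fst z + b * snd z + c)"
  have "smooth_gen (\<lambda>z. a * ?d z)" "smooth_gen (\<lambda>z. b * ?d z)" by (intro smooth_gen.smooth_mult smooth_gen.smooth_const smooth_bump)+
  moreover have "((\<lambda>z. step (a * fst z + b * snd z + c)) has_derivative (\<lambda>w. fst w * (a * ?d z) + snd w * (b * ?d z))) (at z)" for z
  proof -
    have "((\<lambda>z. a * fst z + b * snd z + c) has_derivative (\<lambda>w. a * fst w + b * snd w)) (at z)"
      by (auto intro!: derivative_eq_intros)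
    from DERIV_compose_FDERIV[OF step_has_derivative this]
    show ?thesis by (rule has_derivative_eq_rhs) (auto simp: fun_eq_iff algebra_simps)
  qed
  ultimately show ?case by blast
next
  case (smooth_add f g)
  then obtain f1 f2 g1 g2 where s: "smooth_gen f1" "smooth_gen f2" "smooth_gen g1" "smooth_gen g2"
    and d: "\<And>z. (f has_derivative (\<lambda>w. fst w * f1 z + snd w * f2 z)) (at z)"
      "\<And>z. (g has_derivative (\<lambda>w. fst w * g1 z + snd w * g2 z)) (at z)" by blast
  have "((\<lambda>z. f z + g z) has_derivative (\<lambda>w. fst w * (f1 z + g1 z) + snd w * (f2 z + g2 z))) (at z)" for z
    by (rule has_derivative_eq_rhs[OF has_derivative_add[OF d]]) (simp add: algebra_simps)
  moreover have "smooth_gen (\<lambda>z. f1 z + g1 z)" "smooth_gen (\<lambda>z. f2 z + g2 z)"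
    using s by (auto intro: smooth_gen.smooth_add)
  ultimately show ?case by blast
next
  case (smooth_mult f g)
  then obtain f1 f2 g1 g2 where s: "smooth_gen f1" "smooth_gen f2" "smooth_gen g1" "smooth_gen g2"
    and d: "\<And>z. (f has_derivative (\<lambda>w. fst w * f1 z + snd w * f2 z)) (at z)"
      "\<And>z. (g has_derivative (\<lambda>w. fst w * g1 z + snd w * g2 z)) (at z)" by blast
  have "((\<lambda>z. f z * g z) has_derivative (\<lambda>w. fst w * (f z * g1 z + f1 z * g z) + snd w * (f z * g2 z + f2 z * g z))) (at z)" for z
    by (rule has_derivative_eq_rhs[OF has_derivative_mult[OF d]]) (simp add: algebra_simps)
  moreover have "smooth_gen (\<lambda>z. f z * g1 z + f1 z * g z)" "smooth_gen (\<lambda>z. f z * g2 z + f2 z * g z)"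
    using s smooth_mult.hyps by (auto intro!: smooth_gen.smooth_add smooth_gen.smooth_mult)
  ultimately show ?case by blast
qed

lemma smooth_gen_imp_smooth2:
  assumes "smooth_gen f" shows "smooth2 f"
  unfolding smooth2_def
proof
  fix n show "higher_diff n f"
    using assms
  proof (induction n arbitrary: f)
    case 0
    then obtain f1 f2 where "\<And>z. (f has_derivative (\<lambda>w. fst w * f1 z + snd w * f2 z)) (at z)"
      using smooth_gen_derivative by blast
    then have "f differentiable_on UNIV" by (auto simp: differentiable_on_def differentiable_def)
    then show ?case by (simp add: differentiable_imp_continuous_on)
  next
    case (Suc n)
    then obtain f1 f2 where s: "smooth_gen f1" "smooth_gen f2"
      and d: "\<And>z. (f has_derivative (\<lambda>w. fst w * f1 z + snd w * f2 z)) (at z)"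
      using smooth_gen_derivative by blast
    have "f differentiable_on UNIV" using d by (auto simp: differentiable_on_def differentiable_def)
    moreover have "higher_diff n (\<lambda>z. frechet_derivative f (at z) w)" for w
    proof -
      have "frechet_derivative f (at z) = (\<lambda>w. fst w * f1 z + snd w * f2 z)" for z
        by (rule frechet_derivative_at[OF d, symmetric])
      then have "(\<lambda>z. frechet_derivative f (at z) w) = (\<lambda>z. fst w * f1 z + snd w * f2 z)" by simp
      moreover have "smooth_gen (\<lambda>z. fst w * f1 z + snd w * f2 z)" using s by (intro smooth_gen.intros)
      ultimately show ?thesis using Suc.IH by simp
    qed
    ultimately show ?case by simp
  qed
qed

lemma dt_dx_prod:
  assumes "(\<alpha> has_real_derivative \<alpha>') (at (fst z))" "(\<beta> has_real_derivative \<beta>') (at (snd z))"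
  shows "dt (\<lambda>z. \<alpha> (fst z) * \<beta> (snd z)) z = \<alpha>' * \<beta> (snd z)" "dx (\<lambda>z. \<alpha> (fst z) * \<beta> (snd z)) z = \<alpha> (fst z) * \<beta>'"
proof -
  have a: "((\<lambda>z. \<alpha> (fst z)) has_derivative (\<lambda>w. fst w * \<alpha>')) (at z)"
    by (rule DERIV_compose_FDERIV[where f=\<alpha> and g=fst, OF assms(1)]) (auto intro!: derivative_eq_intros)
  have b: "((\<lambda>z. \<beta> (snd z)) has_derivative (\<lambda>w. snd w * \<beta>')) (at z)"
    by (rule DERIV_compose_FDERIV[where f=\<beta> and g=snd, OF assms(2)]) (auto intro!: derivative_eq_intros)
  note d = frechet_derivative_at[OF has_derivative_mult[OF a b], symmetric]
  show "dt (\<lambda>z. \<alpha> (fst z) * \<beta> (snd z)) z = \<alpha>' * \<beta> (snd z)" unfolding dt_def d by simp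
  show "dx (\<lambda>z. \<alpha> (fst z) * \<beta> (snd z)) z = \<alpha> (fst z) * \<beta>'" unfolding dx_def d by simp
qed

definition bump_test :: "real \<Rightarrow> real \<Rightarrow> real \<Rightarrow> real \<Rightarrow> real \<Rightarrow> real \<times> real \<Rightarrow> real" where
  "bump_test s r d x e z = (step ((fst z - s) / d) - step ((fst z - r) / d)) * (bump ((x - snd z) / e) / e)"

text \<open>By \<open>d < s\<close> and \<open>r + d < T\<close> the time support
  \<open>[s - d, r + d]\<close> lies inside \<open>(0,T)\<close>. Hence the function vanishes at
  time 0 and the initial datum drops out of the entropy inequality.\<close>

lemma bump_test:
  assumes sr: "0 < s" "s < r" "r < T" and d: "0 < d" "d < s" "r + d < T" and e: "0 < e"
  shows "test_fun_half T (bump_test s r d x e)" "0 \<le> bump_test s r d x e z" "bump_test s r d x e (0, y) = 0"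
    and "dt (bump_test s r d x e) z = (bump ((fst z - s) / d) / d - bump ((fst z - r) / d) / d) * (bump ((x - snd z) / e) / e)"
    and "dx (bump_test s r d x e) z = (step ((fst z - s) / d) - step ((fst z - r) / d)) * (- bumpd ((x - snd z) / e) / e\<^sup>2)"
proof -
  have "smooth_gen (\<lambda>z. (step ((1 / d) * fst z + 0 * snd z + (- s / d)) + (-1) * step ((1 / d) * fst z + 0 * snd z + (- r / d)))
      * (bump (0 * fst z + (- 1 / e) * snd z + x / e) * (1 / e)))"
    by (intro smooth_gen.intros smooth_bump)
  also have "(\<lambda>z. (step ((1 / d) * fst z + 0 * snd z + (- s / d)) + (-1) * step ((1 / d) * fst z + 0 * snd z + (- r / d)))
      * (bump (0 * fst z + (- 1 / e) * snd z + x / e) * (1 / e))) = bump_test s r d x e"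
    by (simp add: fun_eq_iff bump_test_def diff_divide_distrib)
  finally have "smooth2 (bump_test s r d x e)" by (rule smooth_gen_imp_smooth2)
  moreover have "\<exists>K. compact K \<and> K \<subseteq> {..<T} \<times> UNIV \<and> (\<forall>z. z \<notin> K \<longrightarrow> bump_test s r d x e z = 0)"
  proof (intro exI[of _ "{s - d..r + d} \<times> {x - e..x + e}"] conjI allI impI)
    show "compact ({s - d..r + d} \<times> {x - e..x + e})" by (intro compact_Times compact_Icc)
    show "{s - d..r + d} \<times> {x - e..x + e} \<subseteq> {..<T} \<times> UNIV" using d by auto
    fix z assume z: "z \<notin> {s - d..r + d} \<times> {x - e..x + e}"
    consider "fst z < s - d" | "fst z > r + d" | "snd z < x - e" | "snd z > x + e"
      using z by (cases z) (auto simp: not_le)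
    then show "bump_test s r d x e z = 0"
    proof cases
      case 1
      then have "(fst z - s) / d \<le> -1" "(fst z - r) / d \<le> -1" using d sr by (auto simp: divide_le_eq)
      then show ?thesis by (simp add: bump_test_def step_le)
    next
      case 2
      then have "(fst z - s) / d \<ge> 1" "(fst z - r) / d \<ge> 1" using d sr by (auto simp: le_divide_eq)
      then show ?thesis by (simp add: bump_test_def step_ge)
    next
      case 3
      then have "(x - snd z) / e \<ge> 1" using e by (auto simp: le_divide_eq)
      then have "bump ((x - snd z) / e) = 0" by (intro bump_eq_0) linarith
      then show ?thesis by (simp add: bump_test_def)
    next
      case 4
      then have "(x - snd z) / e \<le> -1" using e by (auto simp: divide_le_eq)
      then have "bump ((x - snd z) / e) = 0" by (intro bump_eq_0) linarith
      then show ?thesis by (simp add: bump_test_def)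
    qed
  qed
  ultimately show "test_fun_half T (bump_test s r d x e)" by (simp add: test_fun_half_def)
  have "step ((fst z - r) / d) \<le> step ((fst z - s) / d)"
    using sr d by (intro step_mono divide_right_mono) auto
  then show "0 \<le> bump_test s r d x e z" using e bump_nonneg by (simp add: bump_test_def)
  have "(0 - s) / d \<le> -1" "(0 - r) / d \<le> -1" using d sr by (auto simp: divide_le_eq)
  then show "bump_test s r d x e (0, y) = 0" by (simp add: bump_test_def step_le)
  have a: "((\<lambda>t. step ((t - s) / d) - step ((t - r) / d)) has_real_derivative
      (bump ((fst z - s) / d) / d - bump ((fst z - r) / d) / d)) (at (fst z))"
    using d(1) by (auto intro!: derivative_eq_intros DERIV_chain2[OF step_has_derivative])
  have b: "((\<lambda>y. bump ((x - y) / e) / e) has_real_derivative - bumpd ((x - snd z) / e) / e\<^sup>2) (at (snd z))"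
    using e by (auto intro!: derivative_eq_intros DERIV_chain2[OF bump_has_derivative] simp: power2_eq_square)
  show "dt (bump_test s r d x e) z = (bump ((fst z - s) / d) / d - bump ((fst z - r) / d) / d) * (bump ((x - snd z) / e) / e)"
    "dx (bump_test s r d x e) z = (step ((fst z - s) / d) - step ((fst z - r) / d)) * (- bumpd ((x - snd z) / e) / e\<^sup>2)"
    unfolding bump_test_def[abs_def] by (rule dt_dx_prod[OF a b])+
qed

lemma integral_bumpd: "(\<integral>u. bumpd u \<partial>lborel) = 0"
proof -
  have "(\<integral>u. bumpd u \<partial>lborel) = (\<integral>u. indicator {-1..1} u * bumpd u \<partial>lborel)"
  proof (intro Bochner_Integration.integral_cong refl)
    show "bumpd u = indicator {-1..1} u * bumpd u" for u
      using bumpd_eq_0[of u] by (cases "\<bar>u\<bar> \<ge> 1") (auto simp: indicator_def)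
  qed
  also have "\<dots> = bump 1 - bump (-1)"
    by (rule integral_Icc_eq_diff[OF bump_has_derivative continuous_bumpd]) simp
  finally show ?thesis by (simp add: bump_eq_0)
qed

context claw0
begin

text \<open>For a constant \<open>k\<close> above 1 the entropy integrand is \<open>E k - I\<close>,
  and for one below 0 it is \<open>I - E k\<close>, where \<open>I\<close> is the weak integrand and
  \<open>E k\<close> the contribution of the constant state. As \<open>E k\<close> integrates to
  zero, the integral of \<open>I\<close> is bounded by zero from both sides.\<close>

lemma entropy_imp_weak:
  fixes U :: "real \<Rightarrow> real \<Rightarrow> real" and Fc :: "nat \<Rightarrow> real \<Rightarrow> real"
  assumes ent: "entropy_solution T U M0 M"
    and U: "\<And>t m. U t m = (\<Sum>i\<le>n. B i t * Fc i m)"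
    and Fc: "\<And>i m. i \<le> n \<Longrightarrow> 0 \<le> m \<Longrightarrow> m \<le> 1 \<Longrightarrow> Fc i m = prim (F i) m"
    and sr: "0 < s" "s < r" "r < T" and d: "0 < d" "d < s" "r + d < T" and e: "0 < e"
  shows "(LINT z:{0<..<T} \<times> UNIV|lborel. M (fst z) (snd z)
          * ((bump ((fst z - s) / d) / d - bump ((fst z - r) / d) / d) * (bump ((x - snd z) / e) / e))
        + (\<Sum>i\<le>n. B i (fst z) * prim (F i) (M (fst z) (snd z)))
          * ((step ((fst z - s) / d) - step ((fst z - r) / d)) * (- bumpd ((x - snd z) / e) / e\<^sup>2))) = 0"
proof -
  interpret P: pair_sigma_finite "Iv 0 T" "lborel :: real measure" by (rule pair_Iv_lborel)
  let ?\<mu> = "Iv 0 T \<Otimes>\<^sub>M (lborel :: real measure)"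
  have strip: "(LINT z:{0<..<T} \<times> UNIV|lborel. f z) = (\<integral>z. f z \<partial>?\<mu>)" for f :: "real \<times> real \<Rightarrow> real"
    unfolding Iv_pair_lborel set_lebesgue_integral_def
    by (subst integral_restrict_space) (auto simp: open_Times)
  let ?\<phi> = "bump_test s r d x e"
  let ?k = "\<lambda>y. bump ((x - y) / e) / e"
  let ?\<zeta> = "\<lambda>y. - bumpd ((x - y) / e) / e\<^sup>2"
  let ?a = "\<lambda>t. bump ((t - s) / d) / d - bump ((t - r) / d) / d"
  let ?b = "\<lambda>t. step ((t - s) / d) - step ((t - r) / d)"
  note \<phi> = bump_test[OF sr d e, of x]
  define I where "I z = M (fst z) (snd z) * (?a (fst z) * ?k (snd z))
    + Uf (fst z) (M (fst z) (snd z)) * (?b (fst z) * ?\<zeta> (snd z))" for z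
  have int: "integrable ?\<mu> I"
    unfolding I_def[abs_def] by (intro Bochner_Integration.integrable_add weak_integrable d e)
  define E where "E k z = k * (?a (fst z) * ?k (snd z)) + U (fst z) k * (?b (fst z) * ?\<zeta> (snd z))" for k z
  \<comment> \<open>Constant states solve the equation: \<open>?a\<close> is the derivative of the
    time cutoff and integrates to zero over \<open>(0,T)\<close>, and \<open>?\<zeta>\<close> is the
    derivative of the kernel and integrates to zero over the line.\<close>
  have E: "integrable ?\<mu> (E k) \<and> (\<integral>z. E k z \<partial>?\<mu>) = 0" for k
  proof -
    have ac: "continuous_on A ?a" and bc: "continuous_on A ?b" for A
      using d(1) by (intro continuous_intros continuous_on_compose2[OF continuous_bump[of UNIV]]
          continuous_on_compose2[OF continuous_step[of UNIV]]; auto)+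
    have Uc: "continuous_on {0..T} (\<lambda>t. U t k * ?b t)"
      unfolding U by (intro continuous_intros B bc) auto
    have ci: "integrable (Iv 0 T) f" if "continuous_on {0..T} f" for f :: "real \<Rightarrow> real"
      unfolding integrable_Iv by (rule set_integrable_subset[OF borel_integrable_atLeastAtMost'[OF that]]) auto
    have i1: "integrable ?\<mu> (\<lambda>z. (k * ?a (fst z)) * ?k (snd z))"
      by (rule P.integrable_fst_mult_snd[OF ci integrable_kernel[OF e]]) (intro continuous_intros ac)
    have i2: "integrable ?\<mu> (\<lambda>z. (U (fst z) k * ?b (fst z)) * ?\<zeta> (snd z))"
      by (rule P.integrable_fst_mult_snd[OF ci[OF Uc] integrable_kernel_deriv[OF e]])
    have "(\<integral>t. ?a t \<partial>Iv 0 T) = 0"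
    proof -
      have "(\<integral>t. ?a t \<partial>Iv 0 T) = (\<integral>t. indicator {0..T} t * ?a t \<partial>lborel)"
        by (rule integral_Iv_Icc[OF ac])
      also have "\<dots> = ?b T - ?b 0"
      proof (rule integral_Icc_eq_diff)
        show "(?b has_real_derivative ?a t) (at t)" for t
          using d(1) by (auto intro!: derivative_eq_intros DERIV_chain2[OF step_has_derivative])
      qed (use ac T in auto)
      also have "\<dots> = 0"
      proof -
        have "(T - s) / d \<ge> 1" "(T - r) / d \<ge> 1" "(0 - s) / d \<le> -1" "(0 - r) / d \<le> -1"
          using d sr by (auto simp: le_divide_eq divide_le_eq)
        then show ?thesis by (simp add: step_ge step_le)
      qed
      finally show ?thesis .
    qed
    then have z1: "(\<integral>z. (k * ?a (fst z)) * ?k (snd z) \<partial>?\<mu>) = 0"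
      using P.integral_fst'[OF i1] by simp
    have "(\<integral>y. ?\<zeta> y \<partial>lborel) = 0"
    proof -
      have "(\<integral>y. 1 * (bumpd ((x - y) / e) / e) \<partial>lborel) = 0"
        by (subst affine_kernel(1)[OF e]) (simp add: integral_bumpd)
      then show ?thesis using e by (simp add: power2_eq_square)
    qed
    then have z2: "(\<integral>z. (U (fst z) k * ?b (fst z)) * ?\<zeta> (snd z) \<partial>?\<mu>) = 0"
      using P.integral_fst'[OF i2, symmetric]
      by (simp only: fst_conv snd_conv integral_mult_right_zero mult_zero_right Bochner_Integration.integral_zero)
    have eq: "E k = (\<lambda>z. (k * ?a (fst z)) * ?k (snd z) + (U (fst z) k * ?b (fst z)) * ?\<zeta> (snd z))"
      unfolding E_def by (simp only: mult.assoc)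
    show ?thesis unfolding eq using i1 i2 z1 z2 by (simp only: Bochner_Integration.integral_add Bochner_Integration.integrable_add simp_thms add_0)
  qed
  obtain D where D: "closure D = UNIV"
    and ineq: "\<And>k \<phi>. k \<in> D \<Longrightarrow> test_fun_half T \<phi> \<Longrightarrow> (\<And>z. fst z \<ge> 0 \<Longrightarrow> \<phi> z \<ge> 0) \<Longrightarrow>
           (LINT z:{0<..<T} \<times> UNIV|lborel.
               \<bar>M (fst z) (snd z) - k\<bar> * dt \<phi> z
             + sgn (M (fst z) (snd z) - k) * (U (fst z) (M (fst z) (snd z)) - U (fst z) k) * dx \<phi> z)
           + (LINT x|lborel. \<bar>M0 x - k\<bar> * \<phi> (0, x)) \<ge> 0"
    using ent unfolding entropy_solution_def by blast
  have M01: "0 \<le> M t y" "M t y \<le> 1" if "t \<in> {0<..<T}" for t y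
    using cdf_fun.F_nonneg[OF cdf_fun_M, of t y] cdf_fun.F_le_1[OF cdf_fun_M, of t y] that by auto
  have UM: "U t (M t y) = Uf t (M t y)" if "t \<in> {0<..<T}" for t y
    unfolding U Uf_def using Fc M01[OF that] by (intro sum.cong) auto
  have ineq': "(\<integral>z. \<bar>M (fst z) (snd z) - k\<bar> * (?a (fst z) * ?k (snd z))
      + sgn (M (fst z) (snd z) - k) * (U (fst z) (M (fst z) (snd z)) - U (fst z) k) * (?b (fst z) * ?\<zeta> (snd z)) \<partial>?\<mu>) \<ge> 0"
    if k: "k \<in> D" for k
    using ineq[OF k \<phi>(1) \<phi>(2)] unfolding strip \<phi>(3,4,5) by simp
  have alg1: "(k - m) * a + (- 1) * (u - c) * b = (k * a + c * b) - (m * a + u * b)"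
    and alg2: "(m - k) * a + 1 * (u - c) * b = (m * a + u * b) - (k * a + c * b)" for k m a u c b :: real
    by (simp_all add: algebra_simps)
  have sp: "fst z \<in> {0<..<T}" if "z \<in> space ?\<mu>" for z using that by (auto simp: space_pair_measure)
  \<comment> \<open>The inequalities are available for \<open>k\<close> in a dense set, which meets
    the open half-lines above 1 and below 0.\<close>
  have dense: "\<exists>k\<in>D. k \<in> S" if "open S" "S \<noteq> {}" for S
    using open_Int_closure_eq_empty[OF that(1), of D] D that(2) by auto
  obtain k1 where k1: "k1 \<in> D" "k1 > 1" using dense[of "{1<..}"] by auto
  obtain k2 where k2: "k2 \<in> D" "k2 < 0" using dense[of "{..<0}"] by auto
  have "(\<integral>z. \<bar>M (fst z) (snd z) - k1\<bar> * (?a (fst z) * ?k (snd z))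
      + sgn (M (fst z) (snd z) - k1) * (U (fst z) (M (fst z) (snd z)) - U (fst z) k1) * (?b (fst z) * ?\<zeta> (snd z)) \<partial>?\<mu>)
      = (\<integral>z. E k1 z - I z \<partial>?\<mu>)"
  proof (intro Bochner_Integration.integral_cong refl)
    fix z assume "z \<in> space ?\<mu>"
    note z = sp[OF this]
    have "M (fst z) (snd z) < k1" using M01(2)[OF z, of "snd z"] k1 by simp
    then have "\<bar>M (fst z) (snd z) - k1\<bar> = k1 - M (fst z) (snd z)" "sgn (M (fst z) (snd z) - k1) = -1" by auto
    then show "\<bar>M (fst z) (snd z) - k1\<bar> * (?a (fst z) * ?k (snd z))
      + sgn (M (fst z) (snd z) - k1) * (U (fst z) (M (fst z) (snd z)) - U (fst z) k1) * (?b (fst z) * ?\<zeta> (snd z)) = E k1 z - I z"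
      unfolding E_def I_def UM[OF z] by (simp only: alg1)
  qed
  then have "(\<integral>z. I z \<partial>?\<mu>) \<le> 0" using ineq'[OF k1(1)] E[of k1] int by simp
  moreover have "(\<integral>z. \<bar>M (fst z) (snd z) - k2\<bar> * (?a (fst z) * ?k (snd z))
      + sgn (M (fst z) (snd z) - k2) * (U (fst z) (M (fst z) (snd z)) - U (fst z) k2) * (?b (fst z) * ?\<zeta> (snd z)) \<partial>?\<mu>)
      = (\<integral>z. I z - E k2 z \<partial>?\<mu>)"
  proof (intro Bochner_Integration.integral_cong refl)
    fix z assume "z \<in> space ?\<mu>"
    note z = sp[OF this]
    have "M (fst z) (snd z) > k2" using M01(1)[OF z, of "snd z"] k2 by simp
    then have "\<bar>M (fst z) (snd z) - k2\<bar> = M (fst z) (snd z) - k2" "sgn (M (fst z) (snd z) - k2) = 1" by auto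
    then show "\<bar>M (fst z) (snd z) - k2\<bar> * (?a (fst z) * ?k (snd z))
      + sgn (M (fst z) (snd z) - k2) * (U (fst z) (M (fst z) (snd z)) - U (fst z) k2) * (?b (fst z) * ?\<zeta> (snd z)) = I z - E k2 z"
      unfolding E_def I_def UM[OF z] by (simp only: alg2)
  qed
  then have "(\<integral>z. I z \<partial>?\<mu>) \<ge> 0" using ineq'[OF k2(1)] E[of k2] int by simp
  ultimately show ?thesis unfolding strip I_def[symmetric] Uf_def[symmetric] by simp
qed

end

section \<open>Continuity and momentum equations\<close>

lemma smooth2_dt_dx:
  assumes "smooth2 f" shows "smooth2 (dt f)" "smooth2 (dx f)"
proof -
  have "higher_diff (Suc k) f" for k using assms by (auto simp only: smooth2_def)
  then show "smooth2 (dt f)" "smooth2 (dx f)"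
    unfolding smooth2_def dt_def[abs_def] dx_def[abs_def] by auto
qed

lemma smooth2_has_derivative:
  assumes "smooth2 f" shows "(f has_derivative frechet_derivative f (at z)) (at z)"
proof -
  have "higher_diff (Suc 0) f" using assms by (auto simp only: smooth2_def)
  then have "f differentiable (at z)" by (cases z) (simp add: differentiable_on_def)
  then show ?thesis by (simp add: frechet_derivative_works)
qed

lemma smooth2_continuous: "smooth2 f \<Longrightarrow> continuous_on UNIV f"
  using smooth2_has_derivative by (auto intro!: continuous_at_imp_continuous_on has_derivative_continuous)

lemma smooth2_partial:
  assumes "smooth2 f"
  shows "((\<lambda>t. f (t, x)) has_real_derivative dt f (t, x)) (at t)"
    and "((\<lambda>x. f (t, x)) has_real_derivative dx f (t, x)) (at x)"
proof -
  note d = smooth2_has_derivative[OF assms, of "(t, x)"]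
  have lin: "linear (frechet_derivative f (at (t, x)))" by (rule has_derivative_linear[OF d])
  have "((\<lambda>t. (t, x)) has_derivative (\<lambda>h. (h, 0))) (at t)" by (auto intro!: derivative_eq_intros)
  from has_derivative_compose[OF this d]
  have "((\<lambda>t. f (t, x)) has_derivative (\<lambda>h. frechet_derivative f (at (t, x)) (h, 0))) (at t)" .
  moreover have "(\<lambda>h. frechet_derivative f (at (t, x)) (h, 0)) = (*) (dt f (t, x))"
  proof (rule ext)
    fix h
    have "frechet_derivative f (at (t, x)) (h *\<^sub>R (1, 0)) = h *\<^sub>R frechet_derivative f (at (t, x)) (1, 0)"
      by (rule linear_scale[OF lin])
    then show "frechet_derivative f (at (t, x)) (h, 0) = dt f (t, x) * h" by (simp add: dt_def)
  qed
  ultimately show "((\<lambda>t. f (t, x)) has_real_derivative dt f (t, x)) (at t)"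
    by (simp add: has_field_derivative_def)
  have "((\<lambda>x. (t, x)) has_derivative (\<lambda>h. (0, h))) (at x)" by (auto intro!: derivative_eq_intros)
  from has_derivative_compose[OF this d]
  have "((\<lambda>x. f (t, x)) has_derivative (\<lambda>h. frechet_derivative f (at (t, x)) (0, h))) (at x)" .
  moreover have "(\<lambda>h. frechet_derivative f (at (t, x)) (0, h)) = (*) (dx f (t, x))"
  proof (rule ext)
    fix h
    have "frechet_derivative f (at (t, x)) (h *\<^sub>R (0, 1)) = h *\<^sub>R frechet_derivative f (at (t, x)) (0, 1)"
      by (rule linear_scale[OF lin])
    then show "frechet_derivative f (at (t, x)) (0, h) = dx f (t, x) * h" by (simp add: dx_def)
  qed
  ultimately show "((\<lambda>x. f (t, x)) has_real_derivative dx f (t, x)) (at x)"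
    by (simp add: has_field_derivative_def)
qed

lemma derivative_outside_support:
  fixes f :: "real \<times> real \<Rightarrow> real"
  assumes "closed K" "\<And>z. z \<notin> K \<Longrightarrow> f z = 0" "z \<notin> K"
  shows "dt f z = 0" "dx f z = 0"
proof -
  have "((\<lambda>z. 0) has_derivative (\<lambda>w. 0)) (at z)" by simp
  then have "(f has_derivative (\<lambda>w. 0)) (at z)"
    by (rule has_derivative_transform_within_open[of _ _ _ _ "- K"]) (use assms in \<open>auto simp: open_Compl\<close>)
  from frechet_derivative_at[OF this, symmetric] show "dt f z = 0" "dx f z = 0"
    by (simp_all add: dt_def dx_def)
qed

text \<open>The derivatives vanish on the open complement of the support and are continuous on the
  compact support. \<open>dt (dx \<phi>)\<close> is listed because \<open>dx \<phi>\<close> takes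
  the part of \<psi>, whose time derivative has to be controlled.\<close>

lemma test_fun_open_bounds:
  assumes "test_fun_open T \<phi>"
  obtains R L where "R \<ge> 0"
    "\<And>t x. t \<notin> {0<..<T} \<or> \<bar>x\<bar> > R \<Longrightarrow> \<phi> (t, x) = 0 \<and> dx \<phi> (t, x) = 0 \<and> dt \<phi> (t, x) = 0 \<and> dt (dx \<phi>) (t, x) = 0"
    "\<And>z. \<bar>dx \<phi> z\<bar> \<le> L \<and> \<bar>dt \<phi> z\<bar> \<le> L \<and> \<bar>dt (dx \<phi>) z\<bar> \<le> L"
proof -
  obtain K where sm: "smooth2 \<phi>" and K: "compact K" "K \<subseteq> {0<..<T} \<times> UNIV" "\<And>z. z \<notin> K \<Longrightarrow> \<phi> z = 0"
    using assms unfolding test_fun_open_def by blast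
  have cl: "closed K" using K(1) by (rule compact_imp_closed)
  note d1 = derivative_outside_support[where f=\<phi>, OF cl K(3)]
  note d2 = derivative_outside_support(1)[where f="dx \<phi>", OF cl d1(2)]
  have "bounded (snd ` K)" by (intro compact_imp_bounded compact_continuous_image K continuous_intros)
  then obtain R where R: "\<And>z. z \<in> K \<Longrightarrow> \<bar>snd z\<bar> \<le> R" by (auto simp: bounded_iff)
  have bd: "\<exists>c. \<forall>z. \<bar>f z\<bar> \<le> c" if f: "smooth2 f" "\<And>z. z \<notin> K \<Longrightarrow> f z = 0" for f
  proof -
    have "bounded (f ` K)"
      using smooth2_continuous[OF f(1)] by (intro compact_imp_bounded compact_continuous_image K) (rule continuous_on_subset, auto)
    then obtain c where c: "\<And>z. z \<in> K \<Longrightarrow> \<bar>f z\<bar> \<le> c" by (auto simp: bounded_iff)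
    have "\<bar>f z\<bar> \<le> \<bar>c\<bar>" for z using c[of z] f(2)[of z] by (cases "z \<in> K") auto
    then show ?thesis by blast
  qed
  obtain c1 c2 c3 where c: "\<And>z. \<bar>dx \<phi> z\<bar> \<le> c1" "\<And>z. \<bar>dt \<phi> z\<bar> \<le> c2" "\<And>z. \<bar>dt (dx \<phi>) z\<bar> \<le> c3"
    using bd[OF smooth2_dt_dx(2)[OF sm] d1(2)] bd[OF smooth2_dt_dx(1)[OF sm] d1(1)]
      bd[OF smooth2_dt_dx(1)[OF smooth2_dt_dx(2)[OF sm]] d2] by blast
  show ?thesis
  proof (rule that[of "max R 0" "max c1 (max c2 c3)"])
    fix t x assume tx: "t \<notin> {0<..<T} \<or> \<bar>x\<bar> > max R 0"
    then have "(t, x) \<notin> K" using K(2) R[of "(t, x)"] by auto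
    then show "\<phi> (t, x) = 0 \<and> dx \<phi> (t, x) = 0 \<and> dt \<phi> (t, x) = 0 \<and> dt (dx \<phi>) (t, x) = 0"
      using K(3) d1 d2 by blast
  next
    show "\<bar>dx \<phi> z\<bar> \<le> max c1 (max c2 c3) \<and> \<bar>dt \<phi> z\<bar> \<le> max c1 (max c2 c3) \<and> \<bar>dt (dx \<phi>) z\<bar> \<le> max c1 (max c2 c3)" for z
      using c[of z] by (auto simp: le_max_iff_disj)
  qed simp
qed

text \<open>Differentiating \<open>\<phi>(t, x) = - \<integral>\<^sub>x\<^sup>\<infinity> \<partial>\<^sub>x\<phi>(t, y) dy\<close> under the integral sign
  avoids any appeal to the symmetry of mixed partial derivatives.\<close>

lemma dt_eq_tail_integral:
  assumes sm: "smooth2 \<phi>"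
    and supp: "\<And>t x. \<bar>x\<bar> > R \<Longrightarrow> \<phi> (t, x) = 0 \<and> dt (dx \<phi>) (t, x) = 0"
  shows "dt \<phi> (t, x) = - (\<integral>y. indicator {x..} y * dt (dx \<phi>) (t, y) \<partial>lborel)"
proof -
  define S where "S = max x \<bar>R\<bar> + 1"
  have S: "x \<le> S" "\<bar>S\<bar> > R" "\<And>y. y > S \<Longrightarrow> \<bar>y\<bar> > R" by (auto simp: S_def)
  have sx: "smooth2 (dx \<phi>)" and sxt: "smooth2 (dt (dx \<phi>))" using sm by (auto intro: smooth2_dt_dx)
  have cx: "continuous_on A (\<lambda>y. f (t, y))" if "smooth2 f" for f t A
    using smooth2_continuous[OF that] by (rule continuous_on_compose2) (auto intro!: continuous_intros)
  have eq: "\<phi> (t, x) = - integral (cbox x S) (\<lambda>y. dx \<phi> (t, y))" for t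
  proof -
    have "((\<lambda>y. dx \<phi> (t, y)) has_integral \<phi> (t, S) - \<phi> (t, x)) {x..S}"
      by (rule fundamental_theorem_of_calculus[OF S(1)])
        (use smooth2_partial(2)[OF sm] in \<open>auto simp: has_real_derivative_iff_has_vector_derivative intro: has_vector_derivative_at_within\<close>)
    then show ?thesis using supp[OF S(2), of t] by (simp add: integral_unique)
  qed
  have "((\<lambda>t. integral (cbox x S) (\<lambda>y. dx \<phi> (t, y))) has_field_derivative integral (cbox x S) (\<lambda>y. dt (dx \<phi>) (t, y))) (at t within UNIV)"
  proof (rule leibniz_rule_field_derivative)
    show "((\<lambda>t. dx \<phi> (t, y)) has_real_derivative dt (dx \<phi>) (t, y)) (at t within UNIV)" for t y
      using smooth2_partial(1)[OF sx] by simp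
    show "(\<lambda>y. dx \<phi> (t, y)) integrable_on cbox x S" for t by (rule integrable_continuous[OF cx[OF sx]])
    show "continuous_on (UNIV \<times> cbox x S) (\<lambda>(t, y). dt (dx \<phi>) (t, y))"
      using smooth2_continuous[OF sxt] by (auto simp: case_prod_unfold intro: continuous_on_subset)
  qed auto
  from DERIV_minus[OF this]
  have "((\<lambda>t. \<phi> (t, x)) has_real_derivative - integral (cbox x S) (\<lambda>y. dt (dx \<phi>) (t, y))) (at t)"
    unfolding eq by simp
  then have "dt \<phi> (t, x) = - integral (cbox x S) (\<lambda>y. dt (dx \<phi>) (t, y))"
    using smooth2_partial(1)[OF sm] by (intro DERIV_unique)
  also have "integral (cbox x S) (\<lambda>y. dt (dx \<phi>) (t, y)) = (LINT y:{x..S}|lborel. dt (dx \<phi>) (t, y))"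
    using set_borel_integral_eq_integral(2)[OF borel_integrable_atLeastAtMost'[OF cx[OF sxt]], of x S t] by simp
  also have "\<dots> = (\<integral>y. indicator {x..} y * dt (dx \<phi>) (t, y) \<partial>lborel)"
    unfolding set_lebesgue_integral_def
  proof (intro Bochner_Integration.integral_cong refl)
    show "indicator {x..S} y *\<^sub>R dt (dx \<phi>) (t, y) = indicator {x..} y * dt (dx \<phi>) (t, y)" for y
      using supp[OF S(3), of y t] by (cases "y > S") (auto simp: indicator_def)
  qed
  finally show ?thesis .
qed

section \<open>Primitives in time and integration by parts\<close>

lemma AE_Iv_neq: "AE t in Iv s r. t \<noteq> a"
  unfolding Iv_def by (subst AE_restrict_space_iff) (use AE_lborel_singleton[of a] in \<open>auto elim!: eventually_mono\<close>)

lemma ind_measurable_Iv: "A \<in> sets borel \<Longrightarrow> (\<lambda>t. indicator A t :: real) \<in> borel_measurable (Iv s r)"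
  by (rule measurable_compose[OF measurable_ident_Iv]) simp

lemma integrable_Iv_ind:
  fixes f :: "real \<Rightarrow> real"
  assumes "integrable (Iv s r) f" "A \<in> sets borel" shows "integrable (Iv s r) (\<lambda>t. indicator A t * f t)"
proof (rule Bochner_Integration.integrable_bound[OF assms(1)])
  show "(\<lambda>t. indicator A t * f t) \<in> borel_measurable (Iv s r)"
    by (rule borel_measurable_times[OF ind_measurable_Iv[OF assms(2)] borel_measurable_integrable[OF assms(1)]])
qed (auto intro!: AE_I2 simp: indicator_def)

lemma continuous_primitive_Iv:
  fixes f :: "real \<Rightarrow> real"
  shows "integrable (Iv s r) f \<Longrightarrow> continuous_on UNIV (\<lambda>t. \<integral>u. indicator {..t} u * f u \<partial>Iv s r)"
  by (rule continuous_primitive[OF _ AE_Iv_neq ind_measurable_Iv]) auto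

lemma primitive_Iv_bound:
  fixes f :: "real \<Rightarrow> real"
  assumes "integrable (Iv s r) f" shows "\<bar>\<integral>u. indicator {..t} u * f u \<partial>Iv s r\<bar> \<le> (\<integral>u. \<bar>f u\<bar> \<partial>Iv s r)"
proof -
  have "\<bar>\<integral>u. indicator {..t} u * f u \<partial>Iv s r\<bar> \<le> (\<integral>u. \<bar>indicator {..t} u * f u\<bar> \<partial>Iv s r)"
    using integral_norm_bound[of "Iv s r" "\<lambda>u. indicator {..t} u * f u"] by simp
  also have "\<dots> \<le> (\<integral>u. \<bar>f u\<bar> \<partial>Iv s r)"
    using assms by (intro integral_mono integrable_abs integrable_Iv_ind) (auto simp: indicator_def)
  finally show ?thesis .
qed

lemma integrable_primitive_times:
  fixes f g :: "real \<Rightarrow> real"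
  assumes f: "integrable (Iv s r) f" and g: "integrable (Iv s r) g"
  shows "integrable (Iv s r) (\<lambda>t. (\<integral>u. indicator {..t} u * f u \<partial>Iv s r) * g t)"
proof -
  let ?P = "\<lambda>t. \<integral>u. indicator {..t} u * f u \<partial>Iv s r"
  have m: "?P \<in> borel_measurable (Iv s r)"
    by (rule borel_measurable_Iv_continuous[OF continuous_primitive_Iv[OF f]]) auto
  show ?thesis
  proof (rule Bochner_Integration.integrable_bound)
    show "integrable (Iv s r) (\<lambda>t. (\<integral>u. \<bar>f u\<bar> \<partial>Iv s r) * \<bar>g t\<bar>)" using g by (intro integrable_mult_right integrable_abs)
    show "(\<lambda>t. ?P t * g t) \<in> borel_measurable (Iv s r)"
      by (rule borel_measurable_times[OF m borel_measurable_integrable[OF g]])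
    show "AE t in Iv s r. norm (?P t * g t) \<le> norm ((\<integral>u. \<bar>f u\<bar> \<partial>Iv s r) * \<bar>g t\<bar>)"
    proof (rule AE_I2)
      fix t
      have "\<bar>?P t\<bar> * \<bar>g t\<bar> \<le> (\<integral>u. \<bar>f u\<bar> \<partial>Iv s r) * \<bar>g t\<bar>"
        by (rule mult_right_mono[OF primitive_Iv_bound[OF f] abs_ge_zero])
      then show "norm (?P t * g t) \<le> norm ((\<integral>u. \<bar>f u\<bar> \<partial>Iv s r) * \<bar>g t\<bar>)"
        unfolding real_norm_def abs_mult[of "?P t"] by (rule order_trans[OF _ abs_ge_self])
    qed
  qed
qed

text \<open>Integration by parts for functions that are merely integrable, as the \<open>b i\<close>
  are: Fubini on the triangle \<open>u \<le> t\<close>. The product of the two total integrals is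
  the boundary term and vanishes by \<open>a0\<close>; the diagonal is negligible.\<close>

lemma integral_by_parts_Iv:
  fixes a b :: "real \<Rightarrow> real"
  assumes a: "integrable (Iv s r) a" and b: "integrable (Iv s r) b" and a0: "(\<integral>t. a t \<partial>Iv s r) = 0"
  shows "(\<integral>t. (\<integral>u. indicator {..t} u * b u \<partial>Iv s r) * a t \<partial>Iv s r)
    + (\<integral>t. (\<integral>u. indicator {..t} u * a u \<partial>Iv s r) * b t \<partial>Iv s r) = 0"
proof -
  interpret P: pair_sigma_finite "Iv s r" "Iv s r"
    by (rule pair_sigma_finite.intro) (auto intro: Iv.sigma_finite_measure_axioms)
  let ?f = "\<lambda>t u. (if u \<le> t then 1 else 0) * a u * b t"
  note [measurable] = borel_measurable_integrable[OF a] borel_measurable_integrable[OF b]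
    measurable_compose[OF measurable_fst measurable_ident_Iv] measurable_compose[OF measurable_snd measurable_ident_Iv]
  have "(\<lambda>z. ?f (fst z) (snd z)) \<in> borel_measurable (Iv s r \<Otimes>\<^sub>M Iv s r)" by measurable
  then have m: "(\<lambda>(t, u). ?f t u) \<in> borel_measurable (Iv s r \<Otimes>\<^sub>M Iv s r)" by (simp add: case_prod_unfold)
  have i: "integrable (Iv s r \<Otimes>\<^sub>M Iv s r) (\<lambda>(t, u). ?f t u)"
    by (rule Bochner_Integration.integrable_bound[OF P.integrable_fst_mult_snd[OF b a] m])
      (auto intro!: AE_I2 simp: abs_mult mult.commute)
  let ?Pb = "\<lambda>t. \<integral>u. indicator {..t} u * b u \<partial>Iv s r"
  have "(\<integral>t. (\<integral>u. indicator {..t} u * a u \<partial>Iv s r) * b t \<partial>Iv s r) = (\<integral>t. (\<integral>u. ?f t u \<partial>Iv s r) \<partial>Iv s r)"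
  proof (intro Bochner_Integration.integral_cong refl)
    fix t
    have "(\<integral>u. ?f t u \<partial>Iv s r) = (\<integral>u. (indicator {..t} u * a u) * b t \<partial>Iv s r)"
      by (intro Bochner_Integration.integral_cong refl) (simp add: indicator_def)
    also have "\<dots> = (\<integral>u. indicator {..t} u * a u \<partial>Iv s r) * b t" by (rule integral_mult_left_zero)
    finally show "(\<integral>u. indicator {..t} u * a u \<partial>Iv s r) * b t = (\<integral>u. ?f t u \<partial>Iv s r)" ..
  qed
  also have "\<dots> = (\<integral>u. (\<integral>t. ?f t u \<partial>Iv s r) \<partial>Iv s r)"
    using P.Fubini_integral[OF i] by simp
  also have "\<dots> = (\<integral>u. (\<integral>t. b t \<partial>Iv s r) * a u - ?Pb u * a u \<partial>Iv s r)"
  proof (intro Bochner_Integration.integral_cong refl)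
    fix u
    have "(\<integral>t. ?f t u \<partial>Iv s r) = (\<integral>t. (b t - indicator {..u} t * b t) * a u \<partial>Iv s r)"
    proof (rule integral_cong_AE)
      note [measurable] = measurable_ident_Iv
      show "(\<lambda>t. ?f t u) \<in> borel_measurable (Iv s r)" by measurable
      show "(\<lambda>t. (b t - indicator {..u} t * b t) * a u) \<in> borel_measurable (Iv s r)"
        by (intro borel_measurable_times borel_measurable_diff ind_measurable_Iv) auto
      show "AE t in Iv s r. ?f t u = (b t - indicator {..u} t * b t) * a u"
        using AE_Iv_neq[of u] by eventually_elim (auto simp: indicator_def)
    qed
    also have "\<dots> = (\<integral>t. b t - indicator {..u} t * b t \<partial>Iv s r) * a u" by (rule integral_mult_left_zero)
    also have "(\<integral>t. b t - indicator {..u} t * b t \<partial>Iv s r) = (\<integral>t. b t \<partial>Iv s r) - ?Pb u"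
      by (rule Bochner_Integration.integral_diff[OF b integrable_Iv_ind[OF b]]) simp
    finally show "(\<integral>t. ?f t u \<partial>Iv s r) = (\<integral>t. b t \<partial>Iv s r) * a u - ?Pb u * a u" by (simp only: left_diff_distrib)
  qed
  also have "\<dots> = (\<integral>u. (\<integral>t. b t \<partial>Iv s r) * a u \<partial>Iv s r) - (\<integral>u. ?Pb u * a u \<partial>Iv s r)"
    by (rule Bochner_Integration.integral_diff[OF integrable_mult_right[OF a] integrable_primitive_times[OF b a]])
  also have "(\<integral>u. (\<integral>t. b t \<partial>Iv s r) * a u \<partial>Iv s r) = 0"
    using a0 by simp
  finally show ?thesis by simp
qed

context claw
begin

lemma Phi_L2: "integrable Unif (\<lambda>m. (Phi t m)\<^sup>2)"
  using Phi_powr(1)[OF _ F2, of t] by simp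

lemma F_L2: "i \<le> n \<Longrightarrow> integrable Unif (\<lambda>m. (F i m)\<^sup>2)"
  using F2 by simp

section \<open>Balance laws tested with one fixed function\<close>

context
  fixes \<phi> R L
  assumes sm: "smooth2 \<phi>" and R0: "R \<ge> 0"
    and supp: "\<And>t x. t \<notin> {0<..<T} \<or> \<bar>x\<bar> > R \<Longrightarrow> \<phi> (t, x) = 0 \<and> dx \<phi> (t, x) = 0 \<and> dt \<phi> (t, x) = 0 \<and> dt (dx \<phi>) (t, x) = 0"
    and bnd: "\<And>z. \<bar>dx \<phi> z\<bar> \<le> L \<and> \<bar>dt \<phi> z\<bar> \<le> L \<and> \<bar>dt (dx \<phi>) z\<bar> \<le> L"
begin

text \<open>Formally the time derivative of the integral of
  \<open>G m * \<phi> (t, quant (M t) m)\<close>, the quantiles moving with velocity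
  \<open>V\<close>.\<close>

definition flux :: "(real \<Rightarrow> real) \<Rightarrow> real \<Rightarrow> real" where
  "flux G t = (\<integral>m. G m * (dt \<phi> (t, quant (M t) m) + V t m * dx \<phi> (t, quant (M t) m)) \<partial>Unif)"

text \<open>By \<open>integral_tail_quant\<close> this is minus the integral of
  \<open>G m * \<phi> (t, quant (M t) m)\<close>. For \<open>G = F i\<close> it is also the form in
  which the force term appears in the theorem.\<close>

definition content :: "(real \<Rightarrow> real) \<Rightarrow> real \<Rightarrow> real" where
  "content G t = (\<integral>x. prim G (M t x) * dx \<phi> (t, x) \<partial>lborel)"

lemma claw_test_phi:
  assumes "0 \<le> s" "s < r" "r \<le> T"
  shows "claw_test T n M B F (\<lambda>t x. dx \<phi> (t, x)) (\<lambda>t x. dt (dx \<phi>) (t, x)) R L s r"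
proof (intro claw_test.intro claw_test_axioms.intro)
  show "claw T n M B F" by (rule claw_axioms)
  show "continuous_on UNIV (\<lambda>z. dx \<phi> (fst z, snd z))" "continuous_on UNIV (\<lambda>z. dt (dx \<phi>) (fst z, snd z))"
    using smooth2_continuous[OF smooth2_dt_dx(2)[OF sm]] smooth2_continuous[OF smooth2_dt_dx(1)[OF smooth2_dt_dx(2)[OF sm]]]
    by simp_all
  show "((\<lambda>t. dx \<phi> (t, x)) has_real_derivative dt (dx \<phi>) (t, x)) (at t)" for t x
    by (rule smooth2_partial(1)[OF smooth2_dt_dx(2)[OF sm]])
qed (use supp bnd assms in auto)

lemma test_measurable:
  assumes "t \<in> {0..T}"
  shows "(\<lambda>m. dt \<phi> (t, quant (M t) m)) \<in> borel_measurable Unif" "(\<lambda>m. dx \<phi> (t, quant (M t) m)) \<in> borel_measurable Unif"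
proof -
  have c: "(\<lambda>x. f (t, x)) \<in> borel_measurable borel" if "smooth2 f" for f
  proof (rule borel_measurable_continuous_onI)
    show "continuous_on UNIV (\<lambda>x. f (t, x))"
      using smooth2_continuous[OF that] by (rule continuous_on_compose2) (auto intro!: continuous_intros)
  qed
  show "(\<lambda>m. dt \<phi> (t, quant (M t) m)) \<in> borel_measurable Unif" "(\<lambda>m. dx \<phi> (t, quant (M t) m)) \<in> borel_measurable Unif"
    by (rule measurable_compose[OF cdf_fun.quant_measurable[OF cdf_fun_M[OF assms]]], rule c, rule smooth2_dt_dx[OF sm])+
qed

lemma test_integrable:
  assumes t: "t \<in> {0..T}" and G: "G \<in> borel_measurable Unif" "integrable Unif (\<lambda>m. (G m)\<^sup>2)"
  shows "integrable Unif (\<lambda>m. G m * dt \<phi> (t, quant (M t) m))"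
    and "integrable Unif (\<lambda>m. G m * (V t m * dx \<phi> (t, quant (M t) m)))"
proof -
  note [measurable] = G(1) V_measurable[OF t] test_measurable[OF t]
  have L0: "0 \<le> L" using order_trans[OF abs_ge_zero] bnd by blast
  have G1: "integrable Unif G" by (rule Unif.square_integrable_imp_integrable[OF G])
  show "integrable Unif (\<lambda>m. G m * dt \<phi> (t, quant (M t) m))"
  proof (rule Bochner_Integration.integrable_bound)
    show "integrable Unif (\<lambda>m. L * \<bar>G m\<bar>)" using G1 by simp
    show "AE m in Unif. norm (G m * dt \<phi> (t, quant (M t) m)) \<le> norm (L * \<bar>G m\<bar>)"
      using bnd L0 by (intro AE_I2) (auto simp: abs_mult mult.commute[of L] intro!: mult_left_mono)
  qed measurable
  show "integrable Unif (\<lambda>m. G m * (V t m * dx \<phi> (t, quant (M t) m)))"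
  proof (rule Bochner_Integration.integrable_bound)
    show "integrable Unif (\<lambda>m. L * \<bar>G m * V t m\<bar>)" using L2_mult_V(1)[OF t G] by simp
    show "AE m in Unif. norm (G m * (V t m * dx \<phi> (t, quant (M t) m))) \<le> norm (L * \<bar>G m * V t m\<bar>)"
    proof (rule AE_I2)
      fix m
      have "\<bar>G m * V t m\<bar> * \<bar>dx \<phi> (t, quant (M t) m)\<bar> \<le> \<bar>G m * V t m\<bar> * L"
        using bnd by (intro mult_left_mono) auto
      then show "norm (G m * (V t m * dx \<phi> (t, quant (M t) m))) \<le> norm (L * \<bar>G m * V t m\<bar>)"
        using L0 by (simp add: abs_mult mult_ac)
    qed
  qed measurable
qed

lemma flux_bounded:
  assumes G: "G \<in> borel_measurable Unif" "integrable Unif (\<lambda>m. (G m)\<^sup>2)"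
  shows "\<exists>D. \<forall>t\<in>{0..T}. \<bar>flux G t\<bar> \<le> D"
proof -
  have L0: "0 \<le> L" using order_trans[OF abs_ge_zero] bnd by blast
  have G1: "integrable Unif G" by (rule Unif.square_integrable_imp_integrable[OF G])
  from V_L2 obtain K where K: "\<forall>t\<in>{0..T}. integrable Unif (\<lambda>m. (V t m)\<^sup>2) \<and> (\<integral>m. (V t m)\<^sup>2 \<partial>Unif) \<le> K"
    by (elim exE)
  have "\<bar>flux G t\<bar> \<le> L * (\<integral>m. \<bar>G m\<bar> \<partial>Unif) + L * ((\<integral>m. (G m)\<^sup>2 \<partial>Unif) + K)" if t: "t \<in> {0..T}" for t
  proof -
    note i = test_integrable[OF t G]
    have "\<bar>flux G t\<bar> \<le> (\<integral>m. \<bar>G m * dt \<phi> (t, quant (M t) m) + G m * (V t m * dx \<phi> (t, quant (M t) m))\<bar> \<partial>Unif)"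
      unfolding flux_def distrib_left
      using integral_norm_bound[of Unif "\<lambda>m. G m * dt \<phi> (t, quant (M t) m) + G m * (V t m * dx \<phi> (t, quant (M t) m))"] by simp
    also have "\<dots> \<le> (\<integral>m. L * \<bar>G m\<bar> + L * \<bar>G m * V t m\<bar> \<partial>Unif)"
    proof (rule integral_mono)
      show "integrable Unif (\<lambda>m. \<bar>G m * dt \<phi> (t, quant (M t) m) + G m * (V t m * dx \<phi> (t, quant (M t) m))\<bar>)"
        by (intro integrable_abs Bochner_Integration.integrable_add i)
      show "integrable Unif (\<lambda>m. L * \<bar>G m\<bar> + L * \<bar>G m * V t m\<bar>)"
        using G1 L2_mult_V(1)[OF t G] by simp
      fix m
      have "\<bar>G m\<bar> * \<bar>dt \<phi> (t, quant (M t) m)\<bar> \<le> \<bar>G m\<bar> * L" "\<bar>G m * V t m\<bar> * \<bar>dx \<phi> (t, quant (M t) m)\<bar> \<le> \<bar>G m * V t m\<bar> * L"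
        using bnd by (intro mult_left_mono; auto)+
      then show "\<bar>G m * dt \<phi> (t, quant (M t) m) + G m * (V t m * dx \<phi> (t, quant (M t) m))\<bar> \<le> L * \<bar>G m\<bar> + L * \<bar>G m * V t m\<bar>"
        using abs_triangle_ineq[of "G m * dt \<phi> (t, quant (M t) m)" "G m * (V t m * dx \<phi> (t, quant (M t) m))"]
        by (simp add: abs_mult mult_ac)
    qed
    also have "\<dots> = L * (\<integral>m. \<bar>G m\<bar> \<partial>Unif) + L * (\<integral>m. \<bar>G m * V t m\<bar> \<partial>Unif)"
      using G1 L2_mult_V(1)[OF t G] by simp
    also have "\<dots> \<le> L * (\<integral>m. \<bar>G m\<bar> \<partial>Unif) + L * ((\<integral>m. (G m)\<^sup>2 \<partial>Unif) + K)"
    proof (intro add_left_mono mult_left_mono L0)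
      have "(\<integral>m. (V t m)\<^sup>2 \<partial>Unif) \<le> K" using K t by simp
      then show "(\<integral>m. \<bar>G m * V t m\<bar> \<partial>Unif) \<le> (\<integral>m. (G m)\<^sup>2 \<partial>Unif) + K"
        using L2_mult_V(2)[OF t G] by linarith
    qed
    finally show ?thesis .
  qed
  then show ?thesis by blast
qed

text \<open>The balance for \<psi> = \<open>dx \<phi>\<close> on \<open>[0, r]\<close>: there
  \<open>mass\<close> is \<open>content\<close>, and \<open>integral_tail_quant\<close> converts
  \<open>drift\<close> into the \<open>dt \<phi>\<close> part of \<open>flux\<close>. Since \<phi>
  is supported inside \<open>(0,T)\<close>, \<open>content\<close> vanishes at both end times,
  whence the zero total.\<close>

lemma content_flux:
  assumes G: "G \<in> borel_measurable Unif" "integrable Unif (\<lambda>m. (G m)\<^sup>2)"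
  shows "integrable (Iv 0 T) (flux G)"
    and "(\<integral>t. flux G t \<partial>Iv 0 T) = 0"
    and "t \<in> {0<..<T} \<Longrightarrow> content G t = - (\<integral>u. indicator {..t} u * flux G u \<partial>Iv 0 T)"
proof -
  have G1: "integrable Unif G" by (rule Unif.square_integrable_imp_integrable[OF G])
  have *: "flux G \<in> borel_measurable (Iv 0 r) \<and> content G r = - (\<integral>t. flux G t \<partial>Iv 0 r)" if r: "0 < r" "r \<le> T" for r
  proof -
    interpret c: claw_test T n M B F "\<lambda>t x. dx \<phi> (t, x)" "\<lambda>t x. dt (dx \<phi>) (t, x)" R L 0 r
      by (rule claw_test_phi) (use r in auto)
    have eq: "flux G t = - (c.drift G t - c.flow G t)" if t: "t \<in> {0..T}" for t
    proof -
      interpret t: cdf_fun "M t" by (rule cdf_fun_M) fact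
      have "integrable lborel (\<lambda>x. dt (dx \<phi>) (t, x))"
        using c.integrable_psi_times(2)[of "\<lambda>_. 1" 1 t] by simp
      from t.integral_tail_quant[OF G1 this dt_eq_tail_integral[OF sm, of R]] supp
      have "(\<integral>m. G m * dt \<phi> (t, quant (M t) m) \<partial>Unif) = - c.drift G t" by (simp add: c.drift_def)
      moreover have "(\<integral>m. G m * (V t m * dx \<phi> (t, quant (M t) m)) \<partial>Unif) = c.flow G t"
        unfolding c.flow_def by (simp only: mult.assoc)
      ultimately show ?thesis unfolding flux_def distrib_left using test_integrable[OF t G] by simp
    qed
    have bal: "c.balance G" by (rule c.balance_L2[OF G])
    have meas: "flux G \<in> borel_measurable (Iv 0 r)"
    proof -
      have "(\<lambda>t. - (c.drift G t - c.flow G t)) \<in> borel_measurable (Iv 0 r)"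
        using bal unfolding c.balance_def by (intro borel_measurable_uminus borel_measurable_diff) auto
      then show ?thesis by (rule measurable_cong[THEN iffD1, rotated]) (use r in \<open>auto simp: eq\<close>)
    qed
    have "content G r = c.mass G r - c.mass G 0"
      using supp[of 0] by (simp add: c.mass_def content_def)
    also have "\<dots> = (\<integral>t. c.drift G t - c.flow G t \<partial>Iv 0 r)" using bal by (simp add: c.balance_def)
    also have "\<dots> = (\<integral>t. - flux G t \<partial>Iv 0 r)"
      by (intro Bochner_Integration.integral_cong refl) (use r in \<open>simp add: eq\<close>)
    finally show ?thesis using meas by simp
  qed
  obtain D where D: "\<forall>t\<in>{0..T}. \<bar>flux G t\<bar> \<le> D" using flux_bounded[OF G] by (elim exE)
  show "integrable (Iv 0 T) (flux G)"
    by (rule Iv.integrable_const_bound[where B=D]) (use D *[of T] T in \<open>auto intro!: AE_I2\<close>)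
  show "(\<integral>t. flux G t \<partial>Iv 0 T) = 0"
    using *[of T] T supp[of T] by (simp add: content_def)
  assume t: "t \<in> {0<..<T}"
  have "(\<integral>u. flux G u \<partial>Iv 0 t) = (\<integral>u. indicator {..<t} u * flux G u \<partial>Iv 0 T)"
    unfolding integral_Iv set_lebesgue_integral_def
    by (intro Bochner_Integration.integral_cong refl) (use t in \<open>auto simp: indicator_def\<close>)
  also have "\<dots> = (\<integral>u. indicator {..t} u * flux G u \<partial>Iv 0 T)"
  proof (rule integral_cong_AE)
    show "AE u in Iv 0 T. indicator {..<t} u * flux G u = indicator {..t} u * flux G u"
      using AE_Iv_neq[of t] by eventually_elim (auto simp: indicator_def)
  qed (use *[of T] T in \<open>auto intro!: borel_measurable_times ind_measurable_Iv\<close>)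
  finally show "content G t = - (\<integral>u. indicator {..t} u * flux G u \<partial>Iv 0 T)" using *[of t] t by simp
qed

lemma continuity_equation:
  defines "g \<equiv> \<lambda>t. \<integral>x. dt \<phi> (t, x) + cdf_fun.avg (M t) (Phi t) x * dx \<phi> (t, x) \<partial>interval_measure (M t)"
  shows "integrable (Iv 0 T) g" "(\<integral>t. g t \<partial>Iv 0 T) = 0"
proof -
  have eq: "g t = flux (\<lambda>_. 1) t" if "t \<in> {0<..<T}" for t
  proof -
    have t: "t \<in> {0..T}" using that by auto
    interpret t: cdf_fun "M t" by (rule cdf_fun_M) fact
    have "(\<lambda>x. f (t, x)) \<in> borel_measurable borel" if "smooth2 f" for f
    proof (rule borel_measurable_continuous_onI)
      show "continuous_on UNIV (\<lambda>x. f (t, x))"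
        using smooth2_continuous[OF that] by (rule continuous_on_compose2) (auto intro!: continuous_intros)
    qed
    note [measurable] = this[OF smooth2_dt_dx(1)[OF sm]] this[OF smooth2_dt_dx(2)[OF sm]]
      t.avg_measurable[OF borel_measurable_integrable[OF Phi_int[of t]] Phi_int[of t]]
    show ?thesis unfolding g_def flux_def V_eq_avg[OF t] mult_1_left
      by (rule t.integral_quant) measurable
  qed
  have c: "integrable (Iv 0 T) (flux (\<lambda>_. 1))" "(\<integral>t. flux (\<lambda>_. 1) t \<partial>Iv 0 T) = 0"
    by (rule content_flux; simp)+
  show "integrable (Iv 0 T) g"
    by (rule Bochner_Integration.integrable_cong[THEN iffD2, OF refl _ c(1)]) (simp add: eq)
  have "(\<integral>t. g t \<partial>Iv 0 T) = (\<integral>t. flux (\<lambda>_. 1) t \<partial>Iv 0 T)"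
    by (intro Bochner_Integration.integral_cong refl) (simp add: eq)
  then show "(\<integral>t. g t \<partial>Iv 0 T) = 0" using c(2) by simp
qed

text \<open>The integrand is \<open>v\<close> times the function
  \<open>dt \<phi> + v * dx \<phi>\<close> of the position. By the tower property the outer factor
  \<open>v\<close> may be replaced by \<open>Phi t\<close>, which is linear in the
  \<open>F i\<close>; the nonlinearity stays inside the second factor.\<close>

lemma momentum_flux:
  assumes "t \<in> {0<..<T}"
  shows "(\<integral>x. cdf_fun.avg (M t) (Phi t) x * dt \<phi> (t, x) + (cdf_fun.avg (M t) (Phi t) x)\<^sup>2 * dx \<phi> (t, x) \<partial>interval_measure (M t))
    = (\<Sum>i\<le>n. B i t * flux (F i) t)"
proof -
  have t: "t \<in> {0..T}" using assms by auto
  interpret t: cdf_fun "M t" by (rule cdf_fun_M) fact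
  have "(\<lambda>x. f (t, x)) \<in> borel_measurable borel" if "smooth2 f" for f
  proof (rule borel_measurable_continuous_onI)
    show "continuous_on UNIV (\<lambda>x. f (t, x))"
      using smooth2_continuous[OF that] by (rule continuous_on_compose2) (auto intro!: continuous_intros)
  qed
  note [measurable] = this[OF smooth2_dt_dx(1)[OF sm]] this[OF smooth2_dt_dx(2)[OF sm]]
    t.avg_measurable[OF borel_measurable_integrable[OF Phi_int[of t]] Phi_int[of t]]
  have V2: "integrable Unif (\<lambda>m. (V t m)\<^sup>2)" using V_L2 t by (elim exE) simp
  let ?\<xi> = "\<lambda>x. dt \<phi> (t, x) + t.avg (Phi t) x * dx \<phi> (t, x)"
  have i: "integrable Unif (\<lambda>m. G m * ?\<xi> (quant (M t) m))"
    if "G \<in> borel_measurable Unif" "integrable Unif (\<lambda>m. (G m)\<^sup>2)" for G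
    unfolding distrib_left V_eq_avg[OF t, symmetric]
    by (intro Bochner_Integration.integrable_add test_integrable[OF t that])
  have "(\<integral>x. t.avg (Phi t) x * dt \<phi> (t, x) + (t.avg (Phi t) x)\<^sup>2 * dx \<phi> (t, x) \<partial>interval_measure (M t))
      = (\<integral>x. t.avg (Phi t) x * ?\<xi> x \<partial>interval_measure (M t))"
    by (simp add: algebra_simps power2_eq_square)
  also have "\<dots> = (\<integral>m. t.avg (Phi t) (quant (M t) m) * ?\<xi> (quant (M t) m) \<partial>Unif)"
    by (rule t.integral_quant) measurable
  also have "\<dots> = (\<integral>m. Phi t m * ?\<xi> (quant (M t) m) \<partial>Unif)"
  proof (rule t.integral_avg[OF Phi_int])
    show "integrable Unif (\<lambda>m. Phi t m * ?\<xi> (quant (M t) m))"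
      by (rule i[OF borel_measurable_integrable[OF Phi_int] Phi_L2])
    have "V t = (\<lambda>m. t.avg (Phi t) (quant (M t) m))" by (rule ext) (rule V_eq_avg[OF t])
    then show "integrable Unif (\<lambda>m. t.avg (Phi t) (quant (M t) m) * ?\<xi> (quant (M t) m))"
      using i[OF V_measurable[OF t] V2] by simp
  qed
  also have "\<dots> = (\<integral>m. (\<Sum>i\<le>n. B i t * (F i m * ?\<xi> (quant (M t) m))) \<partial>Unif)"
    unfolding Phi_def[of t] by (simp only: sum_distrib_right mult.assoc)
  also have "\<dots> = (\<Sum>i\<le>n. \<integral>m. B i t * (F i m * ?\<xi> (quant (M t) m)) \<partial>Unif)"
    using i[OF F F_L2] by (intro Bochner_Integration.integral_sum integrable_mult_right) auto
  also have "\<dots> = (\<Sum>i\<le>n. B i t * flux (F i) t)"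
    unfolding flux_def V_eq_avg[OF t] by (simp only: integral_mult_right_zero)
  finally show ?thesis .
qed

text \<open>The \<open>i\<close>-th term is \<open>B i * flux (F i) - b i * content (F i)\<close>,
  where \<open>B i\<close> is the primitive of \<open>b i\<close> and \<open>content (F i)\<close>
  is minus the primitive of \<open>flux (F i)\<close>; integration by parts makes its integral
  vanish. For \<open>i = 0\<close> the factor is 1 and \<open>flux (F 0)\<close> itself integrates
  to zero.\<close>

lemma momentum_equation:
  assumes b: "\<And>i. i \<in> {1..n} \<Longrightarrow> integrable (Iv 0 T) (b i)"
    and B0: "\<And>t. t \<in> {0<..<T} \<Longrightarrow> B 0 t = 1"
    and Bb: "\<And>i t. i \<in> {1..n} \<Longrightarrow> t \<in> {0<..<T} \<Longrightarrow> B i t = (\<integral>u. indicator {..t} u * b i u \<partial>Iv 0 T)"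
  defines "g \<equiv> \<lambda>t. (\<integral>x. cdf_fun.avg (M t) (Phi t) x * dt \<phi> (t, x) + (cdf_fun.avg (M t) (Phi t) x)\<^sup>2 * dx \<phi> (t, x) \<partial>interval_measure (M t))
      - (\<Sum>i\<in>{1..n}. b i t * content (F i) t)"
  shows "integrable (Iv 0 T) g" "(\<integral>t. g t \<partial>Iv 0 T) = 0"
proof -
  let ?Pb = "\<lambda>i t. \<integral>u. indicator {..t} u * b i u \<partial>Iv 0 T"
  let ?Pf = "\<lambda>i t. \<integral>u. indicator {..t} u * flux (F i) u \<partial>Iv 0 T"
  have f: "integrable (Iv 0 T) (flux (F i))" "(\<integral>t. flux (F i) t \<partial>Iv 0 T) = 0" if "i \<le> n" for i
    by (rule content_flux[OF F F_L2, OF that that])+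
  define h where "h i t = ?Pb i t * flux (F i) t + ?Pf i t * b i t" for i t
  have i1: "integrable (Iv 0 T) (\<lambda>t. ?Pb i t * flux (F i) t)" and i2: "integrable (Iv 0 T) (\<lambda>t. ?Pf i t * b i t)"
    if i: "i \<in> {1..n}" for i
    using integrable_primitive_times[OF b[OF i] f(1)] integrable_primitive_times[OF f(1) b[OF i]] i by auto
  have h: "integrable (Iv 0 T) (h i)" "(\<integral>t. h i t \<partial>Iv 0 T) = 0" if i: "i \<in> {1..n}" for i
  proof -
    show "integrable (Iv 0 T) (h i)" unfolding h_def[abs_def] by (rule Bochner_Integration.integrable_add[OF i1[OF i] i2[OF i]])
    have "(\<integral>t. h i t \<partial>Iv 0 T) = (\<integral>t. ?Pb i t * flux (F i) t \<partial>Iv 0 T) + (\<integral>t. ?Pf i t * b i t \<partial>Iv 0 T)"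
      unfolding h_def by (rule Bochner_Integration.integral_add[OF i1[OF i] i2[OF i]])
    also have "\<dots> = 0" using i by (intro integral_by_parts_Iv b f) auto
    finally show "(\<integral>t. h i t \<partial>Iv 0 T) = 0" .
  qed
  have eq: "g t = flux (F 0) t + (\<Sum>i\<in>{1..n}. h i t)" if t: "t \<in> {0<..<T}" for t
  proof -
    have "(\<Sum>i\<le>n. B i t * flux (F i) t) = B 0 t * flux (F 0) t + (\<Sum>i\<in>{1..n}. B i t * flux (F i) t)"
      by (simp add: atMost_atLeast0 sum.atLeast_Suc_atMost)
    then have "g t = flux (F 0) t + (\<Sum>i\<in>{1..n}. B i t * flux (F i) t - b i t * content (F i) t)"
      unfolding g_def momentum_flux[OF t] using B0[OF t] by (simp add: sum_subtractf)
    also have "(\<Sum>i\<in>{1..n}. B i t * flux (F i) t - b i t * content (F i) t) = (\<Sum>i\<in>{1..n}. h i t)"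
    proof (rule sum.cong[OF refl])
      fix i assume i: "i \<in> {1..n}"
      have "content (F i) t = - ?Pf i t" using i by (intro content_flux(3)[OF F F_L2 t]) auto
      then show "B i t * flux (F i) t - b i t * content (F i) t = h i t"
        by (simp add: h_def Bb[OF i t] mult.commute)
    qed
    finally show ?thesis .
  qed
  have int: "integrable (Iv 0 T) (\<lambda>t. flux (F 0) t + (\<Sum>i\<in>{1..n}. h i t))"
    using f(1)[of 0] h(1) by (intro Bochner_Integration.integrable_add Bochner_Integration.integrable_sum) auto
  show "integrable (Iv 0 T) g"
    by (rule Bochner_Integration.integrable_cong[THEN iffD2, OF refl _ int]) (simp add: eq)
  have "(\<integral>t. g t \<partial>Iv 0 T) = (\<integral>t. flux (F 0) t + (\<Sum>i\<in>{1..n}. h i t) \<partial>Iv 0 T)"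
    by (intro Bochner_Integration.integral_cong refl) (simp add: eq)
  also have "\<dots> = (\<integral>t. flux (F 0) t \<partial>Iv 0 T) + (\<Sum>i\<in>{1..n}. \<integral>t. h i t \<partial>Iv 0 T)"
    using f(1)[of 0] h(1) by (subst Bochner_Integration.integral_add) (auto intro!: Bochner_Integration.integral_sum)
  finally show "(\<integral>t. g t \<partial>Iv 0 T) = 0" using f(2)[of 0] h(2) by simp
qed

end

end

section \<open>Wasserstein estimate and conclusion\<close>

context claw
begin

text \<open>The cutoff \<zeta> keeps \<open>Z\<close> bounded; so are the displacement
  \<open>D\<close> and the dual function \<open>G = sgn D * \<bar>D\<bar> powr (p - 1)\<close>,
  which makes \<open>G\<close> admissible in the balance. As \<zeta> and \<open>G\<close> do not
  depend on time, the balance expresses \<open>Q\<close>, the integral of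
  \<open>\<bar>D\<bar> powr p\<close>, as a time integral of the flow alone.\<close>

lemma truncated_displacement:
  assumes p: "p \<ge> 2" and sr: "0 \<le> s" "s < r" "r \<le> T" and C: "C \<ge> 0"
    and VC: "\<And>t. t \<in> {0<..<T} \<Longrightarrow> integrable Unif (\<lambda>m. \<bar>V t m\<bar> powr p) \<and> (\<integral>m. \<bar>V t m\<bar> powr p \<partial>Unif) \<le> C powr p"
    and zc: "continuous_on UNIV \<zeta>" and z01: "\<And>x. 0 \<le> \<zeta> x" "\<And>x. \<zeta> x \<le> 1" and zs: "\<And>x. \<bar>x\<bar> > R \<Longrightarrow> \<zeta> x = 0"
    and Z: "\<And>x. Z x = - (\<integral>y. indicator {x..} y * \<zeta> y \<partial>lborel)"
  shows "integrable Unif (\<lambda>m. \<bar>Z (quant (M r) m) - Z (quant (M s) m)\<bar> powr p)"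
    and "(\<integral>m. \<bar>Z (quant (M r) m) - Z (quant (M s) m)\<bar> powr p \<partial>Unif) \<le> ((r - s) * C) powr p"
proof -
  have rsT: "r \<in> {0..T}" "s \<in> {0..T}" using sr by auto
  interpret R: cdf_fun "M r" by (rule cdf_fun_M) fact
  interpret S: cdf_fun "M s" by (rule cdf_fun_M) fact
  interpret c: claw_test T n M B F "\<lambda>t x. \<zeta> x" "\<lambda>t x. 0" R 1 s r
  proof (intro claw_test.intro claw_test_axioms.intro)
    show "claw T n M B F" by (rule claw_axioms)
    show "continuous_on UNIV (\<lambda>z. \<zeta> (snd z))"
      by (rule continuous_on_compose2[OF zc]) (auto intro!: continuous_intros)
    show "\<bar>\<zeta> x\<bar> \<le> 1" for x using z01[of x] by simp
  qed (use zs sr in auto)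
  define h where "h = r - s"
  have h: "h > 0" using sr by (simp add: h_def)
  have zi: "integrable lborel \<zeta>" by (rule integrable_continuous_cpt_support[OF zc zs])
  have zm: "\<zeta> \<in> borel_measurable borel" using zi by auto
  define z where "z = (\<integral>y. \<zeta> y \<partial>lborel)"
  have ii: "integrable lborel (\<lambda>y. indicator {x..} y * \<zeta> y)" for x
    by (rule Bochner_Integration.integrable_bound[OF zi]) (use zm in \<open>auto intro!: AE_I2 simp: indicator_def\<close>)
  have Zb: "\<bar>Z x\<bar> \<le> z" for x
  proof -
    have "(\<integral>y. indicator {x..} y * \<zeta> y \<partial>lborel) \<le> z" unfolding z_def
      by (intro integral_mono ii zi) (use z01 in \<open>auto simp: indicator_def\<close>)
    moreover have "0 \<le> (\<integral>y. indicator {x..} y * \<zeta> y \<partial>lborel)"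
      using z01 by (intro Bochner_Integration.integral_nonneg) (auto simp: indicator_def)
    ultimately show ?thesis by (simp add: Z)
  qed
  have z0: "0 \<le> z" using order_trans[OF abs_ge_zero Zb] by blast
  have "mono Z"
  proof (rule monoI)
    fix x y :: real assume "x \<le> y"
    then have "(\<integral>u. indicator {y..} u * \<zeta> u \<partial>lborel) \<le> (\<integral>u. indicator {x..} u * \<zeta> u \<partial>lborel)"
      by (intro integral_mono ii) (use z01 in \<open>auto simp: indicator_def\<close>)
    then show "Z x \<le> Z y" by (simp add: Z)
  qed
  then have Zm: "Z \<in> borel_measurable borel" by (rule borel_measurable_mono)
  define D where "D m = Z (quant (M r) m) - Z (quant (M s) m)" for m
  have Dm: "D \<in> borel_measurable Unif" unfolding D_def[abs_def]
    by (intro borel_measurable_diff measurable_compose[OF R.quant_measurable Zm] measurable_compose[OF S.quant_measurable Zm])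
  have Db: "\<bar>D m\<bar> \<le> 2 * z" for m
    using Zb[of "quant (M r) m"] Zb[of "quant (M s) m"] unfolding D_def by linarith
  have Dpb: "\<bar>D m\<bar> powr a \<le> (2 * z) powr a" if "a \<ge> 0" for m a
    using Db that by (intro powr_mono2) auto
  have Dp: "integrable Unif (\<lambda>m. \<bar>D m\<bar> powr p)"
    by (rule Unif.integrable_const_bound[where B="(2 * z) powr p"]) (use Dm Dpb[of p] p in auto)
  define G where "G m = sgn (D m) * \<bar>D m\<bar> powr (p - 1)" for m
  have Gm: "G \<in> borel_measurable Unif" unfolding G_def[abs_def] using Dm by measurable
  have Gabs: "\<bar>G m\<bar> \<le> \<bar>D m\<bar> powr (p - 1)" for m by (auto simp: G_def abs_mult sgn_if)
  have Gb: "\<bar>G m\<bar> \<le> (2 * z) powr (p - 1)" for m using Gabs[of m] Dpb[of "p - 1" m] p by linarith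
  have G1: "integrable Unif G"
    by (rule Unif.integrable_const_bound[where B="(2 * z) powr (p - 1)"]) (use Gm Gb in auto)
  have G2: "integrable Unif (\<lambda>m. (G m)\<^sup>2)"
    by (rule Unif.integrable_const_bound[where B="((2 * z) powr (p - 1))\<^sup>2"])
      (use Gm power_mono[OF Gb abs_ge_zero, of _ 2] in auto)
  have GD: "G m * D m = \<bar>D m\<bar> powr p" for m
  proof (cases "D m = 0")
    case False
    have "G m * D m = \<bar>D m\<bar> powr (p - 1) * (sgn (D m) * D m)" by (simp add: G_def)
    also have "sgn (D m) * D m = \<bar>D m\<bar> powr 1" by (simp add: sgn_if)
    also have "\<bar>D m\<bar> powr (p - 1) * \<bar>D m\<bar> powr 1 = \<bar>D m\<bar> powr p"
      using powr_add[of "\<bar>D m\<bar>" "p - 1" 1] by simp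
    finally show ?thesis .
  qed simp
  define Q where "Q = (\<integral>m. \<bar>D m\<bar> powr p \<partial>Unif)"
  have GZ: "integrable Unif (\<lambda>m. G m * Z (quant (M t) m))" if "t \<in> {0..T}" for t
  proof (rule Bochner_Integration.integrable_bound)
    interpret t: cdf_fun "M t" by (rule cdf_fun_M) fact
    show "integrable Unif (\<lambda>m. z * G m)" using G1 by simp
    show "(\<lambda>m. G m * Z (quant (M t) m)) \<in> borel_measurable Unif"
      by (intro borel_measurable_times Gm measurable_compose[OF t.quant_measurable Zm])
    show "AE m in Unif. norm (G m * Z (quant (M t) m)) \<le> norm (z * G m)"
      using Zb z0 by (intro AE_I2) (auto simp: abs_mult mult.commute[of z] intro!: mult_left_mono)
  qed
  have "Q = (\<integral>m. G m * Z (quant (M r) m) - G m * Z (quant (M s) m) \<partial>Unif)"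
    unfolding Q_def GD[symmetric] by (simp add: D_def right_diff_distrib)
  also have "\<dots> = (\<integral>m. G m * Z (quant (M r) m) \<partial>Unif) - (\<integral>m. G m * Z (quant (M s) m) \<partial>Unif)"
    by (rule Bochner_Integration.integral_diff[OF GZ[OF rsT(1)] GZ[OF rsT(2)]])
  also have "\<dots> = - (c.mass G r - c.mass G s)"
    unfolding R.integral_tail_quant[OF G1 zi Z] S.integral_tail_quant[OF G1 zi Z] c.mass_def by simp
  also have "\<dots> = (\<integral>t. c.flow G t \<partial>Iv s r)"
    using c.balance_L2[OF Gm G2] by (simp add: c.balance_def c.drift_def)
  finally have Qflow: "Q = (\<integral>t. c.flow G t \<partial>Iv s r)" .
  \<comment> \<open>Young's inequality with the weight \<open>h = r - s\<close> on the velocity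
    bounds \<open>h\<close> times the flow by \<open>W\<close>. Over an interval of length
    \<open>h\<close> this yields \<open>Q \<le> W\<close>, and the share
    \<open>(p - 1) / p * Q\<close> of the right side is absorbed.\<close>
  define W where "W = (p - 1) / p * Q + (h * C) powr p / p"
  have W0: "0 \<le> W" unfolding W_def Q_def using p by (intro add_nonneg_nonneg mult_nonneg_nonneg divide_nonneg_nonneg) auto
  have fl: "c.flow G t \<le> W / h" if t: "t \<in> {s<..<r}" for t
  proof -
    have t': "t \<in> {0..T}" "t \<in> {0<..<T}" using t sr by auto
    note Vm = V_measurable[OF t'(1)]
    have GV: "integrable Unif (\<lambda>m. G m * V t m)" by (rule L2_mult_V(1)[OF t'(1) Gm G2])
    interpret t: cdf_fun "M t" by (rule cdf_fun_M) fact
    note Vp = VC[OF t'(2)]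
    have le: "h * (G m * V t m * \<zeta> (quant (M t) m)) \<le> (p - 1) / p * \<bar>D m\<bar> powr p + h powr p / p * \<bar>V t m\<bar> powr p" for m
    proof -
      have "G m * V t m * \<zeta> (quant (M t) m) \<le> \<bar>G m * V t m * \<zeta> (quant (M t) m)\<bar>"
        by (rule abs_ge_self)
      also have "\<dots> = \<bar>G m\<bar> * \<bar>V t m\<bar> * \<zeta> (quant (M t) m)"
        using z01(1) by (simp add: abs_mult)
      also have "\<dots> \<le> \<bar>G m\<bar> * \<bar>V t m\<bar> * 1"
        by (rule mult_left_mono[OF z01(2)]) simp
      also have "\<dots> \<le> \<bar>D m\<bar> powr (p - 1) * \<bar>V t m\<bar>"
        using Gabs[of m] by (simp add: mult_right_mono)
      finally have "h * (G m * V t m * \<zeta> (quant (M t) m)) \<le> h * (\<bar>D m\<bar> powr (p - 1) * \<bar>V t m\<bar>)"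
        using h by (intro mult_left_mono) auto
      also have "\<dots> = \<bar>D m\<bar> powr (p - 1) * (h * \<bar>V t m\<bar>)" by simp
      also have "\<dots> \<le> (p - 1) / p * \<bar>D m\<bar> powr p + (h * \<bar>V t m\<bar>) powr p / p"
        by (rule young_powr) (use p h in auto)
      also have "(h * \<bar>V t m\<bar>) powr p / p = h powr p / p * \<bar>V t m\<bar> powr p"
        using h by (simp add: powr_mult)
      finally show ?thesis .
    qed
    have "h * c.flow G t = (\<integral>m. h * (G m * V t m * \<zeta> (quant (M t) m)) \<partial>Unif)"
      unfolding c.flow_def by simp
    also have "\<dots> \<le> (\<integral>m. (p - 1) / p * \<bar>D m\<bar> powr p + h powr p / p * \<bar>V t m\<bar> powr p \<partial>Unif)"
    proof (rule integral_mono[OF _ _ le])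
      show "integrable Unif (\<lambda>m. h * (G m * V t m * \<zeta> (quant (M t) m)))"
      proof (intro integrable_mult_right Bochner_Integration.integrable_bound[OF GV])
        show "(\<lambda>m. G m * V t m * \<zeta> (quant (M t) m)) \<in> borel_measurable Unif"
          by (intro borel_measurable_times Gm Vm measurable_compose[OF t.quant_measurable zm])
        show "AE m in Unif. norm (G m * V t m * \<zeta> (quant (M t) m)) \<le> norm (G m * V t m)"
          using z01 by (intro AE_I2) (auto simp: abs_mult intro!: mult_left_le)
      qed
      show "integrable Unif (\<lambda>m. (p - 1) / p * \<bar>D m\<bar> powr p + h powr p / p * \<bar>V t m\<bar> powr p)"
        using Dp Vp by (intro Bochner_Integration.integrable_add integrable_mult_right) auto
    qed
    also have "\<dots> = (p - 1) / p * Q + h powr p / p * (\<integral>m. \<bar>V t m\<bar> powr p \<partial>Unif)"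
      unfolding Q_def using Dp Vp by simp
    also have "\<dots> \<le> (p - 1) / p * Q + h powr p / p * C powr p"
      using Vp p by (intro add_left_mono mult_left_mono) auto
    also have "\<dots> = W" using h C by (simp add: W_def powr_mult)
    finally show ?thesis using h by (simp add: le_divide_eq mult.commute)
  qed
  have "Q \<le> W"
  proof (cases "integrable (Iv s r) (c.flow G)")
    case True
    have "Q \<le> (\<integral>t. W / h \<partial>Iv s r)"
      unfolding Qflow by (intro integral_mono True) (auto intro: fl)
    also have "\<dots> = W"
      using integral_Iv_Icc[of s r "\<lambda>_. W / h"] sr h by (simp add: h_def)
    finally show ?thesis .
  next
    \<comment> \<open>\<open>balance\<close> asserts measurability but not integrability of the
      flow. If integrability fails, the Bochner integral is 0 by convention; then
      \<open>Q = 0\<close>, and \<open>W\<close> is nonnegative.\<close>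
    case False
    then show ?thesis using W0 Qflow by (simp add: not_integrable_integral_eq)
  qed
  then have "p * Q \<le> p * W" using p by (intro mult_left_mono) auto
  also have "\<dots> = (p - 1) * Q + (h * C) powr p" using p by (simp add: W_def distrib_left)
  finally have "Q \<le> (h * C) powr p" by (simp add: left_diff_distrib)
  then show "(\<integral>m. \<bar>Z (quant (M r) m) - Z (quant (M s) m)\<bar> powr p \<partial>Unif) \<le> ((r - s) * C) powr p"
    by (simp add: Q_def D_def h_def)
  show "integrable Unif (\<lambda>m. \<bar>Z (quant (M r) m) - Z (quant (M s) m)\<bar> powr p)"
    using Dp by (simp add: D_def)
qed

text \<open>The cutoff \<open>\<zeta> k\<close> equals 1 on \<open>[-k, k]\<close>, where
  \<open>Z k\<close> is a translation, so at each \<open>m\<close> the truncated displacement is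
  eventually the true one. The truncated bounds do not depend on \<open>k\<close>, and Fatou's lemma
  passes them on.\<close>

lemma displacement:
  assumes p: "p \<ge> 2" and sr: "0 \<le> s" "s \<le> r" "r \<le> T" and C: "C \<ge> 0"
    and VC: "\<And>t. t \<in> {0<..<T} \<Longrightarrow> integrable Unif (\<lambda>m. \<bar>V t m\<bar> powr p) \<and> (\<integral>m. \<bar>V t m\<bar> powr p \<partial>Unif) \<le> C powr p"
  shows "(\<integral>\<^sup>+m. ennreal (\<bar>quant (M r) m - quant (M s) m\<bar> powr p) \<partial>Unif) \<le> ennreal (((r - s) * C) powr p)"
proof (cases "s = r")
  case True
  then show ?thesis by simp
next
  case False
  then have sr': "s < r" using sr by simp
  have rsT: "r \<in> {0..T}" "s \<in> {0..T}" using sr by auto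
  interpret R: cdf_fun "M r" by (rule cdf_fun_M) fact
  interpret S: cdf_fun "M s" by (rule cdf_fun_M) fact
  define \<zeta> where "\<zeta> k x = max 0 (min 1 (real k + 1 - \<bar>x\<bar>))" for k x
  define Z where "Z k x = - (\<integral>y. indicator {x..} y * \<zeta> k y \<partial>lborel)" for k x
  define u where "u k m = ennreal (\<bar>Z k (quant (M r) m) - Z k (quant (M s) m)\<bar> powr p)" for k m
  have zc: "continuous_on UNIV (\<zeta> k)" for k unfolding \<zeta>_def by (intro continuous_intros)
  have z01: "0 \<le> \<zeta> k x" "\<zeta> k x \<le> 1" for k x by (auto simp: \<zeta>_def)
  have zs: "\<zeta> k x = 0" if "\<bar>x\<bar> > real k + 1" for k x using that by (auto simp: \<zeta>_def)
  have zi: "integrable lborel (\<zeta> k)" for k by (rule integrable_continuous_cpt_support[OF zc zs])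
  note T = truncated_displacement[OF p sr(1) sr' sr(3) C VC zc z01 zs Z_def]
  have um: "u k \<in> borel_measurable Unif" for k
  proof -
    have "mono (Z k)"
    proof (rule monoI)
      fix x y :: real assume "x \<le> y"
      have ii: "integrable lborel (\<lambda>y. indicator {x..} y * \<zeta> k y)" for x
        by (rule Bochner_Integration.integrable_bound[OF zi[of k]])
          (use borel_measurable_integrable[OF zi[of k]] in \<open>auto intro!: AE_I2 simp: indicator_def\<close>)
      from \<open>x \<le> y\<close> have "(\<integral>u. indicator {y..} u * \<zeta> k u \<partial>lborel) \<le> (\<integral>u. indicator {x..} u * \<zeta> k u \<partial>lborel)"
        by (intro integral_mono ii) (use z01 in \<open>auto simp: indicator_def\<close>)
      then show "Z k x \<le> Z k y" by (simp add: Z_def)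
    qed
    then have "Z k \<in> borel_measurable borel" by (rule borel_measurable_mono)
    note [measurable] = measurable_compose[OF R.quant_measurable this] measurable_compose[OF S.quant_measurable this]
    show ?thesis unfolding u_def[abs_def] by measurable
  qed
  have Zx: "Z k x = x - (real k + (\<integral>y. indicator {real k<..} y * \<zeta> k y \<partial>lborel))" if "\<bar>x\<bar> \<le> real k" for k x
  proof -
    have ii: "integrable lborel (\<lambda>y. indicator {real k<..} y * \<zeta> k y)"
      by (rule Bochner_Integration.integrable_bound[OF zi[of k]])
        (use borel_measurable_integrable[OF zi[of k]] in \<open>auto intro!: AE_I2 simp: indicator_def\<close>)
    have "indicator {x..} y * \<zeta> k y = indicator {x..real k} y + indicator {real k<..} y * \<zeta> k y" for y
      using that by (auto simp: indicator_def \<zeta>_def)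
    then have "(\<integral>y. indicator {x..} y * \<zeta> k y \<partial>lborel)
        = (\<integral>y. indicator {x..real k} y + indicator {real k<..} y * \<zeta> k y \<partial>lborel)" by simp
    also have "\<dots> = (\<integral>y. indicator {x..real k} y \<partial>lborel) + (\<integral>y. indicator {real k<..} y * \<zeta> k y \<partial>lborel)"
      by (rule Bochner_Integration.integral_add[OF integrable_ind_Icc ii])
    also have "(\<integral>y. indicator {x..real k} y \<partial>lborel) = real k - x" using that by simp
    finally show ?thesis by (simp add: Z_def)
  qed
  have lim: "(\<lambda>k. u k m) \<longlonglongrightarrow> ennreal (\<bar>quant (M r) m - quant (M s) m\<bar> powr p)" for m
  proof (rule tendsto_eventually)
    obtain k0 :: nat where k0: "max \<bar>quant (M r) m\<bar> \<bar>quant (M s) m\<bar> \<le> real k0" using real_arch_simple by blast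
    show "eventually (\<lambda>k. u k m = ennreal (\<bar>quant (M r) m - quant (M s) m\<bar> powr p)) sequentially"
      using eventually_ge_at_top[of k0]
    proof eventually_elim
      case (elim k)
      then have "real k0 \<le> real k" by simp
      then have "\<bar>quant (M r) m\<bar> \<le> real k" "\<bar>quant (M s) m\<bar> \<le> real k" using k0 by linarith+
      then show ?case unfolding u_def by (simp add: Zx)
    qed
  qed
  have "(\<integral>\<^sup>+m. ennreal (\<bar>quant (M r) m - quant (M s) m\<bar> powr p) \<partial>Unif) = (\<integral>\<^sup>+m. liminf (\<lambda>k. u k m) \<partial>Unif)"
    by (intro nn_integral_cong) (simp add: lim_imp_Liminf[OF _ lim])
  also have "\<dots> \<le> liminf (\<lambda>k. \<integral>\<^sup>+m. u k m \<partial>Unif)"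
    by (rule nn_integral_liminf) (rule um)
  also have "\<dots> \<le> ennreal (((r - s) * C) powr p)"
  proof (rule Liminf_le)
    have "(\<integral>\<^sup>+m. u k m \<partial>Unif) \<le> ennreal (((r - s) * C) powr p)" for k
    proof -
      have "(\<integral>\<^sup>+m. u k m \<partial>Unif) = ennreal (\<integral>m. \<bar>Z k (quant (M r) m) - Z k (quant (M s) m)\<bar> powr p \<partial>Unif)"
        unfolding u_def by (rule nn_integral_eq_integral) (use T(1) in auto)
      also have "\<dots> \<le> ennreal (((r - s) * C) powr p)" by (intro ennreal_leI T(2))
      finally show ?thesis .
    qed
    then show "eventually (\<lambda>k. (\<integral>\<^sup>+m. u k m \<partial>Unif) \<le> ennreal (((r - s) * C) powr p)) sequentially" by simp
  qed simp
  finally show ?thesis .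
qed

text \<open>The joint law of the two quantile functions under Lebesgue measure on
  \<open>(0,1)\<close> is an admissible coupling, and its cost is the integral estimated in
  \<open>displacement\<close>; optimality plays no part in an upper bound.\<close>

lemma wasserstein_le:
  assumes p: "p \<ge> 2" and sr: "0 \<le> s" "s \<le> r" "r \<le> T" and C: "C \<ge> 0"
    and VC: "\<And>t. t \<in> {0<..<T} \<Longrightarrow> integrable Unif (\<lambda>m. \<bar>V t m\<bar> powr p) \<and> (\<integral>m. \<bar>V t m\<bar> powr p \<partial>Unif) \<le> C powr p"
  shows "wasserstein p (interval_measure (M r)) (interval_measure (M s)) \<le> (r - s) * C"
proof -
  have rsT: "r \<in> {0..T}" "s \<in> {0..T}" using sr by auto
  interpret R: cdf_fun "M r" by (rule cdf_fun_M) fact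
  interpret S: cdf_fun "M s" by (rule cdf_fun_M) fact
  let ?X = "\<lambda>m. (quant (M r) m, quant (M s) m)"
  define \<pi> where "\<pi> = distr Unif borel ?X"
  have Xm: "?X \<in> borel_measurable Unif" by (intro borel_measurable_Pair R.quant_measurable S.quant_measurable)
  have "\<pi> \<in> couplings (interval_measure (M r)) (interval_measure (M s))"
  proof -
    have "distr \<pi> borel fst = interval_measure (M r)" "distr \<pi> borel snd = interval_measure (M s)"
      unfolding \<pi>_def R.distr_quant[symmetric] S.distr_quant[symmetric]
      by (subst distr_distr; use Xm in \<open>auto simp: o_def intro!: borel_measurable_continuous_onI continuous_intros\<close>)+
    then show ?thesis
      unfolding couplings_def using Unif.prob_space_distr[OF Xm] by (simp add: \<pi>_def)
  qed
  then have "(INF \<pi>\<in>couplings (interval_measure (M r)) (interval_measure (M s)). \<integral>\<^sup>+ z. ennreal (\<bar>fst z - snd z\<bar> powr p) \<partial>\<pi>)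
      \<le> (\<integral>\<^sup>+ z. ennreal (\<bar>fst z - snd z\<bar> powr p) \<partial>\<pi>)" by (rule INF_lower)
  also have "\<dots> = (\<integral>\<^sup>+m. ennreal (\<bar>quant (M r) m - quant (M s) m\<bar> powr p) \<partial>Unif)"
    unfolding \<pi>_def by (subst nn_integral_distr[OF Xm]) (auto simp: borel_prod[symmetric])
  also have "\<dots> \<le> ennreal (((r - s) * C) powr p)" by (rule displacement[OF assms])
  finally have fin: "(INF \<pi>\<in>couplings (interval_measure (M r)) (interval_measure (M s)). \<integral>\<^sup>+ z. ennreal (\<bar>fst z - snd z\<bar> powr p) \<partial>\<pi>)
      \<le> ennreal (((r - s) * C) powr p)" .
  have "enn2real (INF \<pi>\<in>couplings (interval_measure (M r)) (interval_measure (M s)). \<integral>\<^sup>+ z. ennreal (\<bar>fst z - snd z\<bar> powr p) \<partial>\<pi>)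
      \<le> ((r - s) * C) powr p" by (intro enn2real_leI fin powr_ge_zero)
  then have "wasserstein p (interval_measure (M r)) (interval_measure (M s)) \<le> (((r - s) * C) powr p) powr (1 / p)"
    unfolding wasserstein_def using p by (intro powr_mono2) auto
  also have "\<dots> = (r - s) * C" using p sr C by (simp add: powr_powr)
  finally show ?thesis .
qed

end

lemma Unif_eq_Iv: "Unif = Iv 0 1"
  by (simp add: Unif_def Iv_def)

text \<open>It rewrites the interval integrals of the theorem as primitives over a fixed measure:
  \<open>B i\<close> over \<open>(0,T)\<close> and, with \<open>T = 1\<close>, \<open>Fcal i\<close>
  over the unit interval.\<close>

lemma interval_integral_eq_primitive:
  fixes f :: "real \<Rightarrow> real"
  assumes f: "set_integrable lborel {0<..<T} f" and t: "0 \<le> t" "t \<le> T"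
  shows "(LBINT s=0..t. f s) = (\<integral>u. indicator {..t} u * f u \<partial>Iv 0 T)"
proof -
  have fm: "(\<lambda>x. indicator {0<..<T} x * f x) \<in> borel_measurable lborel"
    using borel_measurable_integrable[OF f[unfolded set_integrable_def]] by simp
  have "(LBINT s=0..t. f s) = (\<integral>x. indicator {..<t} x * (indicator {0<..<T} x * f x) \<partial>lborel)"
    unfolding interval_lebesgue_integral_def set_lebesgue_integral_def zero_ereal_def
    using t by (auto simp: einterval_eq indicator_def intro!: Bochner_Integration.integral_cong)
  also have "\<dots> = (\<integral>x. indicator {..t} x * (indicator {0<..<T} x * f x) \<partial>lborel)"
  proof (rule integral_cong_AE)
    show "AE x in lborel. indicator {..<t} x * (indicator {0<..<T} x * f x) = indicator {..t} x * (indicator {0<..<T} x * f x)"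
      using AE_lborel_singleton[of t] by eventually_elim (auto simp: indicator_def)
  qed (intro borel_measurable_times fm; simp)+
  also have "\<dots> = (\<integral>u. indicator {..t} u * f u \<partial>Iv 0 T)"
    unfolding integral_Iv set_lebesgue_integral_def by (simp add: mult_ac)
  finally show ?thesis .
qed

lemma cdf_of_class:
  assumes "Pp p \<mu>" shows "cdf_class (cdf_of \<mu>)" "interval_measure (cdf_of \<mu>) = \<mu>"
proof -
  have rd: "real_distribution \<mu>"
    using assms by (auto simp: Pp_def real_distribution_def real_distribution_axioms_def intro: sets_eq_imp_space_eq)
  interpret real_distribution \<mu> by (rule rd)
  have eq: "cdf_of \<mu> = cdf \<mu>" by (simp add: fun_eq_iff cdf_of_def cdf_def)
  show c: "cdf_class (cdf_of \<mu>)"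
    unfolding cdf_class_def eq
    using cdf_nondecreasing cdf_is_right_cont cdf_lim_at_bot cdf_lim_at_top_prob by (auto intro: monoI)
  then interpret c: cdf_fun "cdf_of \<mu>" by (simp add: cdf_fun_def)
  show "interval_measure (cdf_of \<mu>) = \<mu>"
    by (rule cdf_unique[OF c.real_distribution rd]) (rule trans[OF c.cdf_eq eq])
qed

theorem theorem4p14:
  fixes p T :: real
    and \<rho>0 :: "real measure"
    and v0 :: "real \<Rightarrow> real"
    and n :: nat
    and F b :: "nat \<Rightarrow> real \<Rightarrow> real"
    and M0 X0 :: "real \<Rightarrow> real"
    and B Fcal :: "nat \<Rightarrow> real \<Rightarrow> real"
    and U Ft M v :: "real \<Rightarrow> real \<Rightarrow> real"
    and \<rho> :: "real \<Rightarrow> real measure"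
  assumes p: "p \<ge> 2"
    and T: "T > 0"
    and rho0: "Pp p \<rho>0"
    and v0: "Lp p \<rho>0 v0"
    and M0_def: "M0 = cdf_of \<rho>0"
    and X0_def: "X0 = gen_inv M0"
    and F0: "F 0 = (\<lambda>\<omega>. v0 (X0 \<omega>))"
    and F_Lp: "\<forall>i\<in>{1..n}. set_borel_measurable lborel {0<..<1} (F i) \<and>
                 set_integrable lborel {0<..<1} (\<lambda>\<omega>. \<bar>F i \<omega>\<bar> powr p)"
    and b_L1: "\<forall>i\<in>{1..n}. set_integrable lborel {0<..<T} (b i)"
    and B_def: "\<forall>i t. B i t = (if i = 0 then 1 else (LBINT s=0..t. b i s))"
    and Fcal_def: "\<forall>i m. Fcal i m = (LBINT \<omega>=0..m. F i \<omega>)"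
    and U_def: "\<forall>t m. U t m = (\<Sum>i\<le>n. B i t * Fcal i m)"
    and Ft_def: "\<forall>t m. Ft t m = (\<Sum>i\<le>n. B i t * F i m)"
    and entropy: "entropy_solution T U M0 M"
    and M_Rp: "\<forall>t\<in>{0..T}. cdf_class_p p (M t)"
    and rho_def: "\<forall>t. \<rho> t = interval_measure (M t)"
    and v_def: "\<forall>t x. v t x = U_prime (U t) (Ft t) (M t) x"
  shows
    "(\<forall>t\<in>{0<..<T}. Tp p (\<rho> t) (v t))
     \<and> (\<forall>\<phi>. test_fun_open T \<phi> \<longrightarrow>
          set_integrable lborel {0<..<T}
            (\<lambda>t. \<integral>x. dt \<phi> (t, x) + v t x * dx \<phi> (t, x) \<partial>\<rho> t)
        \<and> (LINT t:{0<..<T}|lborel. \<integral>x. dt \<phi> (t, x) + v t x * dx \<phi> (t, x) \<partial>\<rho> t) = 0)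
     \<and> (\<forall>\<phi>. test_fun_open T \<phi> \<longrightarrow>
          set_integrable lborel {0<..<T}
            (\<lambda>t. (\<integral>x. v t x * dt \<phi> (t, x) + (v t x)\<^sup>2 * dx \<phi> (t, x) \<partial>\<rho> t)
                 - (\<Sum>i\<in>{1..n}. b i t * (LINT x|lborel. Fcal i (M t x) * dx \<phi> (t, x))))
        \<and> (LINT t:{0<..<T}|lborel.
              (\<integral>x. v t x * dt \<phi> (t, x) + (v t x)\<^sup>2 * dx \<phi> (t, x) \<partial>\<rho> t)
              - (\<Sum>i\<in>{1..n}. b i t * (LINT x|lborel. Fcal i (M t x) * dx \<phi> (t, x)))) = 0)
     \<and> (\<forall>t\<in>{0<..T}. Pp p (\<rho> t) \<and> Lp p (\<rho> t) (v t))
     \<and> (AE t in lborel. t \<in> {0<..<T} \<longrightarrow>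
          Lp_norm p (\<rho> t) (v t)
            \<le> (\<Sum>i\<le>n. \<bar>B i t\<bar> * (LINT \<omega>:{0<..<1}|lborel. \<bar>F i \<omega>\<bar> powr p) powr (1 / p)))
     \<and> (\<forall>s t. 0 \<le> s \<and> s \<le> t \<and> t \<le> T \<longrightarrow>
          wasserstein p (\<rho> t) (\<rho> s)
            \<le> \<bar>t - s\<bar> * (\<Sum>i\<le>n. (LINT \<omega>:{0<..<1}|lborel. \<bar>F i \<omega>\<bar> powr p) powr (1 / p)
                                  * (SUP \<tau>\<in>{0<..<T}. \<bar>B i \<tau>\<bar>)))"
proof -
  have p1: "p \<ge> 1" using p by simp
  have Mc: "cdf_class (M t)" if "t \<in> {0..T}" for t
    using M_Rp that by (auto simp: cdf_class_p_def)
  interpret c0: cdf_fun M0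
    unfolding M0_def using cdf_of_class(1)[OF rho0] by (simp add: cdf_fun_def)
  have v0m: "v0 \<in> borel_measurable borel" and v0i: "integrable \<rho>0 (\<lambda>x. \<bar>v0 x\<bar> powr p)"
    using v0 rho0 by (auto simp: Lp_def Pp_def cong: measurable_cong_sets)
  have F0m: "F 0 \<in> borel_measurable Unif"
    unfolding F0 X0_def by (rule measurable_compose[OF c0.gen_inv_measurable v0m])
  \<comment> \<open>\<rho>0 is the law of \<open>quant M0\<close>, whereas \<open>F 0\<close> is
    built with \<open>gen_inv M0\<close>; the two inverses agree almost everywhere.\<close>
  have F0i: "integrable Unif (\<lambda>m. \<bar>F 0 m\<bar> powr p)"
  proof -
    note [measurable] = v0m
    have "integrable (interval_measure M0) (\<lambda>x. \<bar>v0 x\<bar> powr p)"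
      using v0i unfolding M0_def cdf_of_class(2)[OF rho0] .
    then have "integrable Unif (\<lambda>m. \<bar>v0 (quant M0 m)\<bar> powr p)"
      by (subst (asm) c0.integrable_quant) auto
    moreover have "AE m in Unif. \<bar>v0 (quant M0 m)\<bar> powr p = \<bar>F 0 m\<bar> powr p"
      using c0.AE_gen_inv_eq_quant by eventually_elim (simp add: F0 X0_def)
    ultimately show ?thesis
      using F0m measurable_compose[OF c0.quant_measurable v0m] by (subst (asm) integrable_cong_AE) auto
  qed
  have Fm: "F i \<in> borel_measurable Unif" and Fp: "integrable Unif (\<lambda>m. \<bar>F i m\<bar> powr p)" if "i \<le> n" for i
    using F_Lp F0m F0i that by (cases "i = 0"; auto simp: measurable_Unif integrable_Unif)+
  have F2: "integrable Unif (\<lambda>m. \<bar>F i m\<bar> powr 2)" if "i \<le> n" for i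
    by (rule integrable_powr_le[OF Unif.finite_measure_axioms Fm[OF that] Fp[OF that]]) (use p in auto)
  have bI: "integrable (Iv 0 T) (b i)" if "i \<in> {1..n}" for i
    using b_L1 that by (simp add: integrable_Iv)
  have Bb: "B i t = (\<integral>u. indicator {..t} u * b i u \<partial>Iv 0 T)" if "i \<in> {1..n}" "t \<in> {0..T}" for i t
    using B_def interval_integral_eq_primitive[of T "b i" t] b_L1 that by simp
  have Bc: "continuous_on {0..T} (B i)" if "i \<le> n" for i
  proof (cases "i = 0")
    case True
    then have "B i = (\<lambda>_. 1)" using B_def by (simp add: fun_eq_iff)
    then show ?thesis by simp
  next
    case False
    with that have i: "i \<in> {1..n}" by auto
    show ?thesis
      using continuous_on_subset[OF continuous_primitive_Iv[OF bI[OF i]] subset_UNIV, of "{0..T}"]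
      by (rule continuous_on_cong[THEN iffD1, rotated 2]) (auto simp: Bb[OF i])
  qed
  have c: "claw0 T n M B F"
    using T Mc entropy Bc Fm F2 unfolding entropy_solution_def by unfold_locales auto
  have Fcal: "Fcal i m = prim (F i) m" if "i \<le> n" "0 \<le> m" "m \<le> 1" for i m
  proof -
    have "set_integrable lborel {0<..<1} (F i)" using claw0.F_int[OF c that(1)] by (simp add: integrable_Unif)
    from interval_integral_eq_primitive[OF this that(2,3)]
    show ?thesis using Fcal_def by (simp add: prim_def Unif_eq_Iv)
  qed
  \<comment> \<open>The fluxes \<open>Fcal i\<close> are identified with \<open>prim (F i)\<close>
    on \<open>[0,1]\<close>, which is where \<open>M\<close> takes its values.\<close>
  interpret C: claw T n M B F
    by (intro claw.intro c claw_axioms.intro)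
      (rule claw0.entropy_imp_weak[OF c entropy _ Fcal], use U_def in auto)
  have Ft: "Ft t = C.Phi t" for t using Ft_def by (simp add: fun_eq_iff C.Phi_def)
  have M01: "0 \<le> M t x \<and> M t x \<le> 1 \<and> 0 \<le> left_lim (M t) x \<and> left_lim (M t) x \<le> 1" if "t \<in> {0..T}" for t x
  proof -
    interpret t: cdf_fun "M t" by (rule C.cdf_fun_M) fact
    show ?thesis using t.F_nonneg t.F_le_1 t.left_lim_nonneg order_trans[OF t.left_lim_le t.F_le_1] by blast
  qed
  \<comment> \<open>\<open>U_prime\<close> evaluates the flux at \<open>M t x\<close> and at its
    left limit. Both lie in \<open>[0,1]\<close>, where \<open>U t\<close> is the primitive of
    \<open>Phi t\<close>.\<close>
  have v: "v t = cdf_fun.avg (M t) (C.Phi t)" if t: "t \<in> {0..T}" for t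
  proof
    fix x
    interpret t: cdf_fun "M t" by (rule C.cdf_fun_M) fact
    have "U t m = prim (C.Phi t) m" if "0 \<le> m" "m \<le> 1" for m
      using U_def Fcal that unfolding C.prim_Phi C.Uf_def by simp
    then show "v t x = t.avg (C.Phi t) x"
      using v_def M01[OF t, of x] by (simp add: U_prime_def t.avg_def Ft)
  qed
  have vm: "v t \<in> borel_measurable borel" if t: "t \<in> {0..T}" for t
    unfolding v[OF t] by (rule cdf_fun.avg_measurable[OF C.cdf_fun_M[OF t] borel_measurable_integrable[OF C.Phi_int] C.Phi_int])
  have vV: "v t (quant (M t) m) = C.V t m" if t: "t \<in> {0..T}" for t m
    unfolding v[OF t] C.V_eq_avg[OF t] ..
  have rho: "\<rho> t = interval_measure (M t)" for t using rho_def by simp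
  have PL: "Pp p (\<rho> t) \<and> Lp p (\<rho> t) (v t)" if t: "t \<in> {0..T}" for t
  proof
    interpret t: cdf_fun "M t" by (rule C.cdf_fun_M) fact
    interpret rd: real_distribution "interval_measure (M t)" by (rule t.real_distribution)
    show "Pp p (\<rho> t)"
      unfolding Pp_def rho using M_Rp t rd.prob_space_axioms by (simp add: cdf_class_p_def)
    note [measurable] = vm[OF t]
    have "integrable (interval_measure (M t)) (\<lambda>x. \<bar>v t x\<bar> powr p)"
      by (subst t.integrable_quant) (use C.V_powr(1)[OF t p1 Fp] in \<open>auto simp: vV[OF t]\<close>)
    then show "Lp p (\<rho> t) (v t)" unfolding Lp_def rho by simp
  qed
  have norm: "Lp_norm p (\<rho> t) (v t) = (\<integral>m. \<bar>C.V t m\<bar> powr p \<partial>Unif) powr (1 / p)" if t: "t \<in> {0..T}" for t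
  proof -
    interpret t: cdf_fun "M t" by (rule C.cdf_fun_M) fact
    note [measurable] = vm[OF t]
    show ?thesis unfolding Lp_norm_def rho by (subst t.integral_quant) (auto simp: vV[OF t])
  qed
  have Tp: "\<forall>t\<in>{0<..<T}. Tp p (\<rho> t) (v t)" using PL by (simp add: Tp_def)
  have mass: "set_integrable lborel {0<..<T} (\<lambda>t. \<integral>x. dt \<phi> (t, x) + v t x * dx \<phi> (t, x) \<partial>\<rho> t)
      \<and> (LINT t:{0<..<T}|lborel. \<integral>x. dt \<phi> (t, x) + v t x * dx \<phi> (t, x) \<partial>\<rho> t) = 0"
    and mom: "set_integrable lborel {0<..<T} (\<lambda>t. (\<integral>x. v t x * dt \<phi> (t, x) + (v t x)\<^sup>2 * dx \<phi> (t, x) \<partial>\<rho> t)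
                 - (\<Sum>i\<in>{1..n}. b i t * (LINT x|lborel. Fcal i (M t x) * dx \<phi> (t, x))))
      \<and> (LINT t:{0<..<T}|lborel. (\<integral>x. v t x * dt \<phi> (t, x) + (v t x)\<^sup>2 * dx \<phi> (t, x) \<partial>\<rho> t)
              - (\<Sum>i\<in>{1..n}. b i t * (LINT x|lborel. Fcal i (M t x) * dx \<phi> (t, x)))) = 0"
    if \<phi>: "test_fun_open T \<phi>" for \<phi>
  proof -
    have sm: "smooth2 \<phi>" using \<phi> by (simp add: test_fun_open_def)
    obtain R L where RL: "R \<ge> 0"
      "\<And>t x. t \<notin> {0<..<T} \<or> \<bar>x\<bar> > R \<Longrightarrow> \<phi> (t, x) = 0 \<and> dx \<phi> (t, x) = 0 \<and> dt \<phi> (t, x) = 0 \<and> dt (dx \<phi>) (t, x) = 0"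
      "\<And>z. \<bar>dx \<phi> z\<bar> \<le> L \<and> \<bar>dt \<phi> z\<bar> \<le> L \<and> \<bar>dt (dx \<phi>) z\<bar> \<le> L"
      using test_fun_open_bounds[OF \<phi>] by blast
    \<comment> \<open>The identification of \<open>v\<close> and \<open>Fcal\<close> with
      \<open>avg\<close> and \<open>prim\<close> is used at interior times, and these are all that
      the set integrals see.\<close>
    have transfer: "set_integrable lborel {0<..<T} f \<and> (LINT t:{0<..<T}|lborel. f t) = 0"
      if g: "integrable (Iv 0 T) g" "(\<integral>t. g t \<partial>Iv 0 T) = 0" and fg: "\<And>t. t \<in> {0<..<T} \<Longrightarrow> f t = g t" for f g :: "real \<Rightarrow> real"
    proof -
      have "integrable (Iv 0 T) f" by (rule Bochner_Integration.integrable_cong[THEN iffD2, OF refl _ g(1)]) (simp add: fg)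
      moreover have "(\<integral>t. f t \<partial>Iv 0 T) = (\<integral>t. g t \<partial>Iv 0 T)"
        by (intro Bochner_Integration.integral_cong refl) (simp add: fg)
      ultimately show ?thesis using g(2) by (simp add: integrable_Iv integral_Iv)
    qed
    show "set_integrable lborel {0<..<T} (\<lambda>t. \<integral>x. dt \<phi> (t, x) + v t x * dx \<phi> (t, x) \<partial>\<rho> t)
      \<and> (LINT t:{0<..<T}|lborel. \<integral>x. dt \<phi> (t, x) + v t x * dx \<phi> (t, x) \<partial>\<rho> t) = 0"
    proof (rule transfer[OF C.continuity_equation[OF sm RL]])
      fix t assume "t \<in> {0<..<T}"
      then have "t \<in> {0..T}" by auto
      from v[OF this] rho[of t]
      show "(\<integral>x. dt \<phi> (t, x) + v t x * dx \<phi> (t, x) \<partial>\<rho> t)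
          = (\<integral>x. dt \<phi> (t, x) + cdf_fun.avg (M t) (C.Phi t) x * dx \<phi> (t, x) \<partial>interval_measure (M t))"
        by (simp only:)
    qed
    have FM: "Fcal i (M t x) = prim (F i) (M t x)" if "i \<in> {1..n}" "t \<in> {0<..<T}" for i t x
      using Fcal[of i "M t x"] M01[of t x] that by simp
    have B0: "B 0 t = 1" for t using B_def by simp
    show "set_integrable lborel {0<..<T} (\<lambda>t. (\<integral>x. v t x * dt \<phi> (t, x) + (v t x)\<^sup>2 * dx \<phi> (t, x) \<partial>\<rho> t)
                 - (\<Sum>i\<in>{1..n}. b i t * (LINT x|lborel. Fcal i (M t x) * dx \<phi> (t, x))))
      \<and> (LINT t:{0<..<T}|lborel. (\<integral>x. v t x * dt \<phi> (t, x) + (v t x)\<^sup>2 * dx \<phi> (t, x) \<partial>\<rho> t)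
              - (\<Sum>i\<in>{1..n}. b i t * (LINT x|lborel. Fcal i (M t x) * dx \<phi> (t, x)))) = 0"
    proof (rule transfer[OF C.momentum_equation[OF sm RL bI B0 Bb]])
      fix t assume t: "t \<in> {0<..<T}"
      then have "t \<in> {0..T}" by auto
      note v = v[OF this]
      have "(\<Sum>i\<in>{1..n}. b i t * (LINT x|lborel. Fcal i (M t x) * dx \<phi> (t, x)))
          = (\<Sum>i\<in>{1..n}. b i t * C.content \<phi> (F i) t)"
      proof (rule sum.cong[OF refl])
        fix i assume i: "i \<in> {1..n}"
        have "C.content \<phi> (F i) t = (LINT x|lborel. prim (F i) (M t x) * dx \<phi> (t, x))"
          by (rule C.content_def[OF sm RL])
        then show "b i t * (LINT x|lborel. Fcal i (M t x) * dx \<phi> (t, x)) = b i t * C.content \<phi> (F i) t"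
          by (simp only: FM[OF i t])
      qed
      then show "(\<integral>x. v t x * dt \<phi> (t, x) + (v t x)\<^sup>2 * dx \<phi> (t, x) \<partial>\<rho> t)
             - (\<Sum>i\<in>{1..n}. b i t * (LINT x|lborel. Fcal i (M t x) * dx \<phi> (t, x)))
        = (\<integral>x. cdf_fun.avg (M t) (C.Phi t) x * dt \<phi> (t, x) + (cdf_fun.avg (M t) (C.Phi t) x)\<^sup>2 * dx \<phi> (t, x) \<partial>interval_measure (M t))
             - (\<Sum>i\<in>{1..n}. b i t * C.content \<phi> (F i) t)"
        unfolding v rho by (simp only:)
    qed auto
  qed
  have ae: "AE t in lborel. t \<in> {0<..<T} \<longrightarrow> Lp_norm p (\<rho> t) (v t)
      \<le> (\<Sum>i\<le>n. \<bar>B i t\<bar> * (LINT \<omega>:{0<..<1}|lborel. \<bar>F i \<omega>\<bar> powr p) powr (1 / p))"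
    using C.V_powr(2)[OF _ p1 Fp] by (intro AE_I2) (auto simp: norm integral_Unif[symmetric])
  have was: "wasserstein p (\<rho> t) (\<rho> s) \<le> \<bar>t - s\<bar> * (\<Sum>i\<le>n. (LINT \<omega>:{0<..<1}|lborel. \<bar>F i \<omega>\<bar> powr p) powr (1 / p)
      * (SUP \<tau>\<in>{0<..<T}. \<bar>B i \<tau>\<bar>))" if st: "0 \<le> s" "s \<le> t" "t \<le> T" for s t
  proof -
    \<comment> \<open>A bound for the \<open>L^p\<close> norm of the velocity common to all interior
      times, with each \<bar>B i\<bar> replaced by its supremum.\<close>
    define K where "K = (\<Sum>i\<le>n. (\<integral>m. \<bar>F i m\<bar> powr p \<partial>Unif) powr (1 / p) * (SUP \<tau>\<in>{0<..<T}. \<bar>B i \<tau>\<bar>))"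
    obtain c where c: "\<And>i t. i \<le> n \<Longrightarrow> t \<in> {0..T} \<Longrightarrow> \<bar>B i t\<bar> \<le> c" using C.B_bounded by blast
    have le: "(\<integral>m. \<bar>C.V \<tau> m\<bar> powr p \<partial>Unif) powr (1 / p) \<le> K" if \<tau>: "\<tau> \<in> {0<..<T}" for \<tau>
    proof -
      have "(\<integral>m. \<bar>C.V \<tau> m\<bar> powr p \<partial>Unif) powr (1 / p) \<le> (\<Sum>i\<le>n. \<bar>B i \<tau>\<bar> * (\<integral>m. \<bar>F i m\<bar> powr p \<partial>Unif) powr (1 / p))"
        using \<tau> by (intro C.V_powr(2)[OF _ p1 Fp]) auto
      also have "\<dots> \<le> K" unfolding K_def
      proof (rule sum_mono)
        fix i assume i: "i \<in> {..n}"
        have "\<bar>B i \<tau>\<bar> \<le> (SUP \<tau>\<in>{0<..<T}. \<bar>B i \<tau>\<bar>)"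
          by (rule cSUP_upper[OF \<tau>]) (use c i in \<open>auto intro!: bdd_aboveI2[of _ _ c]\<close>)
        then show "\<bar>B i \<tau>\<bar> * (\<integral>m. \<bar>F i m\<bar> powr p \<partial>Unif) powr (1 / p)
            \<le> (\<integral>m. \<bar>F i m\<bar> powr p \<partial>Unif) powr (1 / p) * (SUP \<tau>\<in>{0<..<T}. \<bar>B i \<tau>\<bar>)"
          by (subst mult.commute) (intro mult_left_mono, auto)
      qed
      finally show ?thesis .
    qed
    \<comment> \<open>\<open>K\<close> dominates a norm at the interior time \<open>T / 2\<close>,
      hence it is nonnegative.\<close>
    have K0: "K \<ge> 0" using order_trans[OF powr_ge_zero le[of "T / 2"]] T by simp
    have "wasserstein p (\<rho> t) (\<rho> s) \<le> (t - s) * K" unfolding rho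
    proof (rule C.wasserstein_le[OF p st K0])
      fix \<tau> assume \<tau>: "\<tau> \<in> {0<..<T}"
      have "(\<integral>m. \<bar>C.V \<tau> m\<bar> powr p \<partial>Unif) = ((\<integral>m. \<bar>C.V \<tau> m\<bar> powr p \<partial>Unif) powr (1 / p)) powr p"
        using p by (simp add: powr_powr)
      also have "\<dots> \<le> K powr p" using p by (intro powr_mono2 le \<tau>) auto
      finally show "integrable Unif (\<lambda>m. \<bar>C.V \<tau> m\<bar> powr p) \<and> (\<integral>m. \<bar>C.V \<tau> m\<bar> powr p \<partial>Unif) \<le> K powr p"
        using C.V_powr(1)[OF _ p1 Fp, of \<tau>] \<tau> by simp
    qed
    then show ?thesis using st by (simp add: K_def integral_Unif)
  qed
  show ?thesis
    using Tp mass mom PL ae was by simp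
qed

end
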